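(* Let $p$ be an odd prime, $k$ a perfect ring of characteristic $p$, and $A = W(k)$. Fix any integer $n\geq1$, and let $S_n\subseteq W_n\Omega^1_A$ be the $W_n(A)$-submodule $\bigcap_{j=1}^\infty p^jW_n\Omega^1_A$. Let $E_\cdot^\bullet$ be the Witt complex over $A$ defined in the context, and let $\eta: W_n\Omega^1_A\to E_n^1$ be the natural map (the level $n$, degree $1$ component of the unique morphism of Witt complexes $W_\cdot\Omega^\bullet_A\to E_\cdot^\bullet$). Then $\eta$ induces an isomorphism $W_n\Omega^1_A/S_n\cong E_n^1$.
   Context: $W$, $W_n$ denote $p$-typical Witt vectors. $\varphi: A \to A$ is the Witt vector Frobenius of $A = W(k)$ (an automorphism), while $F, V$ denote Frobenius and Verschiebung on $W(A)$. There is a unique ring homomorphism $s_\varphi: A \to W(A)$ with $F\circ s_\varphi = s_\varphi\circ\varphi$ and such that $s_\varphi(a)$ has ghost components $(a, \varphi(a), \varphi^2(a), \ldots)$; its composite with $W(A)\to W_n(A)$ is also written $s_\varphi$. Every element of $W_n(A)$ is uniquely of the form $\sum_{i=0}^{n-1} s_\varphi(a_i) V^i(1)$ with $a_i \in A$. A Witt complex over a $\mathbf{Z}_{(p)}$-algebra $R$ ($p$ odd) consists of: (i) a pro-differential graded ring $E^{\bullet}_{\cdot} = (E_n^{\bullet})_{n \ge 1}$ (each $E_n^\bullet$ a graded-commutative differential graded ring in non-negative degrees, with restriction maps $E_{n+1}^\bullet \to E_n^\bullet$) and a strict map of pro-rings $\lambda: W_{\cdot}(R) \to E^0_{\cdot}$;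 (ii) a strict map of pro-graded rings $F: E_{\cdot}^{\bullet} \to E_{\cdot-1}^{\bullet}$ with $F\lambda = \lambda F$ and $F d\lambda([r]) = \lambda([r]^{p-1})\, d\lambda([r])$ for all $r \in R$ ($[r]$ the Teichmüller lift); (iii) a strict map of graded $E_{\cdot}^{\bullet}$-modules $V: F_*E_{\cdot-1}^{\bullet} \to E_{\cdot}^{\bullet}$ (i.e. additive with $V(F(\omega)\eta) = \omega V(\eta)$, and similarly on the right) with $V\lambda = \lambda V$, $FdV = d$, $FV = p$. "Strict" means commuting with the restriction maps. The de Rham-Witt complex $W_{\cdot}\Omega^{\bullet}_R$ is the initial object in the category of Witt complexes over $R$; $W_n\Omega^d_R$ is its level $n$, degree $d$ component. Definition of $E_\cdot^\bullet$ (which is a Witt complex over $A$). As abelian groups, for $n\ge 1$: $E_n^0 := W_n(A)$; $E_n^1 := \prod_{i=0}^{n-1} A/p^iA \cdot dV^i(1)$, where $dV^i(1)$ is a formal basis symbol; $E_n^d := 0$ for $d\ge 2$. The ring structure on $E_n^0$ and its maps $R, F, V$ are the usual ones, and $\lambda$ is the identity. $W_n(A)$ acts on the factor $A/p^iA$ of $E_n^1$ through the ring homomorphism $\sum_{j=0}^{n-1} s_\varphi(a_j)V^j(1)\mapsto \sum_{j=0}^{n-1} a_jp^j$. The remaining maps are: $d: E_n^0\to E_n^1$, $d\left(\sum_{i=0}^{n-1} s_\varphi(a_i)V^i(1)\right) = \sum_{i=1}^{n-1} a_i\cdot dV^i(1)$; $R: E_{n+1}^1\to E_n^1$, $R\left(\sum_{i=0}^{n}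 a_i\cdot dV^i(1)\right) = \sum_{i=0}^{n-1} a_i\cdot dV^i(1)$; $F: E_{n+1}^1\to E_n^1$, $F\left(\sum_{i=1}^{n} a_i\cdot dV^i(1)\right) = \sum_{i=0}^{n-1}\varphi(a_{i+1})\cdot dV^i(1)$; $V: E_n^1\to E_{n+1}^1$, $V\left(\sum_{i=1}^{n-1} a_i\cdot dV^i(1)\right) = \sum_{i=1}^{n-1} p\varphi^{-1}(a_i)\cdot dV^{i+1}(1)$. *)

theory Defs
  imports
    "HOL-Library.Poly_Mapping"
    "HOL-Computational_Algebra.Primes"
    "HOL-Algebra.QuotRing"
    "HOL-Algebra.Module"
begin

section \<open>Witt vectors\<close>

subsection \<open>Universal Witt polynomials\<close>

type_synonym 'v int_mpoly = "('v \<Rightarrow>\<^sub>0 nat) \<Rightarrow>\<^sub>0 int"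

definition pvar :: "'v \<Rightarrow> 'v int_mpoly" where
  "pvar v = Poly_Mapping.single (Poly_Mapping.single v 1) 1"

definition eval_mpoly :: "('a, 'm) ring_scheme \<Rightarrow> 'v int_mpoly \<Rightarrow> ('v \<Rightarrow> 'a) \<Rightarrow> 'a" where
  "eval_mpoly R f v =
     finsum R (\<lambda>m. [Poly_Mapping.lookup f m] \<cdot>\<^bsub>R\<^esub>
        finprod R (\<lambda>i. v i [^]\<^bsub>R\<^esub> Poly_Mapping.lookup m i) (Poly_Mapping.keys m))
       (Poly_Mapping.keys f)"

definition witt_poly :: "nat \<Rightarrow> nat \<Rightarrow> (nat \<Rightarrow> 'b::comm_ring_1) \<Rightarrow> 'b" where
  "witt_poly p n x = (\<Sum>i\<le>n. of_nat p ^ i * x i ^ (p ^ (n - i)))"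

text \<open>The unique sequence of integral polynomials with prescribed ghost components. It exists
  for the three choices of \<open>\<Phi>\<close> below by Witt's theorem.\<close>

definition witt_lift :: "nat \<Rightarrow> (nat \<Rightarrow> 'v int_mpoly) \<Rightarrow> nat \<Rightarrow> 'v int_mpoly" where
  "witt_lift p \<Phi> = (THE S. \<forall>n. witt_poly p n S = \<Phi> n)"

definition witt_add_poly :: "nat \<Rightarrow> nat \<Rightarrow> (nat + nat) int_mpoly" where
  "witt_add_poly p = witt_lift p
     (\<lambda>n. witt_poly p n (\<lambda>i. pvar (Inl i)) + witt_poly p n (\<lambda>i. pvar (Inr i)))"

definition witt_mult_poly :: "nat \<Rightarrow> nat \<Rightarrow> (nat + nat) int_mpoly" where
  "witt_mult_poly p = witt_lift p
     (\<lambda>n. witt_poly p n (\<lambda>i. pvar (Inl i)) * witt_poly p n (\<lambda>i. pvar (Inr i)))"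

definition witt_frob_poly :: "nat \<Rightarrow> nat \<Rightarrow> nat int_mpoly" where
  "witt_frob_poly p = witt_lift p (\<lambda>n. witt_poly p (Suc n) pvar)"

subsection \<open>The rings of Witt vectors and their operators\<close>

text \<open>For \<open>I = UNIV\<close>, \<open>witt_ring p I R\<close> is \<open>W(R)\<close>. For \<open>I = {..<n}\<close> it is \<open>W\<^sub>n(R)\<close>, where a
  truncated Witt vector \<open>(x\<^sub>0, \<dots>, x\<^sub>n\<^sub>-\<^sub>1)\<close> is represented by its extension by zero and the operations
  of \<open>W(R)\<close> are truncated.\<close>

definition wtrunc :: "nat set \<Rightarrow> ('a, 'm) ring_scheme \<Rightarrow> (nat \<Rightarrow> 'a) \<Rightarrow> nat \<Rightarrow> 'a" where
  "wtrunc I R x = (\<lambda>i. if i \<in> I then x i else \<zero>\<^bsub>R\<^esub>)"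

definition teich :: "('a, 'm) ring_scheme \<Rightarrow> 'a \<Rightarrow> nat \<Rightarrow> 'a" where
  "teich R r = (\<lambda>i. if i = 0 then r else \<zero>\<^bsub>R\<^esub>)"

definition witt_ring :: "nat \<Rightarrow> nat set \<Rightarrow> ('a, 'm) ring_scheme \<Rightarrow> (nat \<Rightarrow> 'a) ring" where
  "witt_ring p I R =
     \<lparr>carrier = {x. (\<forall>i. x i \<in> carrier R) \<and> (\<forall>i. i \<notin> I \<longrightarrow> x i = \<zero>\<^bsub>R\<^esub>)},
      mult = (\<lambda>x y. wtrunc I R (\<lambda>i. eval_mpoly R (witt_mult_poly p i) (case_sum x y))),
      one = wtrunc I R (teich R \<one>\<^bsub>R\<^esub>),
      zero = (\<lambda>i. \<zero>\<^bsub>R\<^esub>),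
      add = (\<lambda>x y. wtrunc I R (\<lambda>i. eval_mpoly R (witt_add_poly p i) (case_sum x y)))\<rparr>"

abbreviation W :: "nat \<Rightarrow> ('a, 'm) ring_scheme \<Rightarrow> (nat \<Rightarrow> 'a) ring" where
  "W p R \<equiv> witt_ring p UNIV R"

abbreviation Wn :: "nat \<Rightarrow> nat \<Rightarrow> ('a, 'm) ring_scheme \<Rightarrow> (nat \<Rightarrow> 'a) ring" where
  "Wn p n R \<equiv> witt_ring p {..<n} R"

abbreviation witt_res :: "nat \<Rightarrow> ('a, 'm) ring_scheme \<Rightarrow> (nat \<Rightarrow> 'a) \<Rightarrow> nat \<Rightarrow> 'a" where
  "witt_res n R x \<equiv> wtrunc {..<n} R x"

definition witt_ghost :: "nat \<Rightarrow> ('a, 'm) ring_scheme \<Rightarrow> nat \<Rightarrow> (nat \<Rightarrow> 'a) \<Rightarrow> 'a" where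
  "witt_ghost p R n x = (\<Oplus>\<^bsub>R\<^esub>i\<in>{..n}. [(p ^ i)] \<cdot>\<^bsub>R\<^esub> (x i [^]\<^bsub>R\<^esub> (p ^ (n - i))))"

text \<open>In the next two definitions, \<open>I\<close> indexes the components of the result:
  \<open>I = {..<n}\<close> gives \<open>F: W\<^sub>n\<^sub>+\<^sub>1(R) \<rightarrow> W\<^sub>n(R)\<close>, while \<open>I = {..<Suc n}\<close> gives
  \<open>V: W\<^sub>n(R) \<rightarrow> W\<^sub>n\<^sub>+\<^sub>1(R)\<close>.\<close>

definition witt_frob :: "nat \<Rightarrow> nat set \<Rightarrow> ('a, 'm) ring_scheme \<Rightarrow> (nat \<Rightarrow> 'a) \<Rightarrow> nat \<Rightarrow> 'a" where
  "witt_frob p I R x = wtrunc I R (\<lambda>i. eval_mpoly R (witt_frob_poly p i) x)"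

definition witt_ver :: "nat set \<Rightarrow> ('a, 'm) ring_scheme \<Rightarrow> (nat \<Rightarrow> 'a) \<Rightarrow> nat \<Rightarrow> 'a" where
  "witt_ver I R x = wtrunc I R (\<lambda>i. case i of 0 \<Rightarrow> \<zero>\<^bsub>R\<^esub> | Suc j \<Rightarrow> x j)"

section \<open>Witt complexes\<close>

text \<open>\<open>cmp E n d\<close> is the additive group \<open>E\<^sub>n\<^sup>d\<close>; its fields \<open>mult\<close> and \<open>one\<close> are not used
  (compare the library's records of modules). The other operations are
  \<open>mul E n i j: E\<^sub>n\<^sup>i \<times> E\<^sub>n\<^sup>j \<rightarrow> E\<^sub>n\<^sup>i\<^sup>+\<^sup>j\<close> with unit \<open>unt E n\<close>,
  \<open>diff E n d: E\<^sub>n\<^sup>d \<rightarrow> E\<^sub>n\<^sup>d\<^sup>+\<^sup>1\<close>,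
  \<open>res E n d, frob E n d: E\<^sub>n\<^sub>+\<^sub>1\<^sup>d \<rightarrow> E\<^sub>n\<^sup>d\<close>,
  \<open>ver E n d: E\<^sub>n\<^sup>d \<rightarrow> E\<^sub>n\<^sub>+\<^sub>1\<^sup>d\<close> and \<open>lam E n: W\<^sub>n(R) \<rightarrow> E\<^sub>n\<^sup>0\<close>.
  Only the levels \<open>n \<ge> 1\<close> are meaningful.\<close>

record ('r, 'e) witt_cx =
  cmp :: "nat \<Rightarrow> nat \<Rightarrow> 'e ring"
  unt :: "nat \<Rightarrow> 'e"
  mul :: "nat \<Rightarrow> nat \<Rightarrow> nat \<Rightarrow> 'e \<Rightarrow> 'e \<Rightarrow> 'e"
  diff :: "nat \<Rightarrow> nat \<Rightarrow> 'e \<Rightarrow> 'e"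
  res :: "nat \<Rightarrow> nat \<Rightarrow> 'e \<Rightarrow> 'e"
  frob :: "nat \<Rightarrow> nat \<Rightarrow> 'e \<Rightarrow> 'e"
  ver :: "nat \<Rightarrow> nat \<Rightarrow> 'e \<Rightarrow> 'e"
  lam :: "nat \<Rightarrow> (nat \<Rightarrow> 'r) \<Rightarrow> 'e"

text \<open>\<open>(-1)\<^sup>m x\<close>\<close>

definition signed :: "('e, 'm) ring_scheme \<Rightarrow> nat \<Rightarrow> 'e \<Rightarrow> 'e" where
  "signed G m x = (if even m then x else \<ominus>\<^bsub>G\<^esub> x)"

definition Zp_algebra :: "nat \<Rightarrow> ('r, 'm) ring_scheme \<Rightarrow> bool" where
  "Zp_algebra p R \<longleftrightarrow> cring R \<and> (\<forall>m::nat. \<not> p dvd m \<longrightarrow> [m] \<cdot>\<^bsub>R\<^esub> \<one>\<^bsub>R\<^esub> \<in> Units R)"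

locale witt_complex =
  fixes p :: nat and R :: "'r ring" and E :: "('r, 'e) witt_cx"
  assumes prime_p: "prime p" and odd_p: "odd p" and Zp_alg: "Zp_algebra p R"
    \<comment> \<open>each level is a graded-commutative differential graded ring\<close>
    and grp: "1 \<le> n \<Longrightarrow> abelian_group (cmp E n d)"
    and unt_closed: "1 \<le> n \<Longrightarrow> unt E n \<in> carrier (cmp E n 0)"
    and mul_closed: "\<lbrakk>1 \<le> n; x \<in> carrier (cmp E n i); y \<in> carrier (cmp E n j)\<rbrakk> \<Longrightarrow>
      mul E n i j x y \<in> carrier (cmp E n (i + j))"
    and mul_assoc: "\<lbrakk>1 \<le> n; x \<in> carrier (cmp E n i); y \<in> carrier (cmp E n j);
        z \<in> carrier (cmp E n l)\<rbrakk> \<Longrightarrow>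
      mul E n (i + j) l (mul E n i j x y) z = mul E n i (j + l) x (mul E n j l y z)"
    and mul_unt_left: "\<lbrakk>1 \<le> n; x \<in> carrier (cmp E n i)\<rbrakk> \<Longrightarrow> mul E n 0 i (unt E n) x = x"
    and mul_unt_right: "\<lbrakk>1 \<le> n; x \<in> carrier (cmp E n i)\<rbrakk> \<Longrightarrow> mul E n i 0 x (unt E n) = x"
    and mul_add_left: "\<lbrakk>1 \<le> n; x \<in> carrier (cmp E n i); y \<in> carrier (cmp E n i);
        z \<in> carrier (cmp E n j)\<rbrakk> \<Longrightarrow>
      mul E n i j (x \<oplus>\<^bsub>cmp E n i\<^esub> y) z = mul E n i j x z \<oplus>\<^bsub>cmp E n (i + j)\<^esub> mul E n i j y z"
    and mul_add_right: "\<lbrakk>1 \<le> n; x \<in> carrier (cmp E n i); y \<in> carrier (cmp E n j);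
        z \<in> carrier (cmp E n j)\<rbrakk> \<Longrightarrow>
      mul E n i j x (y \<oplus>\<^bsub>cmp E n j\<^esub> z) = mul E n i j x y \<oplus>\<^bsub>cmp E n (i + j)\<^esub> mul E n i j x z"
    and mul_comm: "\<lbrakk>1 \<le> n; x \<in> carrier (cmp E n i); y \<in> carrier (cmp E n j)\<rbrakk> \<Longrightarrow>
      mul E n i j x y = signed (cmp E n (i + j)) (i * j) (mul E n j i y x)"
    and diff_closed: "\<lbrakk>1 \<le> n; x \<in> carrier (cmp E n i)\<rbrakk> \<Longrightarrow>
      diff E n i x \<in> carrier (cmp E n (Suc i))"
    and diff_add: "\<lbrakk>1 \<le> n; x \<in> carrier (cmp E n i); y \<in> carrier (cmp E n i)\<rbrakk> \<Longrightarrow>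
      diff E n i (x \<oplus>\<^bsub>cmp E n i\<^esub> y) = diff E n i x \<oplus>\<^bsub>cmp E n (Suc i)\<^esub> diff E n i y"
    and diff_mul: "\<lbrakk>1 \<le> n; x \<in> carrier (cmp E n i); y \<in> carrier (cmp E n j)\<rbrakk> \<Longrightarrow>
      diff E n (i + j) (mul E n i j x y) =
        mul E n (Suc i) j (diff E n i x) y \<oplus>\<^bsub>cmp E n (Suc (i + j))\<^esub>
        signed (cmp E n (Suc (i + j))) i (mul E n i (Suc j) x (diff E n j y))"
    and diff_diff: "\<lbrakk>1 \<le> n; x \<in> carrier (cmp E n i)\<rbrakk> \<Longrightarrow>
      diff E n (Suc i) (diff E n i x) = \<zero>\<^bsub>cmp E n (Suc (Suc i))\<^esub>"
    \<comment> \<open>the restriction maps are morphisms of differential graded rings\<close>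
    and res_closed: "\<lbrakk>1 \<le> n; x \<in> carrier (cmp E (Suc n) i)\<rbrakk> \<Longrightarrow> res E n i x \<in> carrier (cmp E n i)"
    and res_add: "\<lbrakk>1 \<le> n; x \<in> carrier (cmp E (Suc n) i); y \<in> carrier (cmp E (Suc n) i)\<rbrakk> \<Longrightarrow>
      res E n i (x \<oplus>\<^bsub>cmp E (Suc n) i\<^esub> y) = res E n i x \<oplus>\<^bsub>cmp E n i\<^esub> res E n i y"
    and res_mul: "\<lbrakk>1 \<le> n; x \<in> carrier (cmp E (Suc n) i); y \<in> carrier (cmp E (Suc n) j)\<rbrakk> \<Longrightarrow>
      res E n (i + j) (mul E (Suc n) i j x y) = mul E n i j (res E n i x) (res E n j y)"
    and res_unt: "1 \<le> n \<Longrightarrow> res E n 0 (unt E (Suc n)) = unt E n"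
    and res_diff: "\<lbrakk>1 \<le> n; x \<in> carrier (cmp E (Suc n) i)\<rbrakk> \<Longrightarrow>
      res E n (Suc i) (diff E (Suc n) i x) = diff E n i (res E n i x)"
    \<comment> \<open>\<open>\<lambda>\<close> is a strict map of pro-rings\<close>
    and lam_closed: "\<lbrakk>1 \<le> n; a \<in> carrier (Wn p n R)\<rbrakk> \<Longrightarrow> lam E n a \<in> carrier (cmp E n 0)"
    and lam_add: "\<lbrakk>1 \<le> n; a \<in> carrier (Wn p n R); b \<in> carrier (Wn p n R)\<rbrakk> \<Longrightarrow>
      lam E n (a \<oplus>\<^bsub>Wn p n R\<^esub> b) = lam E n a \<oplus>\<^bsub>cmp E n 0\<^esub> lam E n b"
    and lam_mul: "\<lbrakk>1 \<le> n; a \<in> carrier (Wn p n R); b \<in> carrier (Wn p n R)\<rbrakk> \<Longrightarrow>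
      lam E n (a \<otimes>\<^bsub>Wn p n R\<^esub> b) = mul E n 0 0 (lam E n a) (lam E n b)"
    and lam_one: "1 \<le> n \<Longrightarrow> lam E n \<one>\<^bsub>Wn p n R\<^esub> = unt E n"
    and lam_res: "\<lbrakk>1 \<le> n; a \<in> carrier (Wn p (Suc n) R)\<rbrakk> \<Longrightarrow>
      res E n 0 (lam E (Suc n) a) = lam E n (witt_res n R a)"
    \<comment> \<open>\<open>F\<close> is a strict map of pro-graded rings\<close>
    and frob_closed: "\<lbrakk>1 \<le> n; x \<in> carrier (cmp E (Suc n) i)\<rbrakk> \<Longrightarrow> frob E n i x \<in> carrier (cmp E n i)"
    and frob_add: "\<lbrakk>1 \<le> n; x \<in> carrier (cmp E (Suc n) i); y \<in> carrier (cmp E (Suc n) i)\<rbrakk> \<Longrightarrow>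
      frob E n i (x \<oplus>\<^bsub>cmp E (Suc n) i\<^esub> y) = frob E n i x \<oplus>\<^bsub>cmp E n i\<^esub> frob E n i y"
    and frob_mul: "\<lbrakk>1 \<le> n; x \<in> carrier (cmp E (Suc n) i); y \<in> carrier (cmp E (Suc n) j)\<rbrakk> \<Longrightarrow>
      frob E n (i + j) (mul E (Suc n) i j x y) = mul E n i j (frob E n i x) (frob E n j y)"
    and frob_unt: "1 \<le> n \<Longrightarrow> frob E n 0 (unt E (Suc n)) = unt E n"
    and frob_res: "\<lbrakk>1 \<le> n; x \<in> carrier (cmp E (Suc (Suc n)) i)\<rbrakk> \<Longrightarrow>
      frob E n i (res E (Suc n) i x) = res E n i (frob E (Suc n) i x)"
    and frob_lam: "\<lbrakk>1 \<le> n; a \<in> carrier (Wn p (Suc n) R)\<rbrakk> \<Longrightarrow>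
      frob E n 0 (lam E (Suc n) a) = lam E n (witt_frob p {..<n} R a)"
    and frob_diff_teich: "\<lbrakk>1 \<le> n; r \<in> carrier R\<rbrakk> \<Longrightarrow>
      frob E n 1 (diff E (Suc n) 0 (lam E (Suc n) (teich R r))) =
        mul E n 0 1 (lam E n (teich R r [^]\<^bsub>Wn p n R\<^esub> (p - 1)))
          (diff E n 0 (lam E n (teich R r)))"
    \<comment> \<open>\<open>V\<close> is a strict map of graded modules\<close>
    and ver_closed: "\<lbrakk>1 \<le> n; x \<in> carrier (cmp E n i)\<rbrakk> \<Longrightarrow> ver E n i x \<in> carrier (cmp E (Suc n) i)"
    and ver_add: "\<lbrakk>1 \<le> n; x \<in> carrier (cmp E n i); y \<in> carrier (cmp E n i)\<rbrakk> \<Longrightarrow>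
      ver E n i (x \<oplus>\<^bsub>cmp E n i\<^esub> y) = ver E n i x \<oplus>\<^bsub>cmp E (Suc n) i\<^esub> ver E n i y"
    and ver_mul_left: "\<lbrakk>1 \<le> n; x \<in> carrier (cmp E (Suc n) i); y \<in> carrier (cmp E n j)\<rbrakk> \<Longrightarrow>
      ver E n (i + j) (mul E n i j (frob E n i x) y) = mul E (Suc n) i j x (ver E n j y)"
    and ver_mul_right: "\<lbrakk>1 \<le> n; y \<in> carrier (cmp E n j); x \<in> carrier (cmp E (Suc n) i)\<rbrakk> \<Longrightarrow>
      ver E n (j + i) (mul E n j i y (frob E n i x)) = mul E (Suc n) j i (ver E n j y) x"
    and ver_res: "\<lbrakk>1 \<le> n; x \<in> carrier (cmp E (Suc n) i)\<rbrakk> \<Longrightarrow>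
      ver E n i (res E n i x) = res E (Suc n) i (ver E (Suc n) i x)"
    and ver_lam: "\<lbrakk>1 \<le> n; a \<in> carrier (Wn p n R)\<rbrakk> \<Longrightarrow>
      ver E n 0 (lam E n a) = lam E (Suc n) (witt_ver {..<Suc n} R a)"
    and frob_diff_ver: "\<lbrakk>1 \<le> n; x \<in> carrier (cmp E n i)\<rbrakk> \<Longrightarrow>
      frob E n (Suc i) (diff E (Suc n) i (ver E n i x)) = diff E n i x"
    and frob_ver: "\<lbrakk>1 \<le> n; x \<in> carrier (cmp E n i)\<rbrakk> \<Longrightarrow>
      frob E n i (ver E n i x) = [p] \<cdot>\<^bsub>cmp E n i\<^esub> x"

definition witt_complex_hom ::
  "nat \<Rightarrow> 'r ring \<Rightarrow> ('r, 'e) witt_cx \<Rightarrow> ('r, 'f) witt_cx \<Rightarrow> (nat \<Rightarrow> nat \<Rightarrow> 'e \<Rightarrow> 'f) \<Rightarrow> bool"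
  where
  "witt_complex_hom p R D E h \<longleftrightarrow> (\<forall>n\<ge>1.
     (\<forall>i. h n i \<in> hom (add_monoid (cmp D n i)) (add_monoid (cmp E n i))) \<and>
     h n 0 (unt D n) = unt E n \<and>
     (\<forall>i j. \<forall>x\<in>carrier (cmp D n i). \<forall>y\<in>carrier (cmp D n j).
        h n (i + j) (mul D n i j x y) = mul E n i j (h n i x) (h n j y)) \<and>
     (\<forall>i. \<forall>x\<in>carrier (cmp D n i). h n (Suc i) (diff D n i x) = diff E n i (h n i x)) \<and>
     (\<forall>i. \<forall>x\<in>carrier (cmp D (Suc n) i). h n i (res D n i x) = res E n i (h (Suc n) i x)) \<and>
     (\<forall>i. \<forall>x\<in>carrier (cmp D (Suc n) i). h n i (frob D n i x) = frob E n i (h (Suc n) i x)) \<and>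
     (\<forall>i. \<forall>x\<in>carrier (cmp D n i). h (Suc n) i (ver D n i x) = ver E n i (h n i x)) \<and>
     (\<forall>a\<in>carrier (Wn p n R). h n 0 (lam D n a) = lam E n a))"

section \<open>The de Rham-Witt complex\<close>

text \<open>Existence and uniqueness of a morphism; maps are compared on the carriers only.\<close>

definition unique_witt_complex_hom ::
  "nat \<Rightarrow> 'r ring \<Rightarrow> ('r, 'e) witt_cx \<Rightarrow> ('r, 'f) witt_cx \<Rightarrow> bool" where
  "unique_witt_complex_hom p R D E \<longleftrightarrow>
     (\<exists>h. witt_complex_hom p R D E h \<and>
       (\<forall>h'. witt_complex_hom p R D E h' \<longrightarrow>
          (\<forall>n\<ge>1. \<forall>i. \<forall>x\<in>carrier (cmp D n i). h' n i x = h n i x)))"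

text \<open>Terms in the operations of a Witt complex. \<open>TMul i j\<close> records the degrees of the factors.\<close>

datatype 'r wterm =
    TLam "nat \<Rightarrow> 'r"
  | TZero
  | TOne
  | TAdd "'r wterm" "'r wterm"
  | TNeg "'r wterm"
  | TMul nat nat "'r wterm" "'r wterm"
  | TDiff "'r wterm"
  | TRes "'r wterm"
  | TFrob "'r wterm"
  | TVer "'r wterm"

text \<open>HOL cannot quantify over all types inside a formula, so initiality is required with respect
  to the Witt complexes carried by two fixed types: the type carrying the complex itself, and
  a type large enough to carry an initial object. By \<open>de_rham_witt_universal\<close> below this gives
  initiality among the Witt complexes carried by arbitrary types, and by \<open>de_rham_witt_exists\<close>
  such a complex exists.\<close>

definition is_de_rham_witt :: "nat \<Rightarrow> 'r ring \<Rightarrow> ('r, 'e) witt_cx \<Rightarrow> bool" where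
  "is_de_rham_witt p R Om \<longleftrightarrow> witt_complex p R Om \<and>
     (\<forall>D :: ('r, 'e) witt_cx. witt_complex p R D \<longrightarrow> unique_witt_complex_hom p R Om D) \<and>
     (\<forall>D :: ('r, 'r wterm set) witt_cx. witt_complex p R D \<longrightarrow> unique_witt_complex_hom p R Om D)"

subsection \<open>Universality and existence\<close>

text \<open>An initial object is constructed as the term model of the axioms of a Witt complex, which
  are equations between terms. \<open>weq p R n d s t\<close> states that \<open>s\<close> and \<open>t\<close> are well-formed terms of
  level \<open>n\<close> and degree \<open>d\<close> whose equality follows from the axioms.\<close>

fun tmult :: "nat \<Rightarrow> 'r wterm \<Rightarrow> 'r wterm" where
  "tmult 0 t = TZero"
| "tmult (Suc m) t = TAdd (tmult m t) t"

definition tsigned :: "nat \<Rightarrow> 'r wterm \<Rightarrow> 'r wterm" where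
  "tsigned m t = (if even m then t else TNeg t)"

inductive weq :: "nat \<Rightarrow> 'r ring \<Rightarrow> nat \<Rightarrow> nat \<Rightarrow> 'r wterm \<Rightarrow> 'r wterm \<Rightarrow> bool" for p R where
  sym: "weq p R n d s t \<Longrightarrow> weq p R n d t s"
| trans: "weq p R n d s t \<Longrightarrow> weq p R n d t u \<Longrightarrow> weq p R n d s u"
| c_lam: "1 \<le> n \<Longrightarrow> a \<in> carrier (Wn p n R) \<Longrightarrow> weq p R n 0 (TLam a) (TLam a)"
| c_zero: "1 \<le> n \<Longrightarrow> weq p R n d TZero TZero"
| c_one: "1 \<le> n \<Longrightarrow> weq p R n 0 TOne TOne"
| c_add: "weq p R n d s s' \<Longrightarrow> weq p R n d t t' \<Longrightarrow> weq p R n d (TAdd s t) (TAdd s' t')"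
| c_neg: "weq p R n d s s' \<Longrightarrow> weq p R n d (TNeg s) (TNeg s')"
| c_mul: "weq p R n i s s' \<Longrightarrow> weq p R n j t t' \<Longrightarrow>
    weq p R n (i + j) (TMul i j s t) (TMul i j s' t')"
| c_diff: "weq p R n d s s' \<Longrightarrow> weq p R n (Suc d) (TDiff s) (TDiff s')"
| c_res: "1 \<le> n \<Longrightarrow> weq p R (Suc n) d s s' \<Longrightarrow> weq p R n d (TRes s) (TRes s')"
| c_frob: "1 \<le> n \<Longrightarrow> weq p R (Suc n) d s s' \<Longrightarrow> weq p R n d (TFrob s) (TFrob s')"
| c_ver: "weq p R n d s s' \<Longrightarrow> weq p R (Suc n) d (TVer s) (TVer s')"
| add_assoc: "weq p R n d s s \<Longrightarrow> weq p R n d t t \<Longrightarrow> weq p R n d u u \<Longrightarrow>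
    weq p R n d (TAdd (TAdd s t) u) (TAdd s (TAdd t u))"
| add_comm: "weq p R n d s s \<Longrightarrow> weq p R n d t t \<Longrightarrow> weq p R n d (TAdd s t) (TAdd t s)"
| add_zero: "weq p R n d s s \<Longrightarrow> weq p R n d (TAdd TZero s) s"
| add_neg: "weq p R n d s s \<Longrightarrow> weq p R n d (TAdd (TNeg s) s) TZero"
| mul_assoc: "weq p R n i s s \<Longrightarrow> weq p R n j t t \<Longrightarrow> weq p R n l u u \<Longrightarrow>
    weq p R n (i + j + l) (TMul (i + j) l (TMul i j s t) u) (TMul i (j + l) s (TMul j l t u))"
| mul_one_left: "weq p R n d s s \<Longrightarrow> weq p R n d (TMul 0 d TOne s) s"
| mul_one_right: "weq p R n d s s \<Longrightarrow> weq p R n d (TMul d 0 s TOne) s"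
| mul_add_left: "weq p R n i s s \<Longrightarrow> weq p R n i t t \<Longrightarrow> weq p R n j u u \<Longrightarrow>
    weq p R n (i + j) (TMul i j (TAdd s t) u) (TAdd (TMul i j s u) (TMul i j t u))"
| mul_add_right: "weq p R n i s s \<Longrightarrow> weq p R n j t t \<Longrightarrow> weq p R n j u u \<Longrightarrow>
    weq p R n (i + j) (TMul i j s (TAdd t u)) (TAdd (TMul i j s t) (TMul i j s u))"
| mul_comm: "weq p R n i s s \<Longrightarrow> weq p R n j t t \<Longrightarrow>
    weq p R n (i + j) (TMul i j s t) (tsigned (i * j) (TMul j i t s))"
| diff_add: "weq p R n d s s \<Longrightarrow> weq p R n d t t \<Longrightarrow>
    weq p R n (Suc d) (TDiff (TAdd s t)) (TAdd (TDiff s) (TDiff t))"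
| diff_mul: "weq p R n i s s \<Longrightarrow> weq p R n j t t \<Longrightarrow>
    weq p R n (Suc (i + j)) (TDiff (TMul i j s t))
      (TAdd (TMul (Suc i) j (TDiff s) t) (tsigned i (TMul i (Suc j) s (TDiff t))))"
| diff_diff: "weq p R n d s s \<Longrightarrow> weq p R n (Suc (Suc d)) (TDiff (TDiff s)) TZero"
| res_add: "1 \<le> n \<Longrightarrow> weq p R (Suc n) d s s \<Longrightarrow> weq p R (Suc n) d t t \<Longrightarrow>
    weq p R n d (TRes (TAdd s t)) (TAdd (TRes s) (TRes t))"
| res_mul: "1 \<le> n \<Longrightarrow> weq p R (Suc n) i s s \<Longrightarrow> weq p R (Suc n) j t t \<Longrightarrow>
    weq p R n (i + j) (TRes (TMul i j s t)) (TMul i j (TRes s) (TRes t))"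
| res_one: "1 \<le> n \<Longrightarrow> weq p R n 0 (TRes TOne) TOne"
| res_diff: "1 \<le> n \<Longrightarrow> weq p R (Suc n) d s s \<Longrightarrow>
    weq p R n (Suc d) (TRes (TDiff s)) (TDiff (TRes s))"
| lam_add: "1 \<le> n \<Longrightarrow> a \<in> carrier (Wn p n R) \<Longrightarrow> b \<in> carrier (Wn p n R) \<Longrightarrow>
    weq p R n 0 (TLam (a \<oplus>\<^bsub>Wn p n R\<^esub> b)) (TAdd (TLam a) (TLam b))"
| lam_mul: "1 \<le> n \<Longrightarrow> a \<in> carrier (Wn p n R) \<Longrightarrow> b \<in> carrier (Wn p n R) \<Longrightarrow>
    weq p R n 0 (TLam (a \<otimes>\<^bsub>Wn p n R\<^esub> b)) (TMul 0 0 (TLam a) (TLam b))"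
| lam_one: "1 \<le> n \<Longrightarrow> weq p R n 0 (TLam \<one>\<^bsub>Wn p n R\<^esub>) TOne"
| lam_res: "1 \<le> n \<Longrightarrow> a \<in> carrier (Wn p (Suc n) R) \<Longrightarrow>
    weq p R n 0 (TRes (TLam a)) (TLam (witt_res n R a))"
| frob_add: "1 \<le> n \<Longrightarrow> weq p R (Suc n) d s s \<Longrightarrow> weq p R (Suc n) d t t \<Longrightarrow>
    weq p R n d (TFrob (TAdd s t)) (TAdd (TFrob s) (TFrob t))"
| frob_mul: "1 \<le> n \<Longrightarrow> weq p R (Suc n) i s s \<Longrightarrow> weq p R (Suc n) j t t \<Longrightarrow>
    weq p R n (i + j) (TFrob (TMul i j s t)) (TMul i j (TFrob s) (TFrob t))"
| frob_one: "1 \<le> n \<Longrightarrow> weq p R n 0 (TFrob TOne) TOne"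
| frob_res: "1 \<le> n \<Longrightarrow> weq p R (Suc (Suc n)) d s s \<Longrightarrow>
    weq p R n d (TFrob (TRes s)) (TRes (TFrob s))"
| frob_lam: "1 \<le> n \<Longrightarrow> a \<in> carrier (Wn p (Suc n) R) \<Longrightarrow>
    weq p R n 0 (TFrob (TLam a)) (TLam (witt_frob p {..<n} R a))"
| frob_diff_teich: "1 \<le> n \<Longrightarrow> r \<in> carrier R \<Longrightarrow>
    weq p R n 1 (TFrob (TDiff (TLam (teich R r))))
      (TMul 0 1 (TLam (teich R r [^]\<^bsub>Wn p n R\<^esub> (p - 1))) (TDiff (TLam (teich R r))))"
| ver_add: "weq p R n d s s \<Longrightarrow> weq p R n d t t \<Longrightarrow>
    weq p R (Suc n) d (TVer (TAdd s t)) (TAdd (TVer s) (TVer t))"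
| ver_mul_left: "1 \<le> n \<Longrightarrow> weq p R (Suc n) i s s \<Longrightarrow> weq p R n j t t \<Longrightarrow>
    weq p R (Suc n) (i + j) (TVer (TMul i j (TFrob s) t)) (TMul i j s (TVer t))"
| ver_mul_right: "1 \<le> n \<Longrightarrow> weq p R n j t t \<Longrightarrow> weq p R (Suc n) i s s \<Longrightarrow>
    weq p R (Suc n) (j + i) (TVer (TMul j i t (TFrob s))) (TMul j i (TVer t) s)"
| ver_res: "1 \<le> n \<Longrightarrow> weq p R (Suc n) d s s \<Longrightarrow>
    weq p R (Suc n) d (TVer (TRes s)) (TRes (TVer s))"
| ver_lam: "1 \<le> n \<Longrightarrow> a \<in> carrier (Wn p n R) \<Longrightarrow>
    weq p R (Suc n) 0 (TVer (TLam a)) (TLam (witt_ver {..<Suc n} R a))"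
| frob_diff_ver: "weq p R n d s s \<Longrightarrow> weq p R n (Suc d) (TFrob (TDiff (TVer s))) (TDiff s)"
| frob_ver: "weq p R n d s s \<Longrightarrow> weq p R n d (TFrob (TVer s)) (tmult p s)"

lemma weq_level: "weq p R n d s t \<Longrightarrow> 1 \<le> n"
  by (induction rule: weq.induct) auto

lemma weq_refl1: "weq p R n d s t \<Longrightarrow> weq p R n d s s"
  and weq_refl2: "weq p R n d s t \<Longrightarrow> weq p R n d t t"
  by (blast intro: weq.sym weq.trans)+

definition tcls :: "nat \<Rightarrow> 'r ring \<Rightarrow> nat \<Rightarrow> nat \<Rightarrow> 'r wterm \<Rightarrow> 'r wterm set" where
  "tcls p R n d s = {t. weq p R n d s t}"

definition trep :: "'r wterm set \<Rightarrow> 'r wterm" where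
  "trep X = (SOME t. t \<in> X)"

lemma tcls_eqI: "weq p R n d s t \<Longrightarrow> tcls p R n d s = tcls p R n d t"
  unfolding tcls_def by (blast intro: weq.sym weq.trans)

lemma trep_tcls: "weq p R n d s s \<Longrightarrow> weq p R n d (trep (tcls p R n d s)) s"
  unfolding trep_def tcls_def by (metis (mono_tags) mem_Collect_eq someI weq.sym)

definition term_cx :: "nat \<Rightarrow> 'r ring \<Rightarrow> ('r, 'r wterm set) witt_cx" where
  "term_cx p R =
     \<lparr>cmp = (\<lambda>n d. \<lparr>carrier = {tcls p R n d s | s. weq p R n d s s},
        mult = undefined, one = undefined, zero = tcls p R n d TZero,
        add = (\<lambda>X Y. tcls p R n d (TAdd (trep X) (trep Y)))\<rparr>),
      unt = (\<lambda>n. tcls p R n 0 TOne),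
      mul = (\<lambda>n i j X Y. tcls p R n (i + j) (TMul i j (trep X) (trep Y))),
      diff = (\<lambda>n d X. tcls p R n (Suc d) (TDiff (trep X))),
      res = (\<lambda>n d X. tcls p R n d (TRes (trep X))),
      frob = (\<lambda>n d X. tcls p R n d (TFrob (trep X))),
      ver = (\<lambda>n d X. tcls p R (Suc n) d (TVer (trep X))),
      lam = (\<lambda>n a. tcls p R n 0 (TLam a))\<rparr>"

lemma eval_mpoly_closed:
  assumes "cring R" "\<And>i. v i \<in> carrier R"
  shows "eval_mpoly R f v \<in> carrier R"
proof -
  interpret cring R by fact
  show ?thesis
    unfolding eval_mpoly_def
    by (intro finsum_closed Pi_I add.int_pow_closed finprod_closed nat_pow_closed assms(2))
qed

lemma teich_pow_closed:
  assumes "cring R" "r \<in> carrier R" "1 \<le> n"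
  shows "teich R r [^]\<^bsub>Wn p n R\<^esub> (m::nat) \<in> carrier (Wn p n R)"
proof (induction m)
  case 0
  interpret cring R by fact
  show ?case by (auto simp: nat_pow_def witt_ring_def wtrunc_def teich_def)
next
  case (Suc m)
  interpret cring R by fact
  show ?case
    using Suc assms(2)
    by (auto simp: nat_pow_def witt_ring_def wtrunc_def teich_def split: sum.splits
        intro!: eval_mpoly_closed assms(1))
qed

lemma teich_closed:
  assumes "cring R" "r \<in> carrier R" "1 \<le> n"
  shows "teich R r \<in> carrier (Wn p n R)"
proof -
  interpret cring R by fact
  show ?thesis using assms by (auto simp: witt_ring_def teich_def)
qed

context
  fixes p :: nat and R :: "'r ring"
begin

private abbreviation (input) "tw n d s \<equiv> weq p R n d s s"
private abbreviation (input) "cl \<equiv> tcls p R"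
private abbreviation (input) "T \<equiv> term_cx p R"

lemma carrier_term_cx: "X \<in> carrier (cmp T n d) \<longleftrightarrow> (\<exists>s. tw n d s \<and> X = cl n d s)"
  by (auto simp: term_cx_def)

lemma carrier_term_cxE:
  assumes "X \<in> carrier (cmp T n d)" obtains s where "tw n d s" "X = cl n d s"
  using assms carrier_term_cx by blast

lemma cl_closed: "tw n d s \<Longrightarrow> cl n d s \<in> carrier (cmp T n d)"
  using carrier_term_cx by blast

lemma term_zero: "\<zero>\<^bsub>cmp T n d\<^esub> = cl n d TZero"
  by (simp add: term_cx_def)

lemma term_unt: "unt T n = cl n 0 TOne"
  by (simp add: term_cx_def)

lemma term_lam: "lam T n a = cl n 0 (TLam a)"
  by (simp add: term_cx_def)

lemma term_add: "tw n d s \<Longrightarrow> tw n d t \<Longrightarrow> cl n d s \<oplus>\<^bsub>cmp T n d\<^esub> cl n d t = cl n d (TAdd s t)"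
  by (simp add: term_cx_def) (intro tcls_eqI weq.c_add trep_tcls; assumption)

lemma term_mul: "tw n i s \<Longrightarrow> tw n j t \<Longrightarrow>
    mul T n i j (cl n i s) (cl n j t) = cl n (i + j) (TMul i j s t)"
  by (simp add: term_cx_def) (intro tcls_eqI weq.c_mul trep_tcls; assumption)

lemma term_diff: "tw n d s \<Longrightarrow> diff T n d (cl n d s) = cl n (Suc d) (TDiff s)"
  by (simp add: term_cx_def) (intro tcls_eqI weq.c_diff trep_tcls; assumption)

lemma term_res: "1 \<le> n \<Longrightarrow> tw (Suc n) d s \<Longrightarrow> res T n d (cl (Suc n) d s) = cl n d (TRes s)"
  by (simp add: term_cx_def) (intro tcls_eqI weq.c_res trep_tcls; simp)

lemma term_frob: "1 \<le> n \<Longrightarrow> tw (Suc n) d s \<Longrightarrow> frob T n d (cl (Suc n) d s) = cl n d (TFrob s)"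
  by (simp add: term_cx_def) (intro tcls_eqI weq.c_frob trep_tcls; simp)

lemma term_ver: "tw n d s \<Longrightarrow> ver T n d (cl n d s) = cl (Suc n) d (TVer s)"
  by (simp add: term_cx_def) (intro tcls_eqI weq.c_ver trep_tcls; assumption)

lemma wf_tsigned: "tw n d s \<Longrightarrow> tw n d (tsigned m s)"
  by (simp add: tsigned_def weq.c_neg)

lemma wf_tmult: "tw n d s \<Longrightarrow> tw n d (tmult m s)"
  by (induction m) (auto intro: weq.c_zero weq.c_add dest: weq_level)

lemma abelian_group_term_cx: "1 \<le> n \<Longrightarrow> abelian_group (cmp T n d)"
proof (rule abelian_groupI, goal_cases)
  case (1 x y)
  then show ?case by (elim carrier_term_cxE) (simp add: term_add cl_closed weq.c_add)
next
  case 2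
  then show ?case by (simp add: term_zero cl_closed weq.c_zero)
next
  case (3 x y z)
  then show ?case
    by (elim carrier_term_cxE) (simp add: term_add weq.c_add, rule tcls_eqI, rule weq.add_assoc; assumption)
next
  case (4 x y)
  then show ?case by (elim carrier_term_cxE) (simp add: term_add, rule tcls_eqI, rule weq.add_comm; assumption)
next
  case (5 x)
  then show ?case
    by (elim carrier_term_cxE) (simp add: term_add term_zero weq.c_zero, rule tcls_eqI, rule weq.add_zero; assumption)
next
  case (6 x)
  then obtain s where s: "tw n d s" "x = cl n d s" by (elim carrier_term_cxE)
  then have "cl n d (TNeg s) \<oplus>\<^bsub>cmp T n d\<^esub> x = \<zero>\<^bsub>cmp T n d\<^esub>"
    by (simp add: term_add term_zero weq.c_neg) (rule tcls_eqI, rule weq.add_neg)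
  then show ?case using s by (blast intro: cl_closed weq.c_neg)
qed

lemma term_neg: assumes "tw n d s" shows "\<ominus>\<^bsub>cmp T n d\<^esub> cl n d s = cl n d (TNeg s)"
proof -
  interpret abelian_group "cmp T n d"
    using assms weq_level abelian_group_term_cx by blast
  show ?thesis
    by (rule minus_equality)
      (use assms in \<open>simp_all add: cl_closed term_add term_zero weq.c_neg tcls_eqI[OF weq.add_neg]\<close>)
qed

lemma term_signed: "tw n d s \<Longrightarrow> signed (cmp T n d) m (cl n d s) = cl n d (tsigned m s)"
  by (simp add: signed_def tsigned_def term_neg)

lemma term_add_pow:
  assumes "tw n d s" shows "[(m::nat)] \<cdot>\<^bsub>cmp T n d\<^esub> cl n d s = cl n d (tmult m s)"
proof -
  interpret abelian_group "cmp T n d"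
    using assms weq_level abelian_group_term_cx by blast
  show ?thesis
    by (induction m) (use assms in \<open>simp_all add: term_zero term_add wf_tmult cl_closed\<close>)
qed

lemma tw_mul: "tw n i s \<Longrightarrow> tw n j t \<Longrightarrow> l = i + j \<Longrightarrow> tw n l (TMul i j s t)"
  by (simp add: weq.c_mul)

lemmas tw_intros = weq.c_lam weq.c_zero weq.c_one weq.c_add weq.c_neg tw_mul weq.c_diff
  weq.c_res weq.c_frob weq.c_ver wf_tsigned wf_tmult

lemmas term_ops = term_zero term_unt term_lam term_add term_mul term_diff term_res term_frob
  term_ver term_signed term_add_pow

lemma cl_mul_assoc: "tw n i s \<Longrightarrow> tw n j t \<Longrightarrow> tw n l u \<Longrightarrow>
    cl n (i + j + l) (TMul (i + j) l (TMul i j s t) u) =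
    cl n (i + (j + l)) (TMul i (j + l) s (TMul j l t u))"
  using tcls_eqI[OF weq.mul_assoc] by (simp only: add.assoc)

lemma witt_complex_term_cx:
  assumes "prime p" "odd p" "Zp_algebra p R"
  shows "witt_complex p R T"
proof (rule witt_complex.intro, goal_cases)
  case 1 show ?case by fact
next
  case 2 show ?case by fact
next
  case 3 show ?case by fact
next
  case (4 n d)
  then show ?case by (rule abelian_group_term_cx)
next
  case 5
  then show ?case
    by (auto elim!: carrier_term_cxE simp: term_ops tw_intros intro!: cl_closed)
next
  case 6
  then show ?case
    by (auto elim!: carrier_term_cxE simp: term_ops tw_intros intro!: cl_closed)
next
  case 7
  then show ?case
    by - ((elim carrier_term_cxE)?, simp add: term_ops tw_intros, (rule cl_mul_assoc; assumption))
next
  case 8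
  then show ?case
    by - ((elim carrier_term_cxE)?, simp add: term_ops tw_intros, (intro tcls_eqI weq.mul_one_left; simp)?)
next
  case 9
  then show ?case
    by - ((elim carrier_term_cxE)?, simp add: term_ops tw_intros, (intro tcls_eqI weq.mul_one_right; simp)?)
next
  case 10
  then show ?case
    by - ((elim carrier_term_cxE)?, simp add: term_ops tw_intros, (intro tcls_eqI weq.mul_add_left; simp)?)
next
  case 11
  then show ?case
    by - ((elim carrier_term_cxE)?, simp add: term_ops tw_intros, (intro tcls_eqI weq.mul_add_right; simp)?)
next
  case (12 n x i y j)
  then obtain s t where st: "tw n i s" "x = cl n i s" "tw n j t" "y = cl n j t"
    by (elim carrier_term_cxE)
  have "signed (cmp T n (i + j)) (i * j) (cl n (i + j) (TMul j i t s)) =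
      cl n (i + j) (tsigned (i * j) (TMul j i t s))"
    by (rule term_signed, rule tw_mul) (use st in simp_all)
  then show ?case
    using st tcls_eqI[OF weq.mul_comm[OF st(1,3)]] by (simp add: term_mul add.commute[of j i])
next
  case 13
  then show ?case
    by (auto elim!: carrier_term_cxE simp: term_ops tw_intros intro!: cl_closed)
next
  case 14
  then show ?case
    by - ((elim carrier_term_cxE)?, simp add: term_ops tw_intros, (intro tcls_eqI weq.diff_add; simp)?)
next
  case 15
  then show ?case
    by - ((elim carrier_term_cxE)?, simp add: term_ops tw_intros, (intro tcls_eqI weq.diff_mul; simp)?)
next
  case 16
  then show ?case
    by - ((elim carrier_term_cxE)?, simp add: term_ops tw_intros, (intro tcls_eqI weq.diff_diff; simp)?)
next
  case 17
  then show ?case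
    by (auto elim!: carrier_term_cxE simp: term_ops tw_intros intro!: cl_closed)
next
  case 18
  then show ?case
    by - ((elim carrier_term_cxE)?, simp add: term_ops tw_intros, (intro tcls_eqI weq.res_add; simp)?)
next
  case 19
  then show ?case
    by - ((elim carrier_term_cxE)?, simp add: term_ops tw_intros, (intro tcls_eqI weq.res_mul; simp)?)
next
  case 20
  then show ?case
    by - ((elim carrier_term_cxE)?, simp add: term_ops tw_intros, (intro tcls_eqI weq.res_one; simp)?)
next
  case 21
  then show ?case
    by - ((elim carrier_term_cxE)?, simp add: term_ops tw_intros, (intro tcls_eqI weq.res_diff; simp)?)
next
  case 22
  then show ?case
    by (auto elim!: carrier_term_cxE simp: term_ops tw_intros intro!: cl_closed)
next
  case 23
  then show ?case
    by - ((elim carrier_term_cxE)?, simp add: term_ops tw_intros, (intro tcls_eqI weq.lam_add; simp)?)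
next
  case 24
  then show ?case
    by - ((elim carrier_term_cxE)?, simp add: term_ops tw_intros, (intro tcls_eqI weq.lam_mul; simp)?)
next
  case 25
  then show ?case
    by - ((elim carrier_term_cxE)?, simp add: term_ops tw_intros, (intro tcls_eqI weq.lam_one; simp)?)
next
  case 26
  then show ?case
    by - ((elim carrier_term_cxE)?, simp add: term_ops tw_intros, (intro tcls_eqI weq.lam_res; simp)?)
next
  case 27
  then show ?case
    by (auto elim!: carrier_term_cxE simp: term_ops tw_intros intro!: cl_closed)
next
  case 28
  then show ?case
    by - ((elim carrier_term_cxE)?, simp add: term_ops tw_intros, (intro tcls_eqI weq.frob_add; simp)?)
next
  case 29
  then show ?case
    by - ((elim carrier_term_cxE)?, simp add: term_ops tw_intros, (intro tcls_eqI weq.frob_mul; simp)?)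
next
  case 30
  then show ?case
    by - ((elim carrier_term_cxE)?, simp add: term_ops tw_intros, (intro tcls_eqI weq.frob_one; simp)?)
next
  case 31
  then show ?case
    by - ((elim carrier_term_cxE)?, simp add: term_ops tw_intros, (intro tcls_eqI weq.frob_res; simp)?)
next
  case 32
  then show ?case
    by - ((elim carrier_term_cxE)?, simp add: term_ops tw_intros, (intro tcls_eqI weq.frob_lam; simp)?)
next
  case (33 n r)
  have "cring R" using assms(3) by (simp add: Zp_algebra_def)
  then have tw: "tw n 0 (TLam (teich R r))" "tw (Suc n) 0 (TLam (teich R r))"
    "tw n 0 (TLam (teich R r [^]\<^bsub>Wn p n R\<^esub> (p - 1)))"
    using 33 by (simp_all add: weq.c_lam teich_closed teich_pow_closed del: One_nat_def)
  show ?case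
    using tw 33 tcls_eqI[OF weq.frob_diff_teich[OF 33]]
    by (simp add: term_ops tw_intros)
next
  case 34
  then show ?case
    by (auto elim!: carrier_term_cxE simp: term_ops tw_intros intro!: cl_closed)
next
  case 35
  then show ?case
    by - ((elim carrier_term_cxE)?, simp add: term_ops tw_intros, (intro tcls_eqI weq.ver_add; simp)?)
next
  case 36
  then show ?case
    by - ((elim carrier_term_cxE)?, simp add: term_ops tw_intros, (intro tcls_eqI weq.ver_mul_left; simp)?)
next
  case 37
  then show ?case
    by - ((elim carrier_term_cxE)?, simp add: term_ops tw_intros, (intro tcls_eqI weq.ver_mul_right; simp)?)
next
  case 38
  then show ?case
    by - ((elim carrier_term_cxE)?, simp add: term_ops tw_intros, (intro tcls_eqI weq.ver_res; simp)?)
next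
  case 39
  then show ?case
    by - ((elim carrier_term_cxE)?, simp add: term_ops tw_intros, (intro tcls_eqI weq.ver_lam; simp)?)
next
  case 40
  then show ?case
    by - ((elim carrier_term_cxE)?, simp add: term_ops tw_intros, (intro tcls_eqI weq.frob_diff_ver; simp)?)
next
  case 41
  then show ?case
    by - ((elim carrier_term_cxE)?, simp add: term_ops tw_intros, (intro tcls_eqI weq.frob_ver; simp)?)
qed

end

primrec teval :: "('r, 'f) witt_cx \<Rightarrow> 'r wterm \<Rightarrow> nat \<Rightarrow> nat \<Rightarrow> 'f" where
  "teval D (TLam a) n d = lam D n a"
| "teval D TZero n d = \<zero>\<^bsub>cmp D n d\<^esub>"
| "teval D TOne n d = unt D n"
| "teval D (TAdd s t) n d = teval D s n d \<oplus>\<^bsub>cmp D n d\<^esub> teval D t n d"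
| "teval D (TNeg s) n d = \<ominus>\<^bsub>cmp D n d\<^esub> teval D s n d"
| "teval D (TMul i j s t) n d = mul D n i j (teval D s n i) (teval D t n j)"
| "teval D (TDiff s) n d = diff D n (d - 1) (teval D s n (d - 1))"
| "teval D (TRes s) n d = res D n d (teval D s (Suc n) d)"
| "teval D (TFrob s) n d = frob D n d (teval D s (Suc n) d)"
| "teval D (TVer s) n d = ver D (n - 1) d (teval D s (n - 1) d)"

lemma teval_tsigned: "teval D (tsigned m t) n d = signed (cmp D n d) m (teval D t n d)"
  by (simp add: tsigned_def signed_def)

lemma teval_tmult: "teval D (tmult m t) n d = [m] \<cdot>\<^bsub>cmp D n d\<^esub> teval D t n d"
  by (induction m) (simp_all add: add_pow_def nat_pow_def)

context witt_complex
begin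

lemma cring_R: "cring R"
  using Zp_alg by (simp add: Zp_algebra_def)

lemma zero_closed: "1 \<le> n \<Longrightarrow> \<zero>\<^bsub>cmp E n d\<^esub> \<in> carrier (cmp E n d)"
  by (rule abelian_groupE(2)[OF grp])

lemma add_closed: "1 \<le> n \<Longrightarrow> x \<in> carrier (cmp E n d) \<Longrightarrow> y \<in> carrier (cmp E n d) \<Longrightarrow>
    x \<oplus>\<^bsub>cmp E n d\<^esub> y \<in> carrier (cmp E n d)"
  by (rule abelian_groupE(1)[OF grp])

lemma neg_closed: "1 \<le> n \<Longrightarrow> x \<in> carrier (cmp E n d) \<Longrightarrow> \<ominus>\<^bsub>cmp E n d\<^esub> x \<in> carrier (cmp E n d)"
  by (rule abelian_group.a_inv_closed[OF grp])

lemma signed_closed: "1 \<le> n \<Longrightarrow> x \<in> carrier (cmp E n d) \<Longrightarrow>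
    signed (cmp E n d) m x \<in> carrier (cmp E n d)"
  by (simp add: signed_def neg_closed)

lemma mul_closed': "\<lbrakk>1 \<le> n; x \<in> carrier (cmp E n i); y \<in> carrier (cmp E n j); l = i + j\<rbrakk> \<Longrightarrow>
    mul E n i j x y \<in> carrier (cmp E n l)"
  by (simp add: mul_closed)

lemmas op_closed = unt_closed zero_closed add_closed neg_closed signed_closed mul_closed'
  diff_closed res_closed frob_closed ver_closed lam_closed

lemmas eqs = mul_unt_left mul_unt_right mul_add_left mul_add_right diff_add diff_mul diff_diff
  res_add res_mul res_unt res_diff frob_add frob_mul frob_unt frob_res
  ver_add ver_mul_left ver_mul_right ver_res frob_diff_ver frob_ver
  lam_add[symmetric] lam_mul[symmetric] lam_one lam_res frob_lam ver_lam

lemmas mul_assoc_eq = mul_assoc and mul_comm_eq = mul_comm and teich_eq = frob_diff_teich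

lemma lam_closed_eqs:
  "1 \<le> n \<Longrightarrow> a \<in> carrier (Wn p n R) \<Longrightarrow> b \<in> carrier (Wn p n R) \<Longrightarrow>
    lam E n (a \<oplus>\<^bsub>Wn p n R\<^esub> b) \<in> carrier (cmp E n 0)"
  "1 \<le> n \<Longrightarrow> a \<in> carrier (Wn p n R) \<Longrightarrow> b \<in> carrier (Wn p n R) \<Longrightarrow>
    lam E n (a \<otimes>\<^bsub>Wn p n R\<^esub> b) \<in> carrier (cmp E n 0)"
  "1 \<le> n \<Longrightarrow> c \<in> carrier (Wn p (Suc n) R) \<Longrightarrow>
    lam E n (witt_res n R c) \<in> carrier (cmp E n 0)"
  "1 \<le> n \<Longrightarrow> c \<in> carrier (Wn p (Suc n) R) \<Longrightarrow>
    lam E n (witt_frob p {..<n} R c) \<in> carrier (cmp E n 0)"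
  "1 \<le> n \<Longrightarrow> a \<in> carrier (Wn p n R) \<Longrightarrow>
    lam E (Suc n) (witt_ver {..<Suc n} R a) \<in> carrier (cmp E (Suc n) 0)"
  by (simp_all add: lam_add lam_mul lam_closed add_closed mul_closed' res_closed frob_closed
      ver_closed flip: lam_res frob_lam ver_lam)

lemma add_pow_p_closed: "1 \<le> n \<Longrightarrow> x \<in> carrier (cmp E n i) \<Longrightarrow> [p] \<cdot>\<^bsub>cmp E n i\<^esub> x \<in> carrier (cmp E n i)"
  by (simp add: frob_closed ver_closed flip: frob_ver)

lemma teval_sound:
  "weq p R n d s t \<Longrightarrow>
    1 \<le> n \<and> teval E s n d \<in> carrier (cmp E n d) \<and> teval E t n d = teval E s n d"
proof (induction rule: weq.induct)
  case (add_assoc n d s t u)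
  then show ?case
    using abelian_groupE(3)[OF grp, of n] by (simp add: op_closed)
next
  case (add_comm n d s t)
  then show ?case
    using abelian_groupE(4)[OF grp, of n] by (simp add: op_closed)
next
  case (add_zero n d s)
  then show ?case
    using abelian_groupE(5)[OF grp, of n] by (simp add: op_closed)
next
  case (add_neg n d s)
  then show ?case
    using abelian_group.l_neg[OF grp, of n] by (simp add: op_closed)
next
  case (mul_assoc n i s j t l u)
  then show ?case
    using mul_assoc_eq[of n "teval E s n i" i] by (simp add: op_closed)
next
  case (mul_comm n i s j t)
  then show ?case
    using mul_comm_eq[of n "teval E s n i" i "teval E t n j" j]
    by (simp add: op_closed teval_tsigned)
next
  case (frob_diff_teich n r)
  then show ?case
    using teich_eq[of n r] teich_closed[OF cring_R, of r] teich_pow_closed[OF cring_R, of r]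
    by (simp add: op_closed)
qed (simp_all add: op_closed teval_tsigned teval_tmult eqs lam_closed_eqs add_pow_p_closed)

end

lemma witt_complex_hom_hom:
  "witt_complex_hom p R D E h \<Longrightarrow> 1 \<le> n \<Longrightarrow>
    h n i \<in> hom (add_monoid (cmp D n i)) (add_monoid (cmp E n i))"
  unfolding witt_complex_hom_def by blast

lemma witt_complex_hom_closed:
  "witt_complex_hom p R D E h \<Longrightarrow> 1 \<le> n \<Longrightarrow> x \<in> carrier (cmp D n i) \<Longrightarrow>
    h n i x \<in> carrier (cmp E n i)"
  using hom_in_carrier[OF witt_complex_hom_hom, of p R D E h n x i] by simp

lemma witt_complex_hom_add:
  "witt_complex_hom p R D E h \<Longrightarrow> 1 \<le> n \<Longrightarrow> x \<in> carrier (cmp D n i) \<Longrightarrow>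
    y \<in> carrier (cmp D n i) \<Longrightarrow>
    h n i (x \<oplus>\<^bsub>cmp D n i\<^esub> y) = h n i x \<oplus>\<^bsub>cmp E n i\<^esub> h n i y"
  using hom_mult[OF witt_complex_hom_hom, of p R D E h n x i y] by simp

lemma witt_complex_hom_ops:
  assumes "witt_complex_hom p R D E h" "1 \<le> n"
  shows "h n 0 (unt D n) = unt E n"
    and "x \<in> carrier (cmp D n i) \<Longrightarrow> y \<in> carrier (cmp D n j) \<Longrightarrow>
      h n (i + j) (mul D n i j x y) = mul E n i j (h n i x) (h n j y)"
    and "x \<in> carrier (cmp D n i) \<Longrightarrow> h n (Suc i) (diff D n i x) = diff E n i (h n i x)"
    and "x \<in> carrier (cmp D (Suc n) i) \<Longrightarrow> h n i (res D n i x) = res E n i (h (Suc n) i x)"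
    and "x \<in> carrier (cmp D (Suc n) i) \<Longrightarrow> h n i (frob D n i x) = frob E n i (h (Suc n) i x)"
    and "x \<in> carrier (cmp D n i) \<Longrightarrow> h (Suc n) i (ver D n i x) = ver E n i (h n i x)"
    and "a \<in> carrier (Wn p n R) \<Longrightarrow> h n 0 (lam D n a) = lam E n a"
  using assms unfolding witt_complex_hom_def by blast+

lemma witt_complex_hom_group_hom:
  assumes "witt_complex p R D" "witt_complex p R E" "witt_complex_hom p R D E h" "1 \<le> n"
  shows "group_hom (add_monoid (cmp D n i)) (add_monoid (cmp E n i)) (h n i)"
proof (intro group_hom.intro group_hom_axioms.intro)
  show "group (add_monoid (cmp D n i))" "group (add_monoid (cmp E n i))"
    by (rule abelian_group.a_group witt_complex.grp assms)+
  show "h n i \<in> hom (add_monoid (cmp D n i)) (add_monoid (cmp E n i))"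
    using assms by (auto simp: witt_complex_hom_def)
qed

lemma witt_complex_hom_zero:
  assumes "witt_complex p R D" "witt_complex p R E" "witt_complex_hom p R D E h" "1 \<le> n"
  shows "h n i \<zero>\<^bsub>cmp D n i\<^esub> = \<zero>\<^bsub>cmp E n i\<^esub>"
  using group_hom.hom_one[OF witt_complex_hom_group_hom[OF assms]] by simp

lemma witt_complex_hom_neg:
  assumes "witt_complex p R D" "witt_complex p R E" "witt_complex_hom p R D E h" "1 \<le> n"
    and "x \<in> carrier (cmp D n i)"
  shows "h n i (\<ominus>\<^bsub>cmp D n i\<^esub> x) = \<ominus>\<^bsub>cmp E n i\<^esub> h n i x"
  using group_hom.hom_inv[OF witt_complex_hom_group_hom[OF assms(1-4)], of x i] assms(5)
  by (simp add: a_inv_def)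

lemma witt_complex_hom_id: "witt_complex_hom p R D D (\<lambda>n i x. x)"
  by (auto simp: witt_complex_hom_def hom_def)

lemma witt_complex_hom_comp:
  assumes f: "witt_complex_hom p R C D f" and g: "witt_complex_hom p R D E g"
  shows "witt_complex_hom p R C E (\<lambda>n i x. g n i (f n i x))"
  unfolding witt_complex_hom_def
  by (intro allI impI conjI ballI homI)
    (simp_all add: witt_complex_hom_closed[OF f] witt_complex_hom_closed[OF g]
      witt_complex_hom_add[OF f] witt_complex_hom_add[OF g]
      witt_complex_hom_ops[OF f] witt_complex_hom_ops[OF g])

lemma (in witt_complex) witt_complex_term_cx': "witt_complex p R (term_cx p R)"
  by (rule witt_complex_term_cx[OF prime_p odd_p Zp_alg])

lemma (in witt_complex) term_cx_hom:
  "witt_complex_hom p R (term_cx p R) E (\<lambda>n d X. teval E (trep X) n d)"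
proof -
  have ev: "teval E (trep (tcls p R n d s)) n d = teval E s n d" if "weq p R n d s s" for n d s
    using teval_sound[OF trep_tcls[OF that]] by simp
  have cl: "teval E s n d \<in> carrier (cmp E n d)" if "weq p R n d s s" for n d s
    using teval_sound[OF that] by simp
  show ?thesis
    unfolding witt_complex_hom_def
    by (intro allI impI conjI ballI homI; (simp only: partial_object.simps monoid.simps)?;
        (elim carrier_term_cxE)?)
      (simp_all add: term_ops tw_intros ev cl)
qed

lemma (in witt_complex) term_cx_hom_unique:
  assumes h: "witt_complex_hom p R (term_cx p R) E h"
  shows "weq p R n d s t \<Longrightarrow> h n d (tcls p R n d s) = teval E s n d"
proof -
  note T = witt_complex_term_cx'
  let ?T = "term_cx p R" and ?tw = "\<lambda>n d s. weq p R n d s s"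
  let ?h = "\<lambda>n d s. h n d (tcls p R n d s)"
  note tw = tw_intros[where p = p and R = R]
  note ops = term_ops[where p = p and R = R] term_neg[where p = p and R = R]
  note hs = witt_complex_hom_ops[OF h]
  have h_lam: "?h n 0 (TLam a) = lam E n a" if "1 \<le> n" "a \<in> carrier (Wn p n R)" for n a
    using hs(7)[of n a] that by (simp add: ops)
  have h_zero: "?h n d TZero = \<zero>\<^bsub>cmp E n d\<^esub>" if "1 \<le> n" for n d
    using witt_complex_hom_zero[OF T witt_complex_axioms h that] by (simp add: ops)
  have h_one: "?h n 0 TOne = unt E n" if "1 \<le> n" for n
    using hs(1)[of n] that by (simp add: ops)
  have h_add: "?h n d (TAdd s t) = ?h n d s \<oplus>\<^bsub>cmp E n d\<^esub> ?h n d t"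
    if "?tw n d s" "?tw n d t" for n d s t
    using witt_complex_hom_add[OF h weq_level[OF that(1)] cl_closed[OF that(1)] cl_closed[OF that(2)]]
      that by (simp add: ops)
  have h_neg: "?h n d (TNeg s) = \<ominus>\<^bsub>cmp E n d\<^esub> ?h n d s" if "?tw n d s" for n d s
    using witt_complex_hom_neg[OF T witt_complex_axioms h weq_level[OF that] cl_closed[OF that]]
      that by (simp add: ops)
  have h_mul: "?h n l (TMul i j s t) = mul E n i j (?h n i s) (?h n j t)"
    if "?tw n i s" "?tw n j t" "l = i + j" for n i j l s t
    using hs(2)[OF weq_level[OF that(1)] cl_closed[OF that(1)] cl_closed[OF that(2)]]
      that by (simp add: ops)
  have h_diff: "?h n (Suc d) (TDiff s) = diff E n d (?h n d s)" if "?tw n d s" for n d s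
    using hs(3)[OF weq_level[OF that] cl_closed[OF that]] that by (simp add: ops)
  have h_res: "?h n d (TRes s) = res E n d (?h (Suc n) d s)" if "1 \<le> n" "?tw (Suc n) d s" for n d s
    using hs(4)[OF that(1) cl_closed[OF that(2)]] that by (simp add: ops)
  have h_frob: "?h n d (TFrob s) = frob E n d (?h (Suc n) d s)" if "1 \<le> n" "?tw (Suc n) d s" for n d s
    using hs(5)[OF that(1) cl_closed[OF that(2)]] that by (simp add: ops)
  have h_ver: "?h (Suc n) d (TVer s) = ver E n d (?h n d s)" if "?tw n d s" for n d s
    using hs(6)[OF weq_level[OF that] cl_closed[OF that]] that by (simp add: ops)
  note h_ops = h_lam h_zero h_one h_add h_neg h_mul h_diff h_res h_frob h_ver
  have swap: "?h n d s = teval E s n d" if "weq p R n d s t" "?h n d t = teval E t n d" for n d s t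
    using that tcls_eqI[OF that(1)] teval_sound[OF that(1)] by simp
  show "weq p R n d s t \<Longrightarrow> ?h n d s = teval E s n d"
  proof (induction rule: weq.induct)
    case (sym n d s t)
    show ?case by (rule swap[OF weq.sym[OF sym.hyps] sym.IH])
  next
    case (lam_add n a b)
    show ?case
      by (rule swap[OF weq.lam_add]) (use lam_add in \<open>simp_all add: h_ops tw\<close>)
  next
    case (lam_mul n a b)
    show ?case
      by (rule swap[OF weq.lam_mul]) (use lam_mul in \<open>simp_all add: h_ops tw\<close>)
  next
    case (lam_one n)
    show ?case
      by (rule swap[OF weq.lam_one]) (use lam_one in \<open>simp_all add: h_ops tw\<close>)
  next
    case (frob_diff_teich n r)
    then show ?case
      using teich_closed[OF cring_R, of r] by (simp add: h_ops tw)
  next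
    case (add_zero n d s)
    then show ?case using weq_level[OF add_zero.hyps] by (simp add: h_ops tw)
  next
    case (mul_one_left n d s)
    then show ?case using weq_level[OF mul_one_left.hyps] by (simp add: h_ops tw)
  next
    case (mul_one_right n d s)
    then show ?case using weq_level[OF mul_one_right.hyps] by (simp add: h_ops tw)
  next
    case (frob_diff_ver n d s)
    then show ?case using weq_level[OF frob_diff_ver.hyps] by (simp add: h_ops tw)
  next
    case (frob_ver n d s)
    then show ?case using weq_level[OF frob_ver.hyps] by (simp add: h_ops tw)
  next
    case c_add
    then show ?case using weq_refl1[OF c_add.hyps(1)] weq_refl1[OF c_add.hyps(2)] by (simp add: h_ops tw)
  next
    case c_neg
    then show ?case using weq_refl1[OF c_neg.hyps(1)] by (simp add: h_ops tw)
  next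
    case c_mul
    then show ?case using weq_refl1[OF c_mul.hyps(1)] weq_refl1[OF c_mul.hyps(2)] by (simp add: h_ops tw)
  next
    case c_diff
    then show ?case using weq_refl1[OF c_diff.hyps(1)] by (simp add: h_ops tw)
  next
    case c_res
    then show ?case using weq_refl1[OF c_res.hyps(2)] by (simp add: h_ops tw)
  next
    case c_frob
    then show ?case using weq_refl1[OF c_frob.hyps(2)] by (simp add: h_ops tw)
  next
    case c_ver
    then show ?case using weq_refl1[OF c_ver.hyps(1)] by (simp add: h_ops tw)
  qed (simp_all add: h_ops tw)
qed

lemma (in witt_complex) term_cx_universal: "unique_witt_complex_hom p R (term_cx p R) E"
  unfolding unique_witt_complex_hom_def
proof (intro exI conjI allI impI ballI)
  show "witt_complex_hom p R (term_cx p R) E (\<lambda>n d X. teval E (trep X) n d)"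
    by (rule term_cx_hom)
next
  fix h n i X
  assume h: "witt_complex_hom p R (term_cx p R) E h" and n: "1 \<le> n"
    and "X \<in> carrier (cmp (term_cx p R) n i)"
  then obtain s where s: "weq p R n i s s" "X = tcls p R n i s"
    by (elim carrier_term_cxE)
  show "h n i X = teval E (trep X) n i"
    using term_cx_hom_unique[OF h s(1)] teval_sound[OF trep_tcls[OF s(1)]] s(2) by simp
qed

theorem de_rham_witt_exists:
  assumes "prime p" "odd p" "Zp_algebra p R"
  shows "is_de_rham_witt p R (term_cx p R)"
  using assms by (simp add: is_de_rham_witt_def witt_complex_term_cx witt_complex.term_cx_universal)

theorem de_rham_witt_universal:
  fixes Om :: "('r, 'e) witt_cx" and D :: "('r, 'd) witt_cx"
  assumes Om: "is_de_rham_witt p R Om" and D: "witt_complex p R D"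
  shows "unique_witt_complex_hom p R Om D"
proof -
  let ?T = "term_cx p R"
  interpret Om: witt_complex p R Om using Om by (simp add: is_de_rham_witt_def)
  interpret D: witt_complex p R D by fact
  have T: "witt_complex p R ?T" by (rule Om.witt_complex_term_cx')
  obtain f where f: "witt_complex_hom p R Om ?T f"
    using Om T unfolding is_de_rham_witt_def unique_witt_complex_hom_def by blast
  obtain g where g: "witt_complex_hom p R ?T Om g"
    using Om.term_cx_hom by blast
  obtain g' where g': "witt_complex_hom p R ?T D g'"
    using D.term_cx_hom by blast
  obtain e where e: "\<And>h n i x. witt_complex_hom p R Om Om h \<Longrightarrow> 1 \<le> n \<Longrightarrow>
      x \<in> carrier (cmp Om n i) \<Longrightarrow> h n i x = e n i x"
  proof -
    have "unique_witt_complex_hom p R Om Om"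
      using Om Om.witt_complex_axioms by (simp add: is_de_rham_witt_def)
    then show ?thesis using that unfolding unique_witt_complex_hom_def by blast
  qed
  have gf: "g n i (f n i x) = x" if "1 \<le> n" "x \<in> carrier (cmp Om n i)" for n i x
    using e[OF witt_complex_hom_comp[OF f g] that] e[OF witt_complex_hom_id that] by simp
  show ?thesis
    unfolding unique_witt_complex_hom_def
  proof (intro exI conjI allI impI ballI)
    show h0: "witt_complex_hom p R Om D (\<lambda>n i x. g' n i (f n i x))"
      by (rule witt_complex_hom_comp[OF f g'])
    fix h n i x
    assume h: "witt_complex_hom p R Om D h" and x: "1 \<le> n" "x \<in> carrier (cmp Om n i)"
    obtain u where u: "\<And>h n i x. witt_complex_hom p R ?T D h \<Longrightarrow> 1 \<le> n \<Longrightarrow>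
        x \<in> carrier (cmp ?T n i) \<Longrightarrow> h n i x = u n i x"
      using D.term_cx_universal unfolding unique_witt_complex_hom_def by blast
    have fx: "f n i x \<in> carrier (cmp ?T n i)"
      by (rule witt_complex_hom_closed[OF f x])
    show "h n i x = g' n i (f n i x)"
      using u[OF witt_complex_hom_comp[OF g h] x(1) fx] u[OF g' x(1) fx] gf[OF x] by simp
  qed
qed

section \<open>Modules\<close>

definition quot_module :: "('a, 'b, 'm) module_scheme \<Rightarrow> 'b set \<Rightarrow> ('a, 'b set) module" where
  "quot_module M S =
     \<lparr>carrier = a_rcosets\<^bsub>M\<^esub> S, mult = undefined, one = undefined, zero = S, add = set_add M,
      smult = (\<lambda>a X. \<Union>x\<in>X. S +>\<^bsub>M\<^esub> (a \<odot>\<^bsub>M\<^esub> x))\<rparr>"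

definition module_iso ::
  "('a, 'l) ring_scheme \<Rightarrow> ('a, 'b, 'm) module_scheme \<Rightarrow> ('a, 'c, 'n) module_scheme \<Rightarrow> ('b \<Rightarrow> 'c) set"
  where
  "module_iso R M N = {f \<in> iso (add_monoid M) (add_monoid N).
     \<forall>a\<in>carrier R. \<forall>x\<in>carrier M. f (a \<odot>\<^bsub>M\<^esub> x) = a \<odot>\<^bsub>N\<^esub> f x}"

text \<open>\<open>E\<^sub>n\<^sup>d\<close> as a module over \<open>W\<^sub>n(R)\<close>.\<close>

definition cmp_module :: "('r, 'e) witt_cx \<Rightarrow> nat \<Rightarrow> nat \<Rightarrow> (nat \<Rightarrow> 'r, 'e) module" where
  "cmp_module E n d =
     \<lparr>carrier = carrier (cmp E n d), mult = undefined, one = undefined,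
      zero = zero (cmp E n d), add = add (cmp E n d),
      smult = (\<lambda>a x. mul E n 0 d (lam E n a) x)\<rparr>"

text \<open>\<open>\<Inter>\<^sub>j\<^sub>\<ge>\<^sub>1 p\<^sup>j M\<close>\<close>

definition p_divisible_part :: "nat \<Rightarrow> ('a, 'm) ring_scheme \<Rightarrow> 'a set" where
  "p_divisible_part p M = (\<Inter>j\<in>{1::nat..}. (\<lambda>x. [(p ^ j)] \<cdot>\<^bsub>M\<^esub> x) ` carrier M)"

section \<open>The Witt complex \<open>E\<close> over \<open>A = W(k)\<close>\<close>

text \<open>The zero ring is allowed.\<close>

definition perfect_ring :: "nat \<Rightarrow> ('k, 'm) ring_scheme \<Rightarrow> bool" where
  "perfect_ring p k \<longleftrightarrow> cring k \<and> [p] \<cdot>\<^bsub>k\<^esub> \<one>\<^bsub>k\<^esub> = \<zero>\<^bsub>k\<^esub> \<and>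
     bij_betw (\<lambda>x. x [^]\<^bsub>k\<^esub> p) (carrier k) (carrier k)"

definition phi :: "nat \<Rightarrow> ('k, 'm) ring_scheme \<Rightarrow> (nat \<Rightarrow> 'k) \<Rightarrow> (nat \<Rightarrow> 'k)" where
  "phi p k = witt_frob p UNIV k"

definition phi_inv :: "nat \<Rightarrow> ('k, 'm) ring_scheme \<Rightarrow> (nat \<Rightarrow> 'k) \<Rightarrow> (nat \<Rightarrow> 'k)" where
  "phi_inv p k = inv_into (carrier (W p k)) (phi p k)"

text \<open>On the carrier of \<open>A\<close>, \<open>s\<^sub>\<phi>\<close> is determined by its ghost components, so the choice is
  unique there.\<close>

definition s_phi :: "nat \<Rightarrow> ('k, 'm) ring_scheme \<Rightarrow> (nat \<Rightarrow> 'k) \<Rightarrow> nat \<Rightarrow> (nat \<Rightarrow> 'k)" where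
  "s_phi p k = (SOME s. s \<in> ring_hom (W p k) (W p (W p k)) \<and>
     (\<forall>a\<in>carrier (W p k). witt_frob p UNIV (W p k) (s a) = s (phi p k a)) \<and>
     (\<forall>a\<in>carrier (W p k). \<forall>n. witt_ghost p (W p k) n (s a) = (phi p k ^^ n) a))"

text \<open>The coefficients \<open>a\<^sub>i\<close> in \<open>x = \<Sum>\<^sub>i\<^sub><\<^sub>n s\<^sub>\<phi>(a\<^sub>i) V\<^sup>i(1) \<in> W\<^sub>n(A)\<close>.\<close>

definition s_coeffs ::
  "nat \<Rightarrow> ('k, 'm) ring_scheme \<Rightarrow> nat \<Rightarrow> (nat \<Rightarrow> nat \<Rightarrow> 'k) \<Rightarrow> nat \<Rightarrow> (nat \<Rightarrow> 'k)" where
  "s_coeffs p k n x = (THE a. a \<in> {..<n} \<rightarrow>\<^sub>E carrier (W p k) \<and>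
     x = (\<Oplus>\<^bsub>Wn p n (W p k)\<^esub>i\<in>{..<n}. witt_res n (W p k) (s_phi p k (a i)) \<otimes>\<^bsub>Wn p n (W p k)\<^esub>
            (witt_ver {..<n} (W p k) ^^ i) \<one>\<^bsub>Wn p n (W p k)\<^esub>))"

text \<open>The ring homomorphism \<open>W\<^sub>n(A) \<rightarrow> A, \<Sum>\<^sub>j s\<^sub>\<phi>(a\<^sub>j) V\<^sup>j(1) \<mapsto> \<Sum>\<^sub>j a\<^sub>j p\<^sup>j\<close>.\<close>

definition wn_to_A :: "nat \<Rightarrow> ('k, 'm) ring_scheme \<Rightarrow> nat \<Rightarrow> (nat \<Rightarrow> nat \<Rightarrow> 'k) \<Rightarrow> (nat \<Rightarrow> 'k)" where
  "wn_to_A p k n x = (\<Oplus>\<^bsub>W p k\<^esub>j\<in>{..<n}. [(p ^ j)] \<cdot>\<^bsub>W p k\<^esub> s_coeffs p k n x j)"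

abbreviation p_ideal :: "nat \<Rightarrow> ('k, 'm) ring_scheme \<Rightarrow> nat \<Rightarrow> (nat \<Rightarrow> 'k) set" where
  "p_ideal p k i \<equiv> PIdl\<^bsub>W p k\<^esub> ([(p ^ i)] \<cdot>\<^bsub>W p k\<^esub> \<one>\<^bsub>W p k\<^esub>)"

abbreviation A_mod :: "nat \<Rightarrow> ('k, 'm) ring_scheme \<Rightarrow> nat \<Rightarrow> (nat \<Rightarrow> 'k) set ring" where
  "A_mod p k i \<equiv> W p k Quot p_ideal p k i"

abbreviation A_coset :: "nat \<Rightarrow> ('k, 'm) ring_scheme \<Rightarrow> nat \<Rightarrow> (nat \<Rightarrow> 'k) \<Rightarrow> (nat \<Rightarrow> 'k) set" where
  "A_coset p k i a \<equiv> p_ideal p k i +>\<^bsub>W p k\<^esub> a"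

text \<open>The map into \<open>A/p\<^sup>iA\<close> induced by \<open>f: A \<rightarrow> A\<close> on cosets.\<close>

definition coset_map ::
  "nat \<Rightarrow> ('k, 'm) ring_scheme \<Rightarrow> nat \<Rightarrow> ((nat \<Rightarrow> 'k) \<Rightarrow> (nat \<Rightarrow> 'k)) \<Rightarrow> (nat \<Rightarrow> 'k) set \<Rightarrow> (nat \<Rightarrow> 'k) set"
  where
  "coset_map p k i f c = (\<Union>a\<in>c. A_coset p k i (f a))"

text \<open>Homogeneous elements of \<open>E\<^sub>n\<close>, with \<open>'a\<close> the type of elements of \<open>A\<close>: a Witt vector in
  degree 0; in degree 1, the family of the components in \<open>A/p\<^sup>iA\<close> of an element
  of \<open>\<Prod>\<^sub>i\<^sub><\<^sub>n A/p\<^sup>iA \<cdot> dV\<^sup>i(1)\<close>; zero in the degrees \<open>\<ge> 2\<close>.\<close>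

datatype 'a E_elem = Deg0 (un0: "nat \<Rightarrow> 'a") | Deg1 (un1: "nat \<Rightarrow> 'a set") | Null

definition E_cmp :: "nat \<Rightarrow> ('k, 'm) ring_scheme \<Rightarrow> nat \<Rightarrow> nat \<Rightarrow> (nat \<Rightarrow> 'k) E_elem ring" where
  "E_cmp p k n d =
     (if d = 0 then
        \<lparr>carrier = Deg0 ` carrier (Wn p n (W p k)), mult = undefined, one = undefined,
         zero = Deg0 \<zero>\<^bsub>Wn p n (W p k)\<^esub>,
         add = (\<lambda>x y. Deg0 (un0 x \<oplus>\<^bsub>Wn p n (W p k)\<^esub> un0 y))\<rparr>
      else if d = 1 then
        \<lparr>carrier = Deg1 ` (\<Pi>\<^sub>E i\<in>{..<n}. carrier (A_mod p k i)), mult = undefined, one = undefined,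
         zero = Deg1 (\<lambda>i\<in>{..<n}. \<zero>\<^bsub>A_mod p k i\<^esub>),
         add = (\<lambda>x y. Deg1 (\<lambda>i\<in>{..<n}. un1 x i \<oplus>\<^bsub>A_mod p k i\<^esub> un1 y i))\<rparr>
      else
        \<lparr>carrier = {Null}, mult = undefined, one = undefined, zero = Null, add = (\<lambda>x y. Null)\<rparr>)"

definition E_act ::
  "nat \<Rightarrow> ('k, 'm) ring_scheme \<Rightarrow> nat \<Rightarrow> (nat \<Rightarrow> nat \<Rightarrow> 'k) \<Rightarrow> (nat \<Rightarrow> (nat \<Rightarrow> 'k) set) \<Rightarrow> nat \<Rightarrow> (nat \<Rightarrow> 'k) set"
  where
  "E_act p k n x c = (\<lambda>i\<in>{..<n}. A_coset p k i (wn_to_A p k n x) \<otimes>\<^bsub>A_mod p k i\<^esub> c i)"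

definition E_cx :: "nat \<Rightarrow> ('k, 'm) ring_scheme \<Rightarrow> (nat \<Rightarrow> 'k, (nat \<Rightarrow> 'k) E_elem) witt_cx" where
  "E_cx p k =
     \<lparr>cmp = E_cmp p k,
      unt = (\<lambda>n. Deg0 \<one>\<^bsub>Wn p n (W p k)\<^esub>),
      mul = (\<lambda>n i j x y.
        if i = 0 \<and> j = 0 then Deg0 (un0 x \<otimes>\<^bsub>Wn p n (W p k)\<^esub> un0 y)
        else if i = 0 \<and> j = 1 then Deg1 (E_act p k n (un0 x) (un1 y))
        else if i = 1 \<and> j = 0 then Deg1 (E_act p k n (un0 y) (un1 x))
        else Null),
      diff = (\<lambda>n d x.
        if d = 0 then Deg1 (\<lambda>i\<in>{..<n}. A_coset p k i (s_coeffs p k n (un0 x) i)) else Null),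
      res = (\<lambda>n d x.
        if d = 0 then Deg0 (witt_res n (W p k) (un0 x))
        else if d = 1 then Deg1 (restrict (un1 x) {..<n}) else Null),
      frob = (\<lambda>n d x.
        if d = 0 then Deg0 (witt_frob p {..<n} (W p k) (un0 x))
        else if d = 1 then Deg1 (\<lambda>i\<in>{..<n}. coset_map p k i (phi p k) (un1 x (Suc i)))
        else Null),
      ver = (\<lambda>n d x.
        if d = 0 then Deg0 (witt_ver {..<Suc n} (W p k) (un0 x))
        else if d = 1 then
          Deg1 (\<lambda>i\<in>{..<Suc n}. case i of
              0 \<Rightarrow> \<zero>\<^bsub>A_mod p k 0\<^esub>
            | Suc j \<Rightarrow> coset_map p k (Suc j) (\<lambda>a. [p] \<cdot>\<^bsub>W p k\<^esub> phi_inv p k a) (un1 x j))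
        else Null),
      lam = (\<lambda>n a. Deg0 a)\<rparr>"

end

theory Submission
  imports Defs
begin

text \<open>
  In degree one an initial Witt complex \<open>\<Omega>\<close> over \<open>A = W(k)\<close> is spanned by the forms \<open>x dy\<close> with
  \<open>x, y \<in> W\<^sub>n(A)\<close>, because these are preserved by all the operations of a Witt complex. Write
  \<open>y = \<Sum>\<^sub>i s\<^sub>\<phi>(a\<^sub>i) V\<^sup>i(1)\<close>. Since \<open>a\<^sub>i = \<phi>\<^sup>m(b)\<close> for some \<open>b\<close>, and \<open>s\<^sub>\<phi> \<phi> = F s\<^sub>\<phi>\<close> and \<open>dF = pFd\<close>, the
  form \<open>ds\<^sub>\<phi>(a\<^sub>i)\<close> is divisible by every power \<open>p\<^sup>m\<close>. Moreover \<open>pdV = Vd\<close> gives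
  \<open>p\<^sup>i dV\<^sup>i(1) = V\<^sup>i d(1) = 0\<close> and \<open>V\<^sup>j(1) dV\<^sup>i(1) = p\<^sup>j dV\<^sup>i(1)\<close>. Hence modulo the \<open>p\<close>-divisible part
  every form is \<open>\<Sum>\<^sub>i s\<^sub>\<phi>(b\<^sub>i) dV\<^sup>i(1)\<close> with \<open>b\<^sub>i \<in> A\<close>, where only \<open>b\<^sub>i\<close> modulo \<open>p\<^sup>i\<close> matters; its image
  under \<open>\<eta>\<close> is the family of the classes of the \<open>b\<^sub>i\<close>.

  The coefficients exist because \<open>A\<close> is \<open>p\<close>-torsion free and \<open>\<phi>\<close> lifts the Frobenius, so that Witt
  vectors over \<open>A\<close> are determined by their ghost components and Dwork's lemma describes the image of
  the ghost map. Applied to integral polynomials, the same lemma yields the Witt polynomials.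
\<close>

section \<open>Integral polynomials\<close>

text \<open>In characteristic \<open>p\<close> ghost components do not determine a Witt vector, so
  \<open>W(k)\<close> cannot be treated through them directly. An identity is proved for vectors of
  indeterminates over integral polynomials, where \<open>p\<close> can be cancelled, and then
  specialized; reading Witt polynomials modulo \<open>p\<close> gives \<open>F\<close> and
  \<open>p = VF\<close> on the components over \<open>k\<close>. Once \<open>A\<close> is thereby
  torsion free with the Frobenius lift \<phi>, identities in \<open>W_n(A)\<close> can again be
  checked on ghost components.

  An initial complex is accessible only through its morphisms. Generation by forms is therefore a
  statement about subcomplexes: a family of subsets stable under all operations carries a Witt
  complex, and initiality forces it to be everything. The delicate point is stability under
  \<open>F\<close>, because the axioms prescribe \<open>Fdy\<close> only for Teichmueller lifts and
  for images of \<open>V\<close>; every \<open>y\<close> is a sum of one of each.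

  The two sides fit together because \<open>p^n\<close> annihilates \<open>E_n^1\<close>, so that
  \<eta> kills \<open>S_n\<close>, while a normal form with image zero has terms that vanish
  outright, not just modulo \<open>S_n\<close>.\<close>

definition int_mpoly_ring :: "'v int_mpoly ring" where
  "int_mpoly_ring = \<lparr>carrier = UNIV, mult = (*), one = 1, zero = 0, add = (+)\<rparr>"

lemma int_mpoly_ring_simps [simp]:
  "carrier int_mpoly_ring = UNIV" "x \<otimes>\<^bsub>int_mpoly_ring\<^esub> y = x * y" "\<one>\<^bsub>int_mpoly_ring\<^esub> = 1"
  "\<zero>\<^bsub>int_mpoly_ring\<^esub> = 0" "x \<oplus>\<^bsub>int_mpoly_ring\<^esub> y = x + y"
  by (simp_all add: int_mpoly_ring_def)

text \<open>Puts the type-class polynomial ring into the form with an explicit carrier, so that the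
  results on ghost components hold for it and for \<open>W p k\<close> alike.\<close>

interpretation int_mpoly_ring: cring int_mpoly_ring
proof (rule cringI[OF abelian_groupI comm_monoidI], goal_cases)
  case (6 x)
  show ?case by (intro bexI[of _ "- x"]) simp_all
qed (simp_all add: algebra_simps)

lemma int_mpoly_ring_pow [simp]: "x [^]\<^bsub>int_mpoly_ring\<^esub> (n::nat) = x ^ n"
  by (induction n) (simp_all add: mult.commute)

lemma int_mpoly_ring_nat_mult [simp]: "[n] \<cdot>\<^bsub>int_mpoly_ring\<^esub> x = of_nat n * (x :: 'v int_mpoly)"
  for n :: nat
  by (induction n) (simp_all add: algebra_simps)

lemma int_mpoly_ring_finsum [simp]: "finite I \<Longrightarrow> finsum int_mpoly_ring f I = sum f I"
  by (induction I rule: finite_induct) simp_all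

lemma witt_poly_eq_ghost: "witt_poly p n x = witt_ghost p int_mpoly_ring n x"
  by (simp add: witt_poly_def witt_ghost_def)

text \<open>Polynomials are formal integral combinations of monomials, and differences of
  \<open>1\<close> already yield all integers. A property compatible with the ring operations thus
  has to be checked on the variables only.\<close>

lemma int_mpoly_induct [case_names one var diff mult]:
  assumes one: "P 1" and var: "\<And>v. P (pvar v)"
    and diff: "\<And>f g. P f \<Longrightarrow> P g \<Longrightarrow> P (f - g)" and mult: "\<And>f g. P f \<Longrightarrow> P g \<Longrightarrow> P (f * g)"
  shows "P (f :: 'v int_mpoly)"
proof (rule frag_induction[of f UNIV])
  fix m :: "'v \<Rightarrow>\<^sub>0 nat"
  have pow: "P (Poly_Mapping.single (Poly_Mapping.single v c) 1)" for v c
  proof (induction c)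
    case (Suc c)
    have "Poly_Mapping.single (Poly_Mapping.single v (Suc c)) 1 =
        pvar v * Poly_Mapping.single (Poly_Mapping.single v c) (1::int)"
      by (simp add: pvar_def mult_single flip: single_add)
    then show ?case using mult[OF var Suc] by simp
  qed (simp add: one)
  show "P (frag_of m)"
  proof (induction m rule: update_induct)
    case const
    then show ?case by (simp add: one)
  next
    case (update m v c)
    have "Poly_Mapping.update v c m = Poly_Mapping.single v c + m"
      using update(1) by (intro poly_mapping_eqI)
        (auto simp: lookup_update lookup_add lookup_single in_keys_iff when_def)
    then have "frag_of (Poly_Mapping.update v c m) =
        Poly_Mapping.single (Poly_Mapping.single v c) 1 * frag_of m"
      by (simp add: mult_single)
    then show ?case using mult[OF pow update(3)] by simp
  qed
qed (use diff[OF one one] diff in auto)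

subsection \<open>Evaluation\<close>

context cring
begin

lemma zero_int_mult: "[(0::int)] \<cdot> x = \<zero>"
  by (simp add: add_pow_def int_pow_def nat_pow_def)

lemma finprod_monomial_superset:
  assumes "\<And>i. v i \<in> carrier R" "finite K" "Poly_Mapping.keys m \<subseteq> K"
  shows "(\<Otimes>i\<in>Poly_Mapping.keys m. v i [^] Poly_Mapping.lookup m i) =
    (\<Otimes>i\<in>K. v i [^] (Poly_Mapping.lookup m i :: nat))"
  using assms by (intro finprod_mono_neutral_cong_left) (auto simp: in_keys_iff)

lemma eval_mpoly_superset:
  assumes "\<And>i. v i \<in> carrier R" "finite K" "Poly_Mapping.keys f \<subseteq> K"
  shows "eval_mpoly R f v = (\<Oplus>m\<in>K. [Poly_Mapping.lookup f m] \<cdot>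
      (\<Otimes>i\<in>Poly_Mapping.keys m. v i [^] Poly_Mapping.lookup m i))"
  unfolding eval_mpoly_def using assms
  by (intro add.finprod_mono_neutral_cong_left)
    (auto simp: in_keys_iff finprod_closed zero_int_mult)

lemma eval_mpoly_single:
  assumes "\<And>i. v i \<in> carrier R"
  shows "eval_mpoly R (Poly_Mapping.single m c) v =
    [c] \<cdot> (\<Otimes>i\<in>Poly_Mapping.keys m. v i [^] Poly_Mapping.lookup m i)"
  by (subst eval_mpoly_superset[of _ "{m}"]) (use assms in \<open>auto simp: finprod_closed\<close>)

lemma eval_mpoly_add:
  assumes v: "\<And>i. v i \<in> carrier R"
  shows "eval_mpoly R (f + g) v = eval_mpoly R f v \<oplus> eval_mpoly R g v"
proof -
  let ?K = "Poly_Mapping.keys f \<union> Poly_Mapping.keys g"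
  have "eval_mpoly R (f + g) v = (\<Oplus>m\<in>?K. [Poly_Mapping.lookup (f + g) m] \<cdot>
      (\<Otimes>i\<in>Poly_Mapping.keys m. v i [^] Poly_Mapping.lookup m i))"
    using keys_add[of f g] by (intro eval_mpoly_superset) (auto simp: v)
  also have "\<dots> = (\<Oplus>m\<in>?K. [Poly_Mapping.lookup f m] \<cdot>
      (\<Otimes>i\<in>Poly_Mapping.keys m. v i [^] Poly_Mapping.lookup m i) \<oplus>
      [Poly_Mapping.lookup g m] \<cdot>
      (\<Otimes>i\<in>Poly_Mapping.keys m. v i [^] Poly_Mapping.lookup m i))"
    by (intro add.finprod_cong) (auto simp: lookup_add add.int_pow_mult v finprod_closed simp_implies_def)
  also have "\<dots> = eval_mpoly R f v \<oplus> eval_mpoly R g v"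
    by (subst (1 2) eval_mpoly_superset[of _ ?K]) (auto simp: v finprod_closed finsum_addf)
  finally show ?thesis .
qed

lemma eval_mpoly_minus:
  assumes v: "\<And>i. v i \<in> carrier R"
  shows "eval_mpoly R (f - g) v = eval_mpoly R f v \<ominus> eval_mpoly R g v"
proof -
  have "eval_mpoly R (f - g) v \<oplus> eval_mpoly R g v = eval_mpoly R f v"
    by (simp add: v flip: eval_mpoly_add)
  then show ?thesis
    using eval_mpoly_closed[OF cring_axioms v, of f] eval_mpoly_closed[OF cring_axioms v, of g]
      eval_mpoly_closed[OF cring_axioms v, of "f - g"]
    by (simp add: add.inv_solve_right minus_eq)
qed

text \<open>Both sides are biadditive in \<open>f\<close> and \<open>g\<close>, so induction over
  formal combinations in each factor leaves two monomials, where exponents add.\<close>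

lemma eval_mpoly_mult:
  assumes v: "\<And>i. v i \<in> carrier R"
  shows "eval_mpoly R (f * g) v = eval_mpoly R f v \<otimes> eval_mpoly R g v"
proof -
  note cl = eval_mpoly_closed[OF cring_axioms v]
  have 0: "eval_mpoly R 0 v = \<zero>" by (simp add: eval_mpoly_def)
  have mono: "eval_mpoly R (frag_of l * frag_of m) v =
      eval_mpoly R (frag_of l) v \<otimes> eval_mpoly R (frag_of m) v" for l m
  proof -
    let ?K = "Poly_Mapping.keys l \<union> Poly_Mapping.keys m"
    have "(\<Otimes>i\<in>Poly_Mapping.keys (l + m). v i [^] Poly_Mapping.lookup (l + m) i) =
        (\<Otimes>i\<in>?K. v i [^] Poly_Mapping.lookup (l + m) i)"
      using keys_add[of l m] by (intro finprod_monomial_superset) (auto simp: v)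
    also have "\<dots> = (\<Otimes>i\<in>?K. v i [^] Poly_Mapping.lookup l i \<otimes> v i [^] Poly_Mapping.lookup m i)"
      by (intro finprod_cong) (auto simp: v lookup_add nat_pow_mult simp_implies_def)
    also have "\<dots> = (\<Otimes>i\<in>?K. v i [^] Poly_Mapping.lookup l i) \<otimes>
        (\<Otimes>i\<in>?K. v i [^] Poly_Mapping.lookup m i)"
      by (intro finprod_multf) (auto simp: v)
    also have "\<dots> = (\<Otimes>i\<in>Poly_Mapping.keys l. v i [^] Poly_Mapping.lookup l i) \<otimes>
        (\<Otimes>i\<in>Poly_Mapping.keys m. v i [^] Poly_Mapping.lookup m i)"
      by (subst (1 2) finprod_monomial_superset[of v ?K]) (auto simp: v)
    finally have "(\<Otimes>i\<in>Poly_Mapping.keys (l + m). v i [^] Poly_Mapping.lookup (l + m) i) =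
        (\<Otimes>i\<in>Poly_Mapping.keys l. v i [^] Poly_Mapping.lookup l i) \<otimes>
        (\<Otimes>i\<in>Poly_Mapping.keys m. v i [^] Poly_Mapping.lookup m i)" .
    moreover have "(\<Otimes>i\<in>Poly_Mapping.keys l. v i [^] Poly_Mapping.lookup l i) \<in> carrier R"
      "(\<Otimes>i\<in>Poly_Mapping.keys m. v i [^] Poly_Mapping.lookup m i) \<in> carrier R"
      by (intro finprod_closed Pi_I nat_pow_closed v)+
    ultimately show ?thesis
      by (simp only: mult_single eval_mpoly_single[OF v] mult_1 add.int_pow_1 m_closed)
  qed
  have single: "eval_mpoly R (frag_of l * g) v = eval_mpoly R (frag_of l) v \<otimes> eval_mpoly R g v" for l
  proof (rule frag_induction[of g UNIV])
    fix a b assume ab: "eval_mpoly R (frag_of l * a) v = eval_mpoly R (frag_of l) v \<otimes> eval_mpoly R a v"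
      "eval_mpoly R (frag_of l * b) v = eval_mpoly R (frag_of l) v \<otimes> eval_mpoly R b v"
    show "eval_mpoly R (frag_of l * (a - b)) v = eval_mpoly R (frag_of l) v \<otimes> eval_mpoly R (a - b) v"
      unfolding right_diff_distrib eval_mpoly_minus[OF v] ab
      by (simp add: cl minus_eq r_distr r_minus)
  qed (simp_all only: mono subset_UNIV mult_zero_right 0 r_null cl)
  show ?thesis
  proof (rule frag_induction[of f UNIV])
    fix a b assume ab: "eval_mpoly R (a * g) v = eval_mpoly R a v \<otimes> eval_mpoly R g v"
      "eval_mpoly R (b * g) v = eval_mpoly R b v \<otimes> eval_mpoly R g v"
    show "eval_mpoly R ((a - b) * g) v = eval_mpoly R (a - b) v \<otimes> eval_mpoly R g v"
      unfolding left_diff_distrib eval_mpoly_minus[OF v] ab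
      by (simp add: cl minus_eq l_distr l_minus)
  qed (simp_all only: single subset_UNIV mult_zero_left 0 l_null cl)
qed

lemma eval_mpoly_one: "(\<And>i. v i \<in> carrier R) \<Longrightarrow> eval_mpoly R 1 v = \<one>"
  using eval_mpoly_single[of v 0 1] by simp

lemma eval_mpoly_pvar: "(\<And>i. v i \<in> carrier R) \<Longrightarrow> eval_mpoly R (pvar i) v = v i"
  using eval_mpoly_single[of v "Poly_Mapping.single i 1" 1] by (simp add: pvar_def)

lemma eval_mpoly_ring_hom:
  "(\<And>i. v i \<in> carrier R) \<Longrightarrow> (\<lambda>f. eval_mpoly R f v) \<in> ring_hom int_mpoly_ring R"
  by (intro ring_hom_memI)
    (simp_all add: eval_mpoly_closed cring_axioms eval_mpoly_add eval_mpoly_mult eval_mpoly_one)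

end

lemma ring_hom_eval_mpoly:
  assumes "cring R" "cring S" "h \<in> ring_hom R S" "\<And>i. v i \<in> carrier R"
  shows "h (eval_mpoly R f v) = eval_mpoly S f (\<lambda>i. h (v i))"
proof -
  interpret ring_hom_cring R S h
    using assms(1-3) by (simp add: ring_hom_cring_def ring_hom_cring_axioms_def)
  note cl = eval_mpoly_closed[OF \<open>cring R\<close> assms(4)]
  have v: "h (v i) \<in> carrier S" for i
    using assms(4) by simp
  show ?thesis
    by (induction f rule: int_mpoly_induct)
      (simp_all add: assms(4) v cl R.eval_mpoly_one S.eval_mpoly_one R.eval_mpoly_pvar
        S.eval_mpoly_pvar R.eval_mpoly_minus S.eval_mpoly_minus R.eval_mpoly_mult S.eval_mpoly_mult
        R.minus_eq S.minus_eq)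
qed

section \<open>Congruences and ghost components\<close>

lemma dvd_diff_pow:
  fixes x y :: "'a::comm_ring_1"
  assumes "d dvd x - y" shows "d dvd x ^ n - y ^ n"
  using assms by (cases n) (auto simp: diff_power_eq_sum simp del: power_Suc)

text \<open>\<open>x^p - y^p\<close> is \<open>x - y\<close> times
  \<open>\<Sum>i<p. x^i * y^(p-1-i)\<close>. As \<open>x\<close> and \<open>y\<close> agree modulo
  \<open>p\<close>, each summand is congruent to \<open>y^(p-1)\<close>, so the sum supplies a
  further factor \<open>p\<close>.\<close>

lemma prime_mult_dvd_diff_pow:
  fixes x y :: "'a::comm_ring_1"
  assumes "of_nat p dvd q" "q dvd x - y"
  shows "of_nat p * q dvd x ^ p - y ^ p"
proof (cases p)
  case (Suc n)
  have *: "(\<Sum>i<p. x ^ i * y ^ (n - i)) =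
      (\<Sum>i<p. (x ^ i - y ^ i) * y ^ (n - i)) + of_nat p * y ^ n"
  proof -
    have "x ^ i * y ^ (n - i) = (x ^ i - y ^ i) * y ^ (n - i) + y ^ n" if "i \<in> {..<p}" for i
      using that Suc by (simp add: algebra_simps flip: power_add)
    then show ?thesis by (simp add: sum.distrib)
  qed
  have "of_nat p dvd x ^ i - y ^ i" for i
    using assms dvd_diff_pow dvd_trans by blast
  then have "of_nat p dvd (\<Sum>i<p. x ^ i * y ^ (n - i))"
    unfolding * by (intro dvd_add dvd_sum dvd_mult2 dvd_triv_left)
  then have "q * of_nat p dvd (x - y) * (\<Sum>i<p. x ^ i * y ^ (n - i))"
    using assms(2) by (intro mult_dvd_mono)
  then show ?thesis
    using Suc by (simp add: diff_power_eq_sum mult.commute lessThan_Suc_atMost del: power_Suc)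
qed simp

lemma prime_dvd_add_pow:
  fixes x y :: "'a::comm_ring_1"
  assumes "prime p"
  shows "of_nat p dvd (x + y) ^ p - (x ^ p + y ^ p)"
proof -
  have p: "0 < p" using assms prime_gt_0_nat by blast
  have "(x + y) ^ p = (\<Sum>k\<in>{..p}. of_nat (p choose k) * x ^ k * y ^ (p - k))"
    by (rule binomial_ring)
  also have "{..p} = insert 0 (insert p {1..<p})" using p by auto
  finally have "(x + y) ^ p - (x ^ p + y ^ p) =
      (\<Sum>k\<in>{1..<p}. of_nat (p choose k) * x ^ k * y ^ (p - k))"
    using p by (simp add: algebra_simps)
  moreover have "of_nat p dvd of_nat (p choose k) * x ^ k * y ^ (p - k)" if "k \<in> {1..<p}" for k
  proof -
    have "p dvd (p choose k)"
      using that assms by (intro dvd_choose_prime) auto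
    then have "(of_nat p :: 'a) dvd of_nat (p choose k)" by (metis dvd_def of_nat_mult)
    then show ?thesis by (intro dvd_mult2)
  qed
  ultimately show ?thesis by (auto intro: dvd_sum)
qed

text \<open>Writing \<open>x\<close> as \<open>(x - y) + y\<close> avoids the sign of
  \<open>(- y) ^ p\<close> and with it a distinction between \<open>p = 2\<close> and odd
  \<open>p\<close>.\<close>

lemma prime_dvd_diff_pow:
  fixes x y :: "'a::comm_ring_1"
  assumes "prime p"
  shows "of_nat p dvd (x - y) ^ p - (x ^ p - y ^ p)"
  using prime_dvd_add_pow[OF assms, of "x - y" y]
    dvd_minus_iff[of "of_nat p" "(x - y) ^ p - (x ^ p - y ^ p)"]
  by (simp add: algebra_simps)

text \<open>Phrased with a witness instead of an ideal, the relation is carried along by every ring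
  homomorphism. Closedness of \<open>a\<close> follows from that of \<open>b\<close>, so most rules
  below ask for it on the right-hand side only.\<close>

definition cong_mod :: "('a, 'm) ring_scheme \<Rightarrow> nat \<Rightarrow> 'a \<Rightarrow> 'a \<Rightarrow> bool" where
  "cong_mod R m a b \<longleftrightarrow> (\<exists>c\<in>carrier R. a = b \<oplus>\<^bsub>R\<^esub> [m] \<cdot>\<^bsub>R\<^esub> c)"

lemma cong_mod_int_mpoly_ring: "cong_mod int_mpoly_ring m a b \<longleftrightarrow> of_nat m dvd a - b"
proof -
  have "(\<exists>c. a = b + of_nat m * c) \<longleftrightarrow> (\<exists>c. a - b = of_nat m * c)"
    by (simp add: algebra_simps)
  then show ?thesis by (simp add: cong_mod_def dvd_def)
qed

lemma ring_hom_nat_mult: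
  assumes "cring R" "cring S" "h \<in> ring_hom R S" "x \<in> carrier R"
  shows "h ([(n::nat)] \<cdot>\<^bsub>R\<^esub> x) = [n] \<cdot>\<^bsub>S\<^esub> h x"
proof -
  interpret ring_hom_cring R S h
    using assms by (simp add: ring_hom_cring_def ring_hom_cring_axioms_def)
  show ?thesis by (induction n) (simp_all add: assms)
qed

lemma ring_hom_nat_pow:
  assumes "cring R" "cring S" "h \<in> ring_hom R S" "x \<in> carrier R"
  shows "h (x [^]\<^bsub>R\<^esub> (n::nat)) = h x [^]\<^bsub>S\<^esub> n"
proof -
  interpret ring_hom_cring R S h
    using assms by (simp add: ring_hom_cring_def ring_hom_cring_axioms_def)
  show ?thesis by (induction n) (simp_all add: assms)
qed

lemma ring_hom_cong_mod:
  assumes "cring R" "cring S" "h \<in> ring_hom R S" "b \<in> carrier R" "cong_mod R m a b"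
  shows "cong_mod S m (h a) (h b)"
proof -
  interpret ring_hom_cring R S h
    using assms by (simp add: ring_hom_cring_def ring_hom_cring_axioms_def)
  show ?thesis using assms(4,5) unfolding cong_mod_def
    by (auto simp: ring_hom_nat_mult[OF assms(1-3)])
qed

context cring
begin

lemma cong_mod_refl: "a \<in> carrier R \<Longrightarrow> cong_mod R m a a"
  unfolding cong_mod_def by (intro bexI[of _ \<zero>]) auto

lemma cong_mod_sym:
  assumes "b \<in> carrier R" "cong_mod R m a b" shows "cong_mod R m b a"
proof -
  obtain c where "c \<in> carrier R" "a = b \<oplus> [m] \<cdot> c" using assms unfolding cong_mod_def by blast
  then show ?thesis using assms unfolding cong_mod_def
    by (intro bexI[of _ "\<ominus> c"]) (auto simp: add.nat_pow_inv a_assoc r_neg)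
qed

lemma cong_mod_trans:
  assumes "c \<in> carrier R" "cong_mod R m a b" "cong_mod R m b c" shows "cong_mod R m a c"
proof -
  obtain u v where "u \<in> carrier R" "a = b \<oplus> [m] \<cdot> u" "v \<in> carrier R" "b = c \<oplus> [m] \<cdot> v"
    using assms unfolding cong_mod_def by blast
  then show ?thesis using assms unfolding cong_mod_def
    by (intro bexI[of _ "v \<oplus> u"]) (auto simp: add.nat_pow_distrib a_assoc)
qed

lemma cong_mod_add:
  assumes "b \<in> carrier R" "b' \<in> carrier R" "cong_mod R m a b" "cong_mod R m a' b'"
  shows "cong_mod R m (a \<oplus> a') (b \<oplus> b')"
proof -
  obtain u v where "u \<in> carrier R" "a = b \<oplus> [m] \<cdot> u" "v \<in> carrier R" "a' = b' \<oplus> [m] \<cdot> v"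
    using assms unfolding cong_mod_def by blast
  then show ?thesis using assms unfolding cong_mod_def
    by (intro bexI[of _ "u \<oplus> v"]) (auto simp: add.nat_pow_distrib a_ac)
qed

lemma cong_mod_mult:
  assumes "b \<in> carrier R" "b' \<in> carrier R" "cong_mod R m a b" "cong_mod R m a' b'"
  shows "cong_mod R m (a \<otimes> a') (b \<otimes> b')"
proof -
  obtain u v where "u \<in> carrier R" "a = b \<oplus> [m] \<cdot> u" "v \<in> carrier R" "a' = b' \<oplus> [m] \<cdot> v"
    using assms unfolding cong_mod_def by blast
  then show ?thesis using assms unfolding cong_mod_def
    by (intro bexI[of _ "b \<otimes> v \<oplus> u \<otimes> (b' \<oplus> [m] \<cdot> v)"])
      (auto simp: add.nat_pow_distrib a_ac l_distr add_pow_ldistr add_pow_rdistr r_distr)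
qed

lemma cong_mod_scale:
  assumes "b \<in> carrier R" "cong_mod R m a b" shows "cong_mod R (l * m) ([l] \<cdot> a) ([l] \<cdot> b)"
proof -
  obtain c where "c \<in> carrier R" "a = b \<oplus> [m] \<cdot> c" using assms unfolding cong_mod_def by blast
  then show ?thesis using assms unfolding cong_mod_def
    by (intro bexI[of _ c]) (auto simp: add.nat_pow_distrib add.nat_pow_pow mult.commute)
qed

lemma cong_mod_finsum:
  assumes "finite I" "\<And>i. i \<in> I \<Longrightarrow> f i \<in> carrier R" "\<And>i. i \<in> I \<Longrightarrow> g i \<in> carrier R"
    "\<And>i. i \<in> I \<Longrightarrow> cong_mod R m (f i) (g i)"
  shows "cong_mod R m (\<Oplus>i\<in>I. f i) (\<Oplus>i\<in>I. g i)"
  using assms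
proof (induction I rule: finite_induct)
  case (insert i I)
  then show ?case by (auto simp: Pi_def intro!: cong_mod_add)
qed (simp add: cong_mod_refl)

text \<open>The binomial estimate is carried out in the polynomial ring in the two
  variables \<open>b\<close> and \<open>c\<close>, where \<open>a = b + p\<^sup>jc\<close>, and specialized.\<close>

lemma cong_mod_pow_prime:
  assumes "b \<in> carrier R" "cong_mod R (p ^ j) a b" "1 \<le> j"
  shows "cong_mod R (p ^ Suc j) (a [^] p) (b [^] p)"
proof -
  obtain c where c: "c \<in> carrier R" "a = b \<oplus> [(p ^ j)] \<cdot> c"
    using assms unfolding cong_mod_def by blast
  define v where "v = case_bool b c"
  have v: "v i \<in> carrier R" for i using c assms by (simp add: v_def split: bool.split)
  let ?h = "\<lambda>f. eval_mpoly R f v"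
  interpret h: ring_hom_cring int_mpoly_ring R ?h
    using eval_mpoly_ring_hom[of v] v
    by (simp add: ring_hom_cring_def ring_hom_cring_axioms_def cring_axioms int_mpoly_ring.cring_axioms)
  have pw: "?h (f ^ n) = ?h f [^] n" for f n
    using ring_hom_nat_pow[OF int_mpoly_ring.cring_axioms cring_axioms h.homh, of f n] by simp
  let ?b = "pvar True" and ?c = "pvar False"
  have "of_nat p dvd (of_nat p ^ j :: bool int_mpoly)"
    using assms(3) by (cases j) auto
  then have "of_nat p * of_nat p ^ j dvd (?b + of_nat p ^ j * ?c) ^ p - ?b ^ p"
    by (intro prime_mult_dvd_diff_pow) simp_all
  then have "cong_mod int_mpoly_ring (p ^ Suc j) ((?b + of_nat p ^ j * ?c) ^ p) (?b ^ p)"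
    by (simp add: cong_mod_int_mpoly_ring)
  then have "cong_mod R (p ^ Suc j) (?h ((?b + of_nat p ^ j * ?c) ^ p)) (?h (?b ^ p))"
    by (rule ring_hom_cong_mod[OF int_mpoly_ring.cring_axioms cring_axioms h.homh, rotated]) simp
  moreover have "?h (?b + of_nat p ^ j * ?c) = a"
    using ring_hom_nat_mult[OF int_mpoly_ring.cring_axioms cring_axioms h.homh, of ?c "p ^ j"] c v
    by (simp add: eval_mpoly_add eval_mpoly_pvar v_def)
  moreover have "?h ?b = b" using v by (simp add: eval_mpoly_pvar v_def)
  ultimately show ?thesis by (simp only: pw)
qed

lemma cong_mod_pow_prime_power:
  assumes "a \<in> carrier R" "b \<in> carrier R" "cong_mod R (p ^ j) a b" "1 \<le> j"
  shows "cong_mod R (p ^ (n + j)) (a [^] (p ^ n)) (b [^] (p ^ n))"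
proof (induction n)
  case (Suc n)
  have "cong_mod R (p ^ Suc (n + j)) ((a [^] (p ^ n)) [^] p) ((b [^] (p ^ n)) [^] p)"
    using assms by (intro cong_mod_pow_prime[OF _ Suc]) auto
  then show ?case using assms by (simp add: nat_pow_pow mult.commute)
qed (use assms in simp)

section \<open>Ghost components and congruences\<close>

lemma witt_ghost_closed: "(\<And>i. x i \<in> carrier R) \<Longrightarrow> witt_ghost p R n x \<in> carrier R"
  by (simp add: witt_ghost_def Pi_def)

lemma witt_ghost_0: "(\<And>i. x i \<in> carrier R) \<Longrightarrow> witt_ghost p R 0 x = x 0"
  by (simp add: witt_ghost_def)

text \<open>Only the last term is new; the others form the previous ghost component of the
  \<open>p\<close>-th powers. The inductions over components below peel off this last term.\<close>

lemma witt_ghost_Suc: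
  assumes "\<And>i. x i \<in> carrier R"
  shows "witt_ghost p R (Suc n) x = witt_ghost p R n (\<lambda>i. x i [^] p) \<oplus> [(p ^ Suc n)] \<cdot> x (Suc n)"
proof -
  have "(x i [^] p) [^] (p ^ (n - i)) = x i [^] (p ^ (Suc n - i))" if "i \<le> n" for i
    using that assms by (simp add: nat_pow_pow Suc_diff_le)
  then have "(\<Oplus>i\<in>{..n}. [(p ^ i)] \<cdot> (x i [^] (p ^ (Suc n - i)))) =
      (\<Oplus>i\<in>{..n}. [(p ^ i)] \<cdot> ((x i [^] p) [^] (p ^ (n - i))))"
    using assms by (intro finsum_cong') auto
  then show ?thesis
    using assms by (simp add: witt_ghost_def a_comm finsum_closed Pi_def del: power_Suc)
qed

text \<open>The power \<open>p^(n-i)\<close> raises the modulus from \<open>p^j\<close> to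
  \<open>p^(n-i+j)\<close>, and the coefficient \<open>p^i\<close> supplies the rest, so every
  summand agrees modulo \<open>p^(n+j)\<close>.\<close>

lemma witt_ghost_cong_mod:
  assumes "\<And>i. x i \<in> carrier R" "\<And>i. y i \<in> carrier R" "1 \<le> j"
    "\<And>i. i \<le> n \<Longrightarrow> cong_mod R (p ^ j) (x i) (y i)"
  shows "cong_mod R (p ^ (n + j)) (witt_ghost p R n x) (witt_ghost p R n y)"
  unfolding witt_ghost_def
proof (rule cong_mod_finsum)
  fix i assume "i \<in> {..n}"
  then have "cong_mod R (p ^ i * p ^ (n - i + j)) ([(p ^ i)] \<cdot> (x i [^] (p ^ (n - i))))
      ([(p ^ i)] \<cdot> (y i [^] (p ^ (n - i))))"
    using assms by (intro cong_mod_scale cong_mod_pow_prime_power) auto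
  then show "cong_mod R (p ^ (n + j)) ([(p ^ i)] \<cdot> (x i [^] (p ^ (n - i))))
      ([(p ^ i)] \<cdot> (y i [^] (p ^ (n - i))))"
    using \<open>i \<in> {..n}\<close> by (simp flip: power_add)
qed (use assms in auto)

end

lemma ring_hom_witt_ghost:
  assumes "cring R" "cring S" "h \<in> ring_hom R S" "\<And>i. x i \<in> carrier R"
  shows "h (witt_ghost p R n x) = witt_ghost p S n (\<lambda>i. h (x i))"
proof -
  interpret ring_hom_cring R S h
    using assms by (simp add: ring_hom_cring_def ring_hom_cring_axioms_def)
  show ?thesis
    using assms(4) by (simp add: witt_ghost_def Pi_def o_def ring_hom_nat_mult[OF assms(1-3)]
      ring_hom_nat_pow[OF assms(1-3)])
qed

text \<open>Two instances matter: integral polynomials with \<open>X \<mapsto> X^p\<close>, which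
  produce the Witt polynomials, and \<open>W(k)\<close> with its Frobenius. Torsion freeness makes
  the ghost map injective, and \<psi> describes its image.\<close>

locale frobenius_lift = cring R for p :: nat and R (structure) and \<psi> +
  assumes prime_p: "prime p"
    and lift_hom: "\<psi> \<in> ring_hom R R"
    and lift_cong: "x \<in> carrier R \<Longrightarrow> cong_mod R p (\<psi> x) (x [^] p)"
    and torsion_free: "x \<in> carrier R \<Longrightarrow> [p] \<cdot> x = \<zero> \<Longrightarrow> x = \<zero>"
begin

lemma lift_closed: "x \<in> carrier R \<Longrightarrow> \<psi> x \<in> carrier R"
  by (rule ring_hom_closed[OF lift_hom])

lemma p_power_torsion_free: "x \<in> carrier R \<Longrightarrow> [(p ^ n)] \<cdot> x = \<zero> \<Longrightarrow> x = \<zero>"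
proof (induction n)
  case (Suc n)
  then have "[p] \<cdot> ([(p ^ n)] \<cdot> x) = \<zero>"
    by (simp add: add.nat_pow_pow mult.commute)
  then have "[(p ^ n)] \<cdot> x = \<zero>"
    by (rule torsion_free[rotated]) (use Suc.prems(1) in simp)
  then show ?case by (rule Suc.IH[OF Suc.prems(1)])
qed simp

lemma p_power_cancel:
  assumes "x \<in> carrier R" "y \<in> carrier R" "[(p ^ n)] \<cdot> x = [(p ^ n)] \<cdot> y" shows "x = y"
proof -
  have "[(p ^ n)] \<cdot> (x \<ominus> y) = \<zero>"
    using assms by (simp add: minus_eq add.nat_pow_distrib add.nat_pow_inv r_neg)
  then have "x \<ominus> y = \<zero>" by (rule p_power_torsion_free[rotated]) (use assms(1,2) in simp)
  moreover have "x = x \<ominus> y \<oplus> y" using assms(1,2) by (simp add: minus_eq a_assoc l_neg)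
  ultimately show ?thesis using assms(2) by simp
qed

text \<open>\<psi> commutes with ghost polynomials, and \<open>\<psi> (x i)\<close> agrees with the
  \<open>p\<close>-th power of \<open>x i\<close> modulo \<open>p\<close>, which ghost component
  \<open>n\<close> improves to \<open>p^(n+1)\<close>.\<close>

lemma witt_ghost_lift:
  assumes "\<And>i. x i \<in> carrier R"
  shows "cong_mod R (p ^ Suc n) (\<psi> (witt_ghost p R n x)) (witt_ghost p R n (\<lambda>i. x i [^] p))"
  using witt_ghost_cong_mod[of "\<lambda>i. \<psi> (x i)" "\<lambda>i. x i [^] p" 1 n p] assms
  by (simp add: ring_hom_witt_ghost[OF cring_axioms cring_axioms lift_hom assms] lift_closed lift_cong)

lemma witt_ghost_lift_Suc:
  assumes "\<And>i. x i \<in> carrier R"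
  shows "cong_mod R (p ^ Suc n) (witt_ghost p R (Suc n) x) (\<psi> (witt_ghost p R n x))"
proof -
  have "cong_mod R (p ^ Suc n) (witt_ghost p R (Suc n) x) (witt_ghost p R n (\<lambda>i. x i [^] p))"
    using assms by (auto simp: witt_ghost_Suc cong_mod_def simp del: power_Suc)
  then show ?thesis
    using assms by (intro cong_mod_trans[OF _ _ cong_mod_sym[OF _ witt_ghost_lift]])
      (auto intro: witt_ghost_closed lift_closed)
qed

text \<open>Once the earlier components are known, ghost component \<open>n\<close> determines
  \<open>p^n x_n\<close>, and \<open>p^n\<close> can be cancelled.\<close>

lemma witt_ghost_inject:
  assumes x: "\<And>i. x i \<in> carrier R" and y: "\<And>i. y i \<in> carrier R"
    and eq: "\<And>m. m \<le> n \<Longrightarrow> witt_ghost p R m x = witt_ghost p R m y"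
  shows "x n = y n"
  using eq
proof (induction n rule: less_induct)
  case (less n)
  show ?case
  proof (cases n)
    case 0
    then show ?thesis using less.prems[of 0] x y by (simp add: witt_ghost_0)
  next
    case (Suc m)
    have "x i = y i" if "i \<le> m" for i
      using less that Suc by simp
    then have "witt_ghost p R m (\<lambda>i. x i [^] p) = witt_ghost p R m (\<lambda>i. y i [^] p)"
      unfolding witt_ghost_def using y by (intro finsum_cong') auto
    then have "[(p ^ n)] \<cdot> x n = [(p ^ n)] \<cdot> y n"
      using less.prems[of n] x y Suc by (simp add: witt_ghost_Suc witt_ghost_closed del: power_Suc)
    then show ?thesis using x y p_power_cancel by blast
  qed
qed

text \<open>A converse to \<open>witt_ghost_cong_mod\<close> for \<open>j = 1\<close>; it is the
  means of reading Witt polynomials modulo \<open>p\<close>.\<close>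

lemma cong_mod_if_witt_ghost_cong_mod:
  assumes x: "\<And>i. x i \<in> carrier R" and y: "\<And>i. y i \<in> carrier R"
    and cong: "\<And>m. cong_mod R (p ^ Suc m) (witt_ghost p R m x) (witt_ghost p R m y)"
  shows "cong_mod R p (x n) (y n)"
proof (induction n rule: less_induct)
  case (less n)
  show ?case
  proof (cases n)
    case 0
    then show ?thesis using cong[of 0] x y by (simp add: witt_ghost_0)
  next
    case (Suc m)
    let ?gx = "witt_ghost p R m (\<lambda>i. x i [^] p)" and ?gy = "witt_ghost p R m (\<lambda>i. y i [^] p)"
    have gcl: "?gx \<in> carrier R" "?gy \<in> carrier R" using x y by (auto intro: witt_ghost_closed)
    \<comment> \<open>Taking \<open>p\<close>-th powers turns agreement modulo \<open>p\<close> into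
      agreement modulo \<open>p^2\<close>. The terms below the last one then agree modulo
      \<open>p^(m+2) = p^(n+1)\<close>, which leaves \<open>p^n x_n\<close> and
      \<open>p^n y_n\<close> to be compared modulo \<open>p^(n+1)\<close>.\<close>
    have "cong_mod R (p ^ 2) (x i [^] p) (y i [^] p)" if "i \<le> m" for i
      using less[of i] that Suc y cong_mod_pow_prime[of "y i" p 1 "x i"]
      by (simp add: numeral_2_eq_2)
    then have "cong_mod R (p ^ (m + 2)) ?gx ?gy"
      using x y by (intro witt_ghost_cong_mod) auto
    then obtain c where c: "c \<in> carrier R" "?gx = ?gy \<oplus> [(p ^ Suc n)] \<cdot> c"
      unfolding cong_mod_def using Suc by auto
    obtain d where d: "d \<in> carrier R"
      "?gx \<oplus> [(p ^ n)] \<cdot> x n = ?gy \<oplus> [(p ^ n)] \<cdot> y n \<oplus> [(p ^ Suc n)] \<cdot> d"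
      using cong[of n] x y Suc by (auto simp: cong_mod_def witt_ghost_Suc simp del: power_Suc)
    have "?gy \<oplus> ([(p ^ Suc n)] \<cdot> c \<oplus> [(p ^ n)] \<cdot> x n) = ?gy \<oplus> ([(p ^ n)] \<cdot> y n \<oplus> [(p ^ Suc n)] \<cdot> d)"
      using d c gcl x y by (simp add: a_assoc)
    then have "[(p ^ Suc n)] \<cdot> c \<oplus> [(p ^ n)] \<cdot> x n = [(p ^ n)] \<cdot> y n \<oplus> [(p ^ Suc n)] \<cdot> d"
      using d(1) c(1) gcl x y by (simp add: a_comm[of ?gy])
    then have "[(p ^ n)] \<cdot> ([p] \<cdot> c \<oplus> x n) = [(p ^ n)] \<cdot> (y n \<oplus> [p] \<cdot> d)"
      using c d x y by (simp add: add.nat_pow_distrib add.nat_pow_pow mult.commute)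
    then have "[p] \<cdot> c \<oplus> x n = y n \<oplus> [p] \<cdot> d"
      by (rule p_power_cancel[rotated 2]) (use c d x y in simp_all)
    then have "x n = \<ominus> ([p] \<cdot> c) \<oplus> (y n \<oplus> [p] \<cdot> d)"
      using c(1) d(1) x y by (simp add: add.inv_solve_left)
    also have "\<dots> = y n \<oplus> [p] \<cdot> (d \<ominus> c)"
      using c(1) d(1) y by (simp add: minus_eq add.nat_pow_distrib add.nat_pow_inv a_ac)
    finally have "x n = y n \<oplus> [p] \<cdot> (d \<ominus> c)" .
    then show ?thesis using c d unfolding cong_mod_def by blast
  qed
qed

text \<open>Components are found one after the other. If \<open>w n\<close> is attained, then
  \<open>w (Suc n)\<close>, being congruent to \<open>\<psi> (w n)\<close>, differs from the
  contribution of the components found so far by a multiple of \<open>p^(n+1)\<close>; the cofactor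
  is the next component.\<close>

lemma dwork_lemma:
  assumes w: "\<And>n. w n \<in> carrier R" and cong: "\<And>n. cong_mod R (p ^ Suc n) (w (Suc n)) (\<psi> (w n))"
  shows "\<exists>x. (\<forall>i. x i \<in> carrier R) \<and> (\<forall>n. witt_ghost p R n x = w n)"
proof -
  define P where "P n x \<longleftrightarrow> (\<forall>i. x i \<in> carrier R) \<and> (\<forall>m\<le>n. witt_ghost p R m x = w m)" for n x
  have agree: "witt_ghost p R n x = witt_ghost p R n y"
    if "\<forall>i. y i \<in> carrier R" "\<forall>i\<le>n. x i = y i" for n x y
    unfolding witt_ghost_def using that by (intro finsum_cong') auto
  have "\<exists>f. \<forall>n. P n (f n) \<and> (\<forall>i\<le>n. f (Suc n) i = f n i)"
  proof (rule dependent_nat_choice)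
    \<comment> \<open>Only component 0 counts at this stage; the others are placeholders,
      overwritten later.\<close>
    show "\<exists>x. P 0 x"
      by (rule exI[of _ "\<lambda>_. w 0"]) (simp add: P_def w witt_ghost_0)
  next
    fix x n assume P: "P n x"
    then have x: "x i \<in> carrier R" for i by (simp add: P_def)
    let ?g = "witt_ghost p R n (\<lambda>i. x i [^] p)"
    have "cong_mod R (p ^ Suc n) (w (Suc n)) ?g"
      by (rule cong_mod_trans[OF _ cong[of n]])
        (use witt_ghost_lift[of x n] x P in \<open>auto simp: P_def intro: witt_ghost_closed\<close>)
    then obtain c where c: "c \<in> carrier R" "w (Suc n) = ?g \<oplus> [(p ^ Suc n)] \<cdot> c"
      unfolding cong_mod_def by blast
    let ?y = "x(Suc n := c)"
    have y: "?y i \<in> carrier R" for i using x c by simp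
    have "witt_ghost p R m ?y = w m" if "m \<le> n" for m
      using agree[of x m ?y] x that P by (simp add: P_def)
    moreover have "witt_ghost p R (Suc n) ?y = w (Suc n)"
    proof -
      have "witt_ghost p R n (\<lambda>i. ?y i [^] p) = ?g"
        using x by (intro agree) auto
      then show ?thesis using c by (simp only: witt_ghost_Suc[OF y] fun_upd_same)
    qed
    ultimately have "P (Suc n) ?y" using y unfolding P_def by (metis le_Suc_eq)
    then show "\<exists>y. P (Suc n) y \<and> (\<forall>i\<le>n. y i = x i)" by (intro exI[of _ ?y]) auto
  qed
  then obtain f where f: "P n (f n)" "i \<le> n \<Longrightarrow> f (Suc n) i = f n i" for n i by blast
  \<comment> \<open>Component \<open>i\<close> is fixed from stage \<open>i\<close> on, so the
    diagonal \<open>f i i\<close> is the limit of the stages.\<close>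
  have stable: "i \<le> n \<Longrightarrow> f n i = f i i" for i n
    by (induction n rule: dec_induct) (simp_all add: f(2))
  have "witt_ghost p R n (\<lambda>i. f i i) = w n" for n
  proof -
    have "witt_ghost p R n (\<lambda>i. f i i) = witt_ghost p R n (f n)"
      by (intro agree allI impI stable[symmetric]) (use f(1)[of n] in \<open>simp add: P_def\<close>)
    then show ?thesis using f(1)[of n] by (simp add: P_def)
  qed
  moreover have "f i i \<in> carrier R" for i using f(1)[of i] by (simp add: P_def)
  ultimately show ?thesis by (intro exI[of _ "\<lambda>i. f i i"]) auto
qed

end

section \<open>Witt vectors\<close>

subsection \<open>The Witt polynomials\<close>

definition pow_subst :: "nat \<Rightarrow> 'v int_mpoly \<Rightarrow> 'v int_mpoly" where
  "pow_subst p f = eval_mpoly int_mpoly_ring f (\<lambda>v. pvar v ^ p)"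

text \<open>The Frobenius congruence holds for \<open>1\<close> and the variables and is stable
  under differences, by \<open>prime_dvd_diff_pow\<close>, and under products. Torsion freeness is
  read off the coefficients.\<close>

lemma frobenius_lift_int_mpoly:
  assumes "prime p"
  shows "frobenius_lift p int_mpoly_ring (pow_subst p :: 'v int_mpoly \<Rightarrow> _)"
proof
  show hom: "pow_subst p \<in> ring_hom int_mpoly_ring (int_mpoly_ring :: 'v int_mpoly ring)"
    unfolding pow_subst_def by (rule int_mpoly_ring.eval_mpoly_ring_hom) simp
  show "cong_mod int_mpoly_ring p (pow_subst p f) (f [^]\<^bsub>int_mpoly_ring\<^esub> p)" for f :: "'v int_mpoly"
    unfolding cong_mod_int_mpoly_ring int_mpoly_ring_pow
  proof (induction f rule: int_mpoly_induct)
    case one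
    then show ?case by (simp add: pow_subst_def int_mpoly_ring.eval_mpoly_one)
  next
    case (var v)
    then show ?case by (simp add: pow_subst_def int_mpoly_ring.eval_mpoly_pvar)
  next
    case (diff f g)
    have "pow_subst p (f - g) = pow_subst p f - pow_subst p g"
      using ring_hom_add[OF hom, of "f - g" g] by simp
    then have "pow_subst p (f - g) - (f - g) ^ p =
        (pow_subst p f - f ^ p) - (pow_subst p g - g ^ p) - ((f - g) ^ p - (f ^ p - g ^ p))"
      by simp
    then show ?case using diff prime_dvd_diff_pow[OF assms, of f g] by (metis dvd_diff)
  next
    case (mult f g)
    have "pow_subst p (f * g) - (f * g) ^ p =
        (pow_subst p f - f ^ p) * pow_subst p g + f ^ p * (pow_subst p g - g ^ p)"
      using ring_hom_mult[OF hom, of f g] by (simp add: algebra_simps)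
    then show ?case using mult by simp
  qed
  show "f = \<zero>\<^bsub>int_mpoly_ring\<^esub>" if "[p] \<cdot>\<^bsub>int_mpoly_ring\<^esub> f = \<zero>\<^bsub>int_mpoly_ring\<^esub>" for f :: "'v int_mpoly"
  proof -
    have lookup: "Poly_Mapping.lookup (of_nat n * f) m = int n * Poly_Mapping.lookup f m" for n m
      by (induction n) (simp_all add: lookup_add algebra_simps)
    have "int p * Poly_Mapping.lookup f m = 0" for m
      using that by (simp flip: lookup)
    then show ?thesis using prime_gt_0_nat[OF assms] by (intro poly_mapping_eqI) simp
  qed
qed (use assms in simp_all)

text \<open>Justifies the definite description: existence is Dwork's lemma, uniqueness the
  injectivity of the ghost map.\<close>

lemma witt_lift_ghost:
  fixes \<Phi> :: "nat \<Rightarrow> 'v int_mpoly"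
  assumes p: "prime p"
    and \<Phi>: "\<And>n. cong_mod int_mpoly_ring (p ^ Suc n) (\<Phi> (Suc n)) (pow_subst p (\<Phi> n))"
  shows "witt_poly p n (witt_lift p \<Phi>) = \<Phi> n"
proof -
  interpret Z: frobenius_lift p int_mpoly_ring "pow_subst p :: 'v int_mpoly \<Rightarrow> _"
    by (rule frobenius_lift_int_mpoly[OF p])
  have "\<exists>!S. \<forall>n. witt_poly p n S = \<Phi> n"
  proof (rule ex_ex1I)
    show "\<exists>S. \<forall>n. witt_poly p n S = \<Phi> n"
      using Z.dwork_lemma[of \<Phi>] \<Phi> by (simp add: witt_poly_eq_ghost)
    fix S T assume "\<forall>n. witt_poly p n S = \<Phi> n" "\<forall>n. witt_poly p n T = \<Phi> n"
    then show "S = T"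
      using Z.witt_ghost_inject[of S T] by (simp add: witt_poly_eq_ghost fun_eq_iff)
  qed
  then show ?thesis unfolding witt_lift_def by (rule theI'[THEN spec])
qed

context
  fixes p :: nat
  assumes p: "prime p"
begin

private lemma ghost_pvar: "cong_mod int_mpoly_ring (p ^ Suc n) (witt_poly p (Suc n) (\<lambda>i. pvar (f i)))
    (pow_subst p (witt_poly p n (\<lambda>i. pvar (f i))))"
  using frobenius_lift.witt_ghost_lift_Suc[OF frobenius_lift_int_mpoly[OF p], of "\<lambda>i. pvar (f i)" n]
  by (simp add: witt_poly_eq_ghost)

private lemma pow_subst_ops:
  "pow_subst p (f + g) = pow_subst p f + pow_subst p g"
  "pow_subst p (f * g) = pow_subst p f * pow_subst p g"
  using ring_hom_add[OF frobenius_lift.lift_hom[OF frobenius_lift_int_mpoly[OF p]], of f g]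
    ring_hom_mult[OF frobenius_lift.lift_hom[OF frobenius_lift_int_mpoly[OF p]], of f g]
  by simp_all

lemma witt_add_poly_ghost: "witt_poly p n (witt_add_poly p) =
    witt_poly p n (\<lambda>i. pvar (Inl i)) + witt_poly p n (\<lambda>i. pvar (Inr i))"
  unfolding witt_add_poly_def
  using int_mpoly_ring.cong_mod_add[OF _ _ ghost_pvar ghost_pvar]
  by (intro witt_lift_ghost[OF p]) (simp add: pow_subst_ops)

lemma witt_mult_poly_ghost: "witt_poly p n (witt_mult_poly p) =
    witt_poly p n (\<lambda>i. pvar (Inl i)) * witt_poly p n (\<lambda>i. pvar (Inr i))"
  unfolding witt_mult_poly_def
  using int_mpoly_ring.cong_mod_mult[OF _ _ ghost_pvar ghost_pvar]
  by (intro witt_lift_ghost[OF p]) (simp add: pow_subst_ops)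

lemma witt_frob_poly_ghost: "witt_poly p n (witt_frob_poly p) = witt_poly p (Suc n) pvar"
  unfolding witt_frob_poly_def
proof (rule witt_lift_ghost[OF p])
  fix n
  show "cong_mod int_mpoly_ring (p ^ Suc n) (witt_poly p (Suc (Suc n)) pvar)
      (pow_subst p (witt_poly p (Suc n) pvar))"
    \<comment> \<open>For the shifted sequence the congruence is available modulo
      \<open>p^(n+2)\<close>, one power more than required.\<close>
    using ghost_pvar[of "Suc n" "\<lambda>i. i"] unfolding cong_mod_int_mpoly_ring
    by (rule dvd_trans[rotated]) simp
qed

end

text \<open>Transfers identities between ghost polynomials to every commutative ring, including
  those whose Witt vectors are not determined by ghost components.\<close>

lemma (in cring) witt_ghost_eval:
  assumes "\<And>i. v i \<in> carrier R"
  shows "witt_ghost p R n (\<lambda>i. eval_mpoly R (S i) v) = eval_mpoly R (witt_poly p n S) v"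
  using ring_hom_witt_ghost[OF int_mpoly_ring.cring_axioms cring_axioms eval_mpoly_ring_hom, of v S p n] assms
  by (simp add: witt_poly_eq_ghost)

lemma (in cring) eval_witt_poly_pvar:
  assumes "\<And>i. v i \<in> carrier R"
  shows "eval_mpoly R (witt_poly p n (\<lambda>i. pvar (f i))) v = witt_ghost p R n (\<lambda>i. v (f i))"
  using witt_ghost_eval[of v p n "\<lambda>i. pvar (f i)"] assms by (simp add: eval_mpoly_pvar)

subsection \<open>Ghost components of the operations\<close>

text \<open>Covers \<open>W(R)\<close> and \<open>W_n(R)\<close> in one argument: ghost component
  \<open>n\<close> involves components up to \<open>n\<close> only, so for \<open>n \<in> I\<close>
  it is unchanged by truncation to a down-closed \<open>I\<close>.\<close>

definition down_closed :: "nat set \<Rightarrow> bool" where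
  "down_closed I \<longleftrightarrow> (\<forall>i\<in>I. {..i} \<subseteq> I)"

lemma down_closed_UNIV [simp]: "down_closed UNIV"
  and down_closed_lessThan [simp]: "down_closed {..<n}"
  by (auto simp: down_closed_def)

lemma witt_ring_carrier:
  "x \<in> carrier (witt_ring p I R) \<longleftrightarrow> (\<forall>i. x i \<in> carrier R) \<and> (\<forall>i. i \<notin> I \<longrightarrow> x i = \<zero>\<^bsub>R\<^esub>)"
  by (simp add: witt_ring_def)

lemma wtrunc_UNIV [simp]: "wtrunc UNIV R x = x"
  by (simp add: wtrunc_def)

locale witt_base = cring R for R (structure) +
  fixes p :: nat
  assumes prime_p: "prime p"
begin

lemma wtrunc_closed: "(\<And>i. x i \<in> carrier R) \<Longrightarrow> wtrunc I R x \<in> carrier (witt_ring p I R)"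
  by (auto simp: witt_ring_carrier wtrunc_def)

lemma witt_ghost_cong:
  assumes "\<And>i. i \<le> n \<Longrightarrow> x i = y i" "\<And>i. y i \<in> carrier R"
  shows "witt_ghost p R n x = witt_ghost p R n y"
  unfolding witt_ghost_def using assms by (intro finsum_cong') auto

lemma witt_ghost_wtrunc:
  assumes "\<And>i. x i \<in> carrier R" "down_closed I" "n \<in> I"
  shows "witt_ghost p R n (wtrunc I R x) = witt_ghost p R n x"
  using assms by (intro witt_ghost_cong) (auto simp: wtrunc_def down_closed_def subset_iff)

lemma witt_ring_add_closed:
  "x \<in> carrier (witt_ring p I R) \<Longrightarrow> y \<in> carrier (witt_ring p I R) \<Longrightarrow>
    x \<oplus>\<^bsub>witt_ring p I R\<^esub> y \<in> carrier (witt_ring p I R)"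
  by (auto simp: witt_ring_def wtrunc_def intro!: eval_mpoly_closed cring_axioms split: sum.splits)

lemma witt_ring_mult_closed:
  "x \<in> carrier (witt_ring p I R) \<Longrightarrow> y \<in> carrier (witt_ring p I R) \<Longrightarrow>
    x \<otimes>\<^bsub>witt_ring p I R\<^esub> y \<in> carrier (witt_ring p I R)"
  by (auto simp: witt_ring_def wtrunc_def intro!: eval_mpoly_closed cring_axioms split: sum.splits)

lemma witt_ring_zero_closed: "\<zero>\<^bsub>witt_ring p I R\<^esub> \<in> carrier (witt_ring p I R)"
  and witt_ring_one_closed: "\<one>\<^bsub>witt_ring p I R\<^esub> \<in> carrier (witt_ring p I R)"
  by (auto simp: witt_ring_def wtrunc_def teich_def)

lemma witt_frob_closed:
  "(\<And>i. x i \<in> carrier R) \<Longrightarrow> witt_frob p I R x \<in> carrier (witt_ring p I R)"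
  unfolding witt_frob_def by (intro wtrunc_closed eval_mpoly_closed cring_axioms)

lemma witt_ver_closed:
  "(\<And>i. x i \<in> carrier R) \<Longrightarrow> witt_ver I R x \<in> carrier (witt_ring p I R)"
  unfolding witt_ver_def by (intro wtrunc_closed) (simp split: nat.split)

context
  fixes I :: "nat set" and n :: nat
  assumes I: "down_closed I" and n: "n \<in> I"
begin

lemma witt_ghost_add:
  assumes "x \<in> carrier (witt_ring p I R)" "y \<in> carrier (witt_ring p I R)"
  shows "witt_ghost p R n (x \<oplus>\<^bsub>witt_ring p I R\<^esub> y) = witt_ghost p R n x \<oplus> witt_ghost p R n y"
proof -
  let ?v = "case_sum x y"
  have v: "?v i \<in> carrier R" for i
    using assms by (auto simp: witt_ring_carrier split: sum.split)
  have "witt_ghost p R n (x \<oplus>\<^bsub>witt_ring p I R\<^esub> y) =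
      witt_ghost p R n (\<lambda>i. eval_mpoly R (witt_add_poly p i) ?v)"
    unfolding witt_ring_def
    by (simp, rule witt_ghost_wtrunc[OF eval_mpoly_closed[OF cring_axioms v] I n])
  also have "\<dots> = witt_ghost p R n x \<oplus> witt_ghost p R n y"
    by (simp add: witt_ghost_eval v witt_add_poly_ghost[OF prime_p] eval_mpoly_add
        eval_witt_poly_pvar)
  finally show ?thesis .
qed

lemma witt_ghost_mult:
  assumes "x \<in> carrier (witt_ring p I R)" "y \<in> carrier (witt_ring p I R)"
  shows "witt_ghost p R n (x \<otimes>\<^bsub>witt_ring p I R\<^esub> y) = witt_ghost p R n x \<otimes> witt_ghost p R n y"
proof -
  let ?v = "case_sum x y"
  have v: "?v i \<in> carrier R" for i
    using assms by (auto simp: witt_ring_carrier split: sum.split)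
  have "witt_ghost p R n (x \<otimes>\<^bsub>witt_ring p I R\<^esub> y) =
      witt_ghost p R n (\<lambda>i. eval_mpoly R (witt_mult_poly p i) ?v)"
    unfolding witt_ring_def
    by (simp, rule witt_ghost_wtrunc[OF eval_mpoly_closed[OF cring_axioms v] I n])
  also have "\<dots> = witt_ghost p R n x \<otimes> witt_ghost p R n y"
    by (simp add: witt_ghost_eval v witt_mult_poly_ghost[OF prime_p] eval_mpoly_mult
        eval_witt_poly_pvar)
  finally show ?thesis .
qed

lemma witt_ghost_frob:
  assumes "\<And>i. x i \<in> carrier R"
  shows "witt_ghost p R n (witt_frob p I R x) = witt_ghost p R (Suc n) x"
proof -
  have "witt_ghost p R n (witt_frob p I R x) =
      witt_ghost p R n (\<lambda>i. eval_mpoly R (witt_frob_poly p i) x)"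
    unfolding witt_frob_def
    by (rule witt_ghost_wtrunc[OF eval_mpoly_closed[OF cring_axioms assms] I n])
  also have "\<dots> = witt_ghost p R (Suc n) x"
    by (simp add: witt_ghost_eval assms witt_frob_poly_ghost[OF prime_p]
        eval_witt_poly_pvar[where f = "\<lambda>i. i"])
  finally show ?thesis .
qed

text \<open>The vector is \<open>V^i([a])\<close>; zero, Teichmueller lifts and the powers of
  \<open>V\<close> on \<open>1\<close> are special cases.\<close>

lemma witt_ghost_single:
  assumes "a \<in> carrier R"
  shows "witt_ghost p R n (\<lambda>j. if j = i then a else \<zero>) =
    (if i \<le> n then [(p ^ i)] \<cdot> (a [^] (p ^ (n - i))) else \<zero>)"
proof -
  have "witt_ghost p R n (\<lambda>j. if j = i then a else \<zero>) =
      (\<Oplus>j\<in>{..n}. if i = j then [(p ^ i)] \<cdot> (a [^] (p ^ (n - i))) else \<zero>)"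
    unfolding witt_ghost_def
    using assms prime_gt_0_nat[OF prime_p] by (intro finsum_cong') (auto simp: nat_pow_zero)
  also have "\<dots> = (if i \<le> n then [(p ^ i)] \<cdot> (a [^] (p ^ (n - i))) else \<zero>)"
    using assms by (auto simp: finsum_singleton[of i "{..n}" "\<lambda>_. [(p ^ i)] \<cdot> (a [^] (p ^ (n - i)))"]
        intro!: add.finprod_one_eqI)
  finally show ?thesis .
qed

lemma witt_ghost_zero: "witt_ghost p R n \<zero>\<^bsub>witt_ring p I R\<^esub> = \<zero>"
  using witt_ghost_single[of \<zero> 0] prime_gt_0_nat[OF prime_p]
  by (simp add: witt_ring_def nat_pow_zero cong: if_cong)

lemma witt_ghost_teich: "a \<in> carrier R \<Longrightarrow> witt_ghost p R n (teich R a) = a [^] (p ^ n)"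
  using witt_ghost_single[of a 0] by (simp add: teich_def)

lemma witt_ghost_one: "witt_ghost p R n \<one>\<^bsub>witt_ring p I R\<^esub> = \<one>"
  using witt_ghost_teich[of \<one>]
  by (simp add: witt_ring_def witt_ghost_wtrunc[OF _ I n] teich_def)

end

end

context frobenius_lift
begin

sublocale witt_base R p
  by unfold_locales (rule prime_p)

context
  fixes I :: "nat set"
  assumes I: "down_closed I"
begin

lemma witt_eqI:
  assumes "x \<in> carrier (witt_ring p I R)" "y \<in> carrier (witt_ring p I R)"
    "\<And>n. n \<in> I \<Longrightarrow> witt_ghost p R n x = witt_ghost p R n y"
  shows "x = y"
proof
  fix n
  show "x n = y n"
  proof (cases "n \<in> I")
    case True
    show ?thesis
      by (rule witt_ghost_inject)
        (use assms I True in \<open>auto simp: witt_ring_carrier down_closed_def subset_iff\<close>)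
  qed (use assms in \<open>simp add: witt_ring_carrier\<close>)
qed

text \<open>The definitions contain no Witt polynomial for negation. The negated ghost components
  again satisfy the congruences of Dwork's lemma, since \<psi> is a ring homomorphism, and so belong
  to a Witt vector.\<close>

lemma witt_ring_neg_exists:
  assumes "x \<in> carrier (witt_ring p I R)"
  shows "\<exists>y\<in>carrier (witt_ring p I R). y \<oplus>\<^bsub>witt_ring p I R\<^esub> x = \<zero>\<^bsub>witt_ring p I R\<^esub>"
proof -
  interpret h: ring_hom_cring R R \<psi>
    using lift_hom by (simp add: ring_hom_cring_def ring_hom_cring_axioms_def cring_axioms)
  have x: "x i \<in> carrier R" for i using assms by (simp add: witt_ring_carrier)
  note g = witt_ghost_closed[of x, OF x]
  have "cong_mod R (p ^ Suc n) (\<ominus> witt_ghost p R (Suc n) x) (\<psi> (\<ominus> witt_ghost p R n x))" for n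
  proof -
    obtain c where "c \<in> carrier R"
      "witt_ghost p R (Suc n) x = \<psi> (witt_ghost p R n x) \<oplus> [(p ^ Suc n)] \<cdot> c"
      using witt_ghost_lift_Suc[of x n, OF x] unfolding cong_mod_def by (elim bexE) (rule that)
    then show ?thesis unfolding cong_mod_def
      by (intro bexI[of _ "\<ominus> c"]) (simp_all add: g minus_add add.nat_pow_inv del: power_Suc)
  qed
  then obtain z where z: "\<And>i. z i \<in> carrier R" "\<And>n. witt_ghost p R n z = \<ominus> witt_ghost p R n x"
    using dwork_lemma[of "\<lambda>n. \<ominus> witt_ghost p R n x"] g by auto
  \<comment> \<open>Dwork's lemma yields an untruncated vector; truncation to \<open>I\<close> keeps
    the ghost components with index in \<open>I\<close>.\<close>
  have "wtrunc I R z \<oplus>\<^bsub>witt_ring p I R\<^esub> x = \<zero>\<^bsub>witt_ring p I R\<^esub>"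
    using assms z g
    by (intro witt_eqI)
      (auto simp: witt_ring_add_closed wtrunc_closed witt_ring_zero_closed witt_ghost_add[OF I]
        witt_ghost_wtrunc I l_neg witt_ghost_zero[OF I])
  then show ?thesis using wtrunc_closed z by blast
qed

lemma cring_witt_ring: "cring (witt_ring p I R)"
proof -
  have g: "witt_ghost p R n x \<in> carrier R" if "x \<in> carrier (witt_ring p I R)" for x n
    using that by (intro witt_ghost_closed) (simp add: witt_ring_carrier)
  note cl = witt_ring_add_closed witt_ring_mult_closed witt_ring_zero_closed witt_ring_one_closed
  note gh = witt_ghost_add[OF I] witt_ghost_mult[OF I] witt_ghost_zero[OF I] witt_ghost_one[OF I]
  show ?thesis
  proof (rule cringI[OF abelian_groupI comm_monoidI], goal_cases)
    case (6 x)
    then show ?case by (rule witt_ring_neg_exists)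
  next
    case (12 x y z)
    then show ?case by (auto intro!: witt_eqI simp: cl gh g l_distr)
  qed (auto intro!: witt_eqI simp: cl gh g a_ac m_ac)
qed

lemma witt_ghost_ring_hom:
  "n \<in> I \<Longrightarrow> witt_ghost p R n \<in> ring_hom (witt_ring p I R) R"
  by (intro ring_hom_memI)
    (auto simp: witt_ghost_add[OF I] witt_ghost_mult[OF I] witt_ghost_one[OF I] witt_ring_carrier
      intro: witt_ghost_closed)

end

end

subsection \<open>Functoriality\<close>

lemma ring_hom_witt_ring:
  assumes "cring R" "cring S" "h \<in> ring_hom R S"
  shows "(\<lambda>x i. h (x i)) \<in> ring_hom (W p R) (W p S)"
proof -
  interpret ring_hom_cring R S h
    using assms by (simp add: ring_hom_cring_def ring_hom_cring_axioms_def)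
  have [simp]: "h (case_sum x y i) = case_sum (\<lambda>i. h (x i)) (\<lambda>i. h (y i)) i" for x y i
    by (simp split: sum.split)
  have ev: "h (eval_mpoly R f (case_sum x y)) =
      eval_mpoly S f (case_sum (\<lambda>i. h (x i)) (\<lambda>i. h (y i)))"
    if "\<forall>i. x i \<in> carrier R" "\<forall>i. y i \<in> carrier R" for x y :: "nat \<Rightarrow> _" and f
    using that by (subst ring_hom_eval_mpoly[OF assms]) (auto split: sum.split)
  show ?thesis
    by (intro ring_hom_memI) (auto simp: witt_ring_def ev teich_def)
qed

lemma ring_hom_witt_frob:
  assumes "cring R" "cring S" "h \<in> ring_hom R S" "x \<in> carrier (W p R)"
  shows "(\<lambda>i. h (witt_frob p UNIV R x i)) = witt_frob p UNIV S (\<lambda>i. h (x i))"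
  using assms(4) ring_hom_eval_mpoly[OF assms(1-3), of x] by (auto simp: witt_frob_def witt_ring_carrier)

context cring
begin

text \<open>Every family of Witt vectors over \<open>R\<close> is the image of the generic family over a
  polynomial ring, where identities can be checked on ghost components.\<close>

lemma generic_witt_vectors:
  assumes "\<And>a. x a \<in> carrier (W p R)"
  obtains h where "h \<in> ring_hom int_mpoly_ring R" "\<And>a. (\<lambda>i. h (pvar (a, i))) = x a"
proof
  have "case_prod x v \<in> carrier R" for v
    using assms by (auto simp: witt_ring_carrier split: prod.split)
  then show "(\<lambda>f. eval_mpoly R f (case_prod x)) \<in> ring_hom int_mpoly_ring R"
    "(\<lambda>i. eval_mpoly R (pvar (a, i)) (case_prod x)) = x a" for a
    by (simp_all add: eval_mpoly_ring_hom eval_mpoly_pvar)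
qed

end

context witt_base
begin

text \<open>The case of interest is \<open>R = k\<close>, where ghost components do not suffice.
  Each axiom holds for generic vectors over a polynomial ring and is mapped from there to
  \<open>W(R)\<close>.\<close>

lemma cring_W: "cring (W p R)"
proof -
  let ?Z = "int_mpoly_ring :: (nat \<times> nat) int_mpoly ring"
  interpret Z: cring "W p ?Z"
    by (rule frobenius_lift.cring_witt_ring[OF frobenius_lift_int_mpoly[OF prime_p]]) simp
  let ?X = "\<lambda>a i. pvar (a :: nat, i :: nat)"
  have X: "?X a \<in> carrier (W p ?Z)" for a by (simp add: witt_ring_carrier)
  \<comment> \<open>Three generic vectors serve all axioms, which have at most three variables.
    Preservation of zero is recorded separately: membership in \<open>ring_hom\<close> does not
    include it, and \<open>W p R\<close> is not yet known to be a ring.\<close>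
  have generic: "\<exists>H\<in>ring_hom (W p ?Z) (W p R). H (?X 0) = x \<and> H (?X 1) = y \<and> H (?X 2) = z \<and>
      H \<zero>\<^bsub>W p ?Z\<^esub> = \<zero>\<^bsub>W p R\<^esub>"
    if xyz: "x \<in> carrier (W p R)" "y \<in> carrier (W p R)" "z \<in> carrier (W p R)" for x y z
  proof -
    obtain h where h: "h \<in> ring_hom ?Z R"
      "\<And>a. (\<lambda>i. h (?X a i)) = (if a = 0 then x else if a = 1 then y else z)"
      by (rule generic_witt_vectors[of "\<lambda>a. if a = 0 then x else if a = 1 then y else z"])
        (use xyz in auto)
    interpret h: ring_hom_cring ?Z R h
      using h(1) by (simp add: ring_hom_cring_def ring_hom_cring_axioms_def cring_axioms
          int_mpoly_ring.cring_axioms)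
    show ?thesis
      by (intro bexI[OF _ ring_hom_witt_ring[OF int_mpoly_ring.cring_axioms cring_axioms h(1)]])
        (use h.hom_zero in \<open>simp add: h(2) witt_ring_def\<close>)
  qed
  note hom = ring_hom_add ring_hom_mult ring_hom_one ring_hom_closed
  note cl = witt_ring_add_closed witt_ring_mult_closed witt_ring_zero_closed witt_ring_one_closed
  show ?thesis
  proof (rule cringI[OF abelian_groupI comm_monoidI], goal_cases)
    case (3 x y z)
    then obtain H where H: "H \<in> ring_hom (W p ?Z) (W p R)" "H (?X 0) = x" "H (?X 1) = y" "H (?X 2) = z"
      using generic by blast
    show ?case
      using arg_cong[OF Z.a_assoc[OF X X X, of 0 1 2], of H]
      by (simp only: hom[OF H(1)] X Z.a_closed H)
  next
    case (4 x y)
    then obtain H where H: "H \<in> ring_hom (W p ?Z) (W p R)" "H (?X 0) = x" "H (?X 1) = y"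
      using generic[of x y x] by blast
    show ?case
      using arg_cong[OF Z.a_comm[OF X X, of 0 1], of H] by (simp only: hom[OF H(1)] X H)
  next
    case (5 x)
    then obtain H where H: "H \<in> ring_hom (W p ?Z) (W p R)" "H (?X 0) = x"
      "H \<zero>\<^bsub>W p ?Z\<^esub> = \<zero>\<^bsub>W p R\<^esub>"
      using generic[of x x x] by blast
    show ?case
      using arg_cong[OF Z.l_zero[OF X, of 0], of H] by (simp only: hom[OF H(1)] X H Z.zero_closed)
  next
    case (6 x)
    then obtain H where H: "H \<in> ring_hom (W p ?Z) (W p R)" "H (?X 0) = x"
      "H \<zero>\<^bsub>W p ?Z\<^esub> = \<zero>\<^bsub>W p R\<^esub>"
      using generic[of x x x] by blast
    show ?case
      using arg_cong[OF Z.l_neg[OF X, of 0], of H]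
      by (intro bexI[of _ "H (\<ominus>\<^bsub>W p ?Z\<^esub> ?X 0)"]) (simp_all only: hom[OF H(1)] X H Z.a_inv_closed)
  next
    case (9 x y z)
    then obtain H where H: "H \<in> ring_hom (W p ?Z) (W p R)" "H (?X 0) = x" "H (?X 1) = y" "H (?X 2) = z"
      using generic by blast
    show ?case
      using arg_cong[OF Z.m_assoc[OF X X X, of 0 1 2], of H]
      by (simp only: hom[OF H(1)] X Z.m_closed H)
  next
    case (10 x)
    then obtain H where H: "H \<in> ring_hom (W p ?Z) (W p R)" "H (?X 0) = x"
      using generic[of x x x] by blast
    show ?case
      using arg_cong[OF Z.l_one[OF X, of 0], of H] by (simp only: hom[OF H(1)] X H Z.one_closed)
  next
    case (11 x y)
    then obtain H where H: "H \<in> ring_hom (W p ?Z) (W p R)" "H (?X 0) = x" "H (?X 1) = y"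
      using generic[of x y x] by blast
    show ?case
      using arg_cong[OF Z.m_comm[OF X X, of 0 1], of H] by (simp only: hom[OF H(1)] X H)
  next
    case (12 x y z)
    then obtain H where H: "H \<in> ring_hom (W p ?Z) (W p R)" "H (?X 0) = x" "H (?X 1) = y" "H (?X 2) = z"
      using generic by blast
    show ?case
      using arg_cong[OF Z.l_distr[OF X X X, of 0 1 2], of H]
      by (simp only: hom[OF H(1)] X Z.m_closed Z.a_closed H)
  qed (use cl in auto)
qed

text \<open>On ghost components \<open>F\<close> is the shift from \<open>n\<close> to
  \<open>n + 1\<close>, so over the polynomial ring it respects the operations; naturality of
  \<open>F\<close> in the ring carries this over to \<open>R\<close>.\<close>

lemma witt_frob_ring_hom: "witt_frob p UNIV R \<in> ring_hom (W p R) (W p R)"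
proof -
  let ?Z = "int_mpoly_ring :: (bool \<times> nat) int_mpoly ring"
  interpret Z: frobenius_lift p ?Z "pow_subst p"
    by (rule frobenius_lift_int_mpoly[OF prime_p])
  let ?F = "witt_frob p UNIV ?Z" and ?X = "\<lambda>a i. pvar (a :: bool, i :: nat)"
  have X: "?X a \<in> carrier (W p ?Z)" for a by (simp add: witt_ring_carrier)
  have F: "?F x \<in> carrier (W p ?Z)" for x by (simp add: witt_ring_carrier)
  have univ: "x \<in> carrier (W p ?Z)" for x by (simp add: witt_ring_carrier)
  note gh = Z.witt_ghost_frob Z.witt_ghost_add Z.witt_ghost_mult Z.witt_ghost_one univ
  have add: "?F (x \<oplus>\<^bsub>W p ?Z\<^esub> y) = ?F x \<oplus>\<^bsub>W p ?Z\<^esub> ?F y"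
    and mult: "?F (x \<otimes>\<^bsub>W p ?Z\<^esub> y) = ?F x \<otimes>\<^bsub>W p ?Z\<^esub> ?F y"
    and one: "?F \<one>\<^bsub>W p ?Z\<^esub> = \<one>\<^bsub>W p ?Z\<^esub>" for x y
    by (rule Z.witt_eqI[of UNIV]; simp add: gh)+
  have frob: "witt_frob p UNIV R x \<in> carrier (W p R)" if "x \<in> carrier (W p R)" for x
    using that by (intro witt_frob_closed) (simp add: witt_ring_carrier)
  have generic: "\<exists>H\<in>ring_hom (W p ?Z) (W p R). H (?X True) = x \<and> H (?X False) = y \<and>
      (\<forall>z. H (?F z) = witt_frob p UNIV R (H z))"
    if xy: "x \<in> carrier (W p R)" "y \<in> carrier (W p R)" for x y
  proof -
    obtain h where h: "h \<in> ring_hom ?Z R" "\<And>a. (\<lambda>i. h (?X a i)) = (if a then x else y)"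
      by (rule generic_witt_vectors[of "\<lambda>a. if a then x else y"]) (use xy in auto)
    show ?thesis
      by (intro bexI[OF _ ring_hom_witt_ring[OF int_mpoly_ring.cring_axioms cring_axioms h(1)]])
        (simp add: h(2) ring_hom_witt_frob[OF int_mpoly_ring.cring_axioms cring_axioms h(1) univ])
  qed
  show ?thesis
  proof (rule ring_hom_memI)
    fix x y assume xy: "x \<in> carrier (W p R)" "y \<in> carrier (W p R)"
    obtain H where H: "H \<in> ring_hom (W p ?Z) (W p R)" "H (?X True) = x" "H (?X False) = y"
      "\<And>z. H (?F z) = witt_frob p UNIV R (H z)"
      using generic[OF xy] by blast
    show "witt_frob p UNIV R (x \<otimes>\<^bsub>W p R\<^esub> y) =
        witt_frob p UNIV R x \<otimes>\<^bsub>W p R\<^esub> witt_frob p UNIV R y"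
      using arg_cong[OF mult[of "?X True" "?X False"], of H]
      by (simp only: H ring_hom_mult[OF H(1) univ univ])
    show "witt_frob p UNIV R (x \<oplus>\<^bsub>W p R\<^esub> y) =
        witt_frob p UNIV R x \<oplus>\<^bsub>W p R\<^esub> witt_frob p UNIV R y"
      using arg_cong[OF add[of "?X True" "?X False"], of H]
      by (simp only: H ring_hom_add[OF H(1) univ univ])
  next
    obtain H where H: "H \<in> ring_hom (W p ?Z) (W p R)"
      "\<And>z. H (?F z) = witt_frob p UNIV R (H z)"
      using generic[OF witt_ring_zero_closed witt_ring_zero_closed] by blast
    show "witt_frob p UNIV R \<one>\<^bsub>W p R\<^esub> = \<one>\<^bsub>W p R\<^esub>"
      using arg_cong[OF one, of H] by (simp only: H ring_hom_one[OF H(1)])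
  qed (rule frob)
qed

end

section \<open>Verschiebung on ghost components\<close>

lemma (in cring) finsum_nat_mult:
  assumes "f \<in> I \<rightarrow> carrier R"
  shows "[(m::nat)] \<cdot> (\<Oplus>i\<in>I. f i) = (\<Oplus>i\<in>I. [m] \<cdot> f i)"
  using assms by (induction I rule: infinite_finite_induct) (auto simp: Pi_def add.nat_pow_distrib)

context witt_base
begin

text \<open>Splits off the first component, not the last: this is
  \<open>x = [x_0] + V(x_1, x_2, ...)\<close> on ghost components.\<close>

lemma witt_ghost_decompose:
  assumes "\<And>i. x i \<in> carrier R"
  shows "witt_ghost p R (Suc n) x =
    x 0 [^] (p ^ Suc n) \<oplus> [p] \<cdot> witt_ghost p R n (\<lambda>i. x (Suc i))"
proof -
  have "witt_ghost p R (Suc n) x =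
      (\<Oplus>i\<in>{..n}. [(p ^ Suc i)] \<cdot> (x (Suc i) [^] (p ^ (n - i)))) \<oplus> x 0 [^] (p ^ Suc n)"
    unfolding witt_ghost_def by (subst finsum_Suc2) (use assms in \<open>auto simp del: power_Suc\<close>)
  also have "(\<Oplus>i\<in>{..n}. [(p ^ Suc i)] \<cdot> (x (Suc i) [^] (p ^ (n - i)))) =
      (\<Oplus>i\<in>{..n}. [p] \<cdot> ([(p ^ i)] \<cdot> (x (Suc i) [^] (p ^ (n - i)))))"
    using assms by (intro finsum_cong') (auto simp: add.nat_pow_pow mult.commute)
  also have "\<dots> = [p] \<cdot> witt_ghost p R n (\<lambda>i. x (Suc i))"
    unfolding witt_ghost_def using assms by (subst finsum_nat_mult) auto
  finally show ?thesis using assms by (simp add: a_comm witt_ghost_closed del: power_Suc)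
qed

lemma witt_ghost_ver:
  assumes x: "\<And>i. x i \<in> carrier R" and I: "down_closed I" "n \<in> I"
  shows "witt_ghost p R n (witt_ver I R x) = (case n of 0 \<Rightarrow> \<zero> | Suc m \<Rightarrow> [p] \<cdot> witt_ghost p R m x)"
proof -
  let ?y = "\<lambda>i. case i of 0 \<Rightarrow> \<zero> | Suc j \<Rightarrow> x j"
  have y: "?y i \<in> carrier R" for i using x by (simp split: nat.split)
  have "witt_ghost p R n (witt_ver I R x) = witt_ghost p R n ?y"
    unfolding witt_ver_def using y I by (intro witt_ghost_wtrunc)
  also have "\<dots> = (case n of 0 \<Rightarrow> \<zero> | Suc m \<Rightarrow> [p] \<cdot> witt_ghost p R m x)"
  proof (cases n)
    case 0
    then show ?thesis using witt_ghost_0[of ?y p] y by simp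
  next
    case (Suc m)
    then show ?thesis
      using witt_ghost_decompose[of ?y m, OF y] x prime_gt_0_nat[OF prime_p]
      by (simp add: nat_pow_zero witt_ghost_closed)
  qed
  finally show ?thesis .
qed

lemma witt_ver_pow_one:
  assumes "down_closed I"
  shows "(witt_ver I R ^^ i) \<one>\<^bsub>witt_ring p I R\<^esub> = (\<lambda>j. if j = i \<and> i \<in> I then \<one> else \<zero>)"
proof (induction i)
  case 0
  then show ?case by (auto simp: witt_ring_def wtrunc_def teich_def)
next
  case (Suc i)
  then show ?case
    using assms by (auto simp: witt_ver_def wtrunc_def down_closed_def subset_iff split: nat.split)
qed

lemma witt_ghost_ver_pow_one:
  assumes I: "down_closed I" and n: "n \<in> I"
  shows "witt_ghost p R n ((witt_ver I R ^^ i) \<one>\<^bsub>witt_ring p I R\<^esub>) =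
    (if i \<le> n then [(p ^ i)] \<cdot> \<one> else \<zero>)"
proof (cases "i \<in> I")
  case True
  then show ?thesis
    using witt_ghost_single[OF I n, of \<one> i] by (simp add: witt_ver_pow_one[OF I])
next
  case False
  then have "\<not> i \<le> n" using I n by (auto simp: down_closed_def)
  then show ?thesis
    using False witt_ghost_single[OF I n, of \<zero> i] prime_gt_0_nat[OF prime_p]
    by (simp add: witt_ver_pow_one[OF I] nat_pow_zero cong: if_cong)
qed

end

subsection \<open>The section of a Frobenius lift\<close>

context frobenius_lift
begin

lemma lift_pow_ring_hom: "\<psi> ^^ n \<in> ring_hom R R"
proof (induction n)
  case (Suc n)
  then show ?case using ring_hom_trans[OF Suc lift_hom] by (simp add: o_def)
qed (auto simp: ring_hom_def)

text \<open>The sequence \<open>a, \<psi> a, \<psi>^2 a, ...\<close> satisfies the congruences of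
  Dwork's lemma as equalities, so it is the ghost vector of some \<open>s a\<close>. As the ghost
  map is injective, the ring homomorphism laws and \<open>F s = s \<psi>\<close> follow from the
  corresponding properties of the powers of \<psi>.\<close>

lemma lift_section_exists:
  "\<exists>s. s \<in> ring_hom R (W p R) \<and> (\<forall>a\<in>carrier R. witt_frob p UNIV R (s a) = s (\<psi> a)) \<and>
    (\<forall>a\<in>carrier R. \<forall>n. witt_ghost p R n (s a) = (\<psi> ^^ n) a)"
proof -
  note pw = lift_pow_ring_hom
  have "\<exists>x. x \<in> carrier (W p R) \<and> (\<forall>n. witt_ghost p R n x = (\<psi> ^^ n) a)" if "a \<in> carrier R" for a
  proof -
    have "(\<psi> ^^ n) a \<in> carrier R" for n using ring_hom_closed[OF pw that] .
    then have "\<exists>x. (\<forall>i. x i \<in> carrier R) \<and> (\<forall>n. witt_ghost p R n x = (\<psi> ^^ n) a)"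
      by (intro dwork_lemma) (simp_all add: cong_mod_refl lift_closed)
    then show ?thesis by (simp add: witt_ring_carrier)
  qed
  then obtain s where s: "\<And>a. a \<in> carrier R \<Longrightarrow> s a \<in> carrier (W p R)"
    "\<And>a n. a \<in> carrier R \<Longrightarrow> witt_ghost p R n (s a) = (\<psi> ^^ n) a" by metis
  have frob: "witt_frob p UNIV R x \<in> carrier (W p R)" if "x \<in> carrier (W p R)" for x
    using that by (intro witt_frob_closed) (simp add: witt_ring_carrier)
  have comp: "x i \<in> carrier R" if "x \<in> carrier (W p R)" for x i
    using that by (simp add: witt_ring_carrier)
  have "s \<in> ring_hom R (W p R)"
    by (intro ring_hom_memI witt_eqI[OF down_closed_UNIV])
      (simp_all add: s witt_ring_add_closed witt_ring_mult_closed witt_ring_one_closed witt_ghost_add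
        witt_ghost_mult witt_ghost_one ring_hom_add[OF pw] ring_hom_mult[OF pw] ring_hom_one[OF pw])
  moreover have "witt_frob p UNIV R (s a) = s (\<psi> a)" if "a \<in> carrier R" for a
  proof (rule witt_eqI[OF down_closed_UNIV])
    fix n
    have "witt_ghost p R n (witt_frob p UNIV R (s a)) = witt_ghost p R (Suc n) (s a)"
      using that by (intro witt_ghost_frob) (simp_all add: comp s)
    then show "witt_ghost p R n (witt_frob p UNIV R (s a)) = witt_ghost p R n (s (\<psi> a))"
      using that by (simp add: s lift_closed funpow_swap1)
  qed (use that in \<open>simp_all add: s lift_closed frob\<close>)
  ultimately show ?thesis using s by blast
qed

end

subsection \<open>Witt vectors over a perfect ring\<close>

text \<open>The ghost components of the Frobenius polynomials are
  \<open>w_(m+1)(X) = w_m(X^p) + p^(m+1) X_(m+1)\<close>; modulo \<open>p^(m+1)\<close> they are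
  those of the vector of \<open>p\<close>-th powers.\<close>

lemma witt_frob_poly_cong:
  assumes "prime p"
  shows "cong_mod int_mpoly_ring p (witt_frob_poly p i) (pvar i ^ p)"
proof -
  interpret Z: frobenius_lift p int_mpoly_ring "pow_subst p :: nat int_mpoly \<Rightarrow> _"
    by (rule frobenius_lift_int_mpoly[OF assms])
  have "cong_mod int_mpoly_ring (p ^ Suc m) (witt_ghost p int_mpoly_ring m (witt_frob_poly p))
      (witt_ghost p int_mpoly_ring m (\<lambda>i. pvar i ^ p))" for m
    using witt_frob_poly_ghost[OF assms, of m] int_mpoly_ring.witt_ghost_Suc[of pvar p m]
    by (simp add: cong_mod_int_mpoly_ring witt_poly_eq_ghost)
  then show ?thesis
    by (rule Z.cong_mod_if_witt_ghost_cong_mod[rotated 2]) simp_all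
qed

locale witt_perfect =
  fixes p :: nat and k :: "('k, 'm) ring_scheme"
  assumes prime_p: "prime p" and perfect: "perfect_ring p k"
begin

abbreviation "A \<equiv> W p k"
abbreviation "\<phi> \<equiv> phi p k"

sublocale k: witt_base k p
  by (intro witt_base.intro witt_base_axioms.intro prime_p) (use perfect in \<open>simp add: perfect_ring_def\<close>)

sublocale A_cring: cring A
  by (rule k.cring_W)

lemma A_component [simp]: "x \<in> carrier A \<Longrightarrow> x i \<in> carrier k"
  by (simp add: witt_ring_carrier)

lemma A_zero: "\<zero>\<^bsub>A\<^esub> = (\<lambda>_. \<zero>\<^bsub>k\<^esub>)"
  unfolding witt_ring_def by simp

lemma p_mult_eq_zero: "c \<in> carrier k \<Longrightarrow> [p] \<cdot>\<^bsub>k\<^esub> c = \<zero>\<^bsub>k\<^esub>"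
  using perfect k.add_pow_ldistr[of "\<one>\<^bsub>k\<^esub>" c p] by (simp add: perfect_ring_def)

lemma cong_mod_p_iff: "b \<in> carrier k \<Longrightarrow> cong_mod k p a b \<longleftrightarrow> a = b"
  using k.zero_closed by (auto simp: cong_mod_def p_mult_eq_zero)

lemma eval_mpoly_cong:
  assumes "cong_mod int_mpoly_ring p f g" "\<And>i. v i \<in> carrier k"
  shows "eval_mpoly k f v = eval_mpoly k g v"
  using ring_hom_cong_mod[OF int_mpoly_ring.cring_axioms k.cring_axioms k.eval_mpoly_ring_hom, of v g p f]
    assms cong_mod_p_iff[OF eval_mpoly_closed[OF k.cring_axioms], of v] by simp

text \<open>The Frobenius polynomial with index \<open>i\<close> is congruent to
  \<open>X_i^p\<close> modulo \<open>p\<close>, and \<open>p\<close> is zero in \<open>k\<close>.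
  Bijectivity of \<phi> on \<open>A\<close> follows from this and perfectness.\<close>

lemma phi_component:
  assumes "x \<in> carrier A" shows "\<phi> x i = x i [^]\<^bsub>k\<^esub> p"
proof -
  have x: "x i \<in> carrier k" for i using assms by simp
  have "\<phi> x i = eval_mpoly k (pvar i ^ p) x"
    unfolding phi_def witt_frob_def wtrunc_UNIV
    by (rule eval_mpoly_cong[OF witt_frob_poly_cong[OF prime_p] x])
  also have "\<dots> = x i [^]\<^bsub>k\<^esub> p"
    using ring_hom_nat_pow[OF int_mpoly_ring.cring_axioms k.cring_axioms k.eval_mpoly_ring_hom,
        of x "pvar i" p] x by (simp add: k.eval_mpoly_pvar)
  finally show ?thesis .
qed

lemma pow_p_inject: "x \<in> carrier k \<Longrightarrow> y \<in> carrier k \<Longrightarrow> x [^]\<^bsub>k\<^esub> p = y [^]\<^bsub>k\<^esub> p \<Longrightarrow> x = y"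
  using perfect unfolding perfect_ring_def bij_betw_def inj_on_def by blast

lemma pow_p_surj: "y \<in> carrier k \<Longrightarrow> \<exists>x\<in>carrier k. x [^]\<^bsub>k\<^esub> p = y"
  using perfect unfolding perfect_ring_def bij_betw_def by (metis imageE)

text \<open>This is \<open>p = VF\<close> in characteristic \<open>p\<close>. For indeterminates,
  ghost component \<open>m\<close> of \<open>p X\<close> exceeds that of \<open>V(X^p)\<close> by
  \<open>p^(m+1) X_m\<close>, so the two vectors agree modulo \<open>p\<close> in every
  component.\<close>

lemma p_mult_component:
  assumes x: "x \<in> carrier A"
  shows "([p] \<cdot>\<^bsub>A\<^esub> x) i = (case i of 0 \<Rightarrow> \<zero>\<^bsub>k\<^esub> | Suc j \<Rightarrow> x j [^]\<^bsub>k\<^esub> p)"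
proof -
  let ?Z = "int_mpoly_ring :: nat int_mpoly ring"
  interpret Z: frobenius_lift p ?Z "pow_subst p"
    by (rule frobenius_lift_int_mpoly[OF prime_p])
  have univ: "y \<in> carrier (W p ?Z)" for y by (simp add: witt_ring_carrier)
  define Y where "Y = [p] \<cdot>\<^bsub>W p ?Z\<^esub> (pvar :: nat \<Rightarrow> nat int_mpoly)"
  define V where "V = witt_ver UNIV ?Z (\<lambda>j. pvar j ^ p)"
  have ghost_Y: "witt_ghost p ?Z m Y = of_nat p * witt_ghost p ?Z m pvar" for m
    using ring_hom_nat_mult[OF Z.cring_W int_mpoly_ring.cring_axioms
        Z.witt_ghost_ring_hom[OF down_closed_UNIV UNIV_I] univ, where x = pvar and n = p]
    by (simp add: Y_def)
  have ghost_V: "witt_ghost p ?Z m V =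
      (case m of 0 \<Rightarrow> 0 | Suc l \<Rightarrow> of_nat p * witt_ghost p ?Z l (\<lambda>j. pvar j ^ p))" for m
    unfolding V_def by (subst Z.witt_ghost_ver) (simp_all split: nat.split)
  have "cong_mod ?Z (p ^ Suc m) (witt_ghost p ?Z m Y) (witt_ghost p ?Z m V)" for m
  proof (cases m)
    case 0
    then show ?thesis by (simp add: cong_mod_int_mpoly_ring ghost_Y ghost_V)
  next
    case (Suc l)
    have "witt_ghost p ?Z m Y - witt_ghost p ?Z m V = of_nat (p ^ Suc m) * pvar m"
      using int_mpoly_ring.witt_ghost_Suc[of pvar p l] Suc
      by (simp add: ghost_Y ghost_V algebra_simps)
    then show ?thesis unfolding cong_mod_int_mpoly_ring by (metis dvd_triv_left)
  qed
  then have cong: "cong_mod ?Z p (Y i) (V i)"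
    by (rule Z.cong_mod_if_witt_ghost_cong_mod[rotated 2]) simp_all
  have xi: "x i \<in> carrier k" for i using x by simp
  let ?h = "\<lambda>f. eval_mpoly k f x"
  note h = k.eval_mpoly_ring_hom[of x, OF xi]
  have "(\<lambda>i. ?h (Y i)) = [p] \<cdot>\<^bsub>A\<^esub> x"
    using ring_hom_nat_mult[OF Z.cring_W A_cring.cring_axioms
        ring_hom_witt_ring[OF int_mpoly_ring.cring_axioms k.cring_axioms h] univ,
        where x = pvar and n = p] xi
    by (simp add: Y_def k.eval_mpoly_pvar)
  then have "([p] \<cdot>\<^bsub>A\<^esub> x) i = ?h (Y i)" by metis
  also have "\<dots> = ?h (V i)" by (rule eval_mpoly_cong[OF cong xi])
  also have "\<dots> = (case i of 0 \<Rightarrow> \<zero>\<^bsub>k\<^esub> | Suc j \<Rightarrow> x j [^]\<^bsub>k\<^esub> p)"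
    using ring_hom_nat_pow[OF int_mpoly_ring.cring_axioms k.cring_axioms h, of _ p] xi
    by (simp add: V_def witt_ver_def k.eval_mpoly_pvar eval_mpoly_def[of k 0] split: nat.split)
  finally show ?thesis .
qed

lemma component_0_ring_hom: "(\<lambda>x. x 0) \<in> ring_hom A k"
proof -
  have 0: "x 0 = witt_ghost p k 0 x" if "x \<in> carrier A" for x
    using k.witt_ghost_0[of x p] that by simp
  show ?thesis
    by (intro ring_hom_memI)
      (simp_all add: 0 k.witt_ring_add_closed k.witt_ring_mult_closed k.witt_ring_one_closed
        k.witt_ghost_add k.witt_ghost_mult k.witt_ghost_one k.witt_ghost_closed)
qed

text \<open>Because \<open>p = VF\<close> with \<open>F\<close> onto, a vector with component 0
  equal to zero is a multiple of \<open>p\<close>; this applies to the difference of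
  \<open>\<phi> x\<close> and the \<open>p\<close>-th power of \<open>x\<close>. Torsion freeness
  holds because \<open>V\<close> and \<open>F\<close> are injective.\<close>

sublocale A: frobenius_lift p A \<phi>
proof
  show hom: "\<phi> \<in> ring_hom A A"
    unfolding phi_def by (rule k.witt_frob_ring_hom)
  show "cong_mod A p (\<phi> x) (x [^]\<^bsub>A\<^esub> p)" if x: "x \<in> carrier A" for x
  proof -
    let ?d = "\<phi> x \<ominus>\<^bsub>A\<^esub> x [^]\<^bsub>A\<^esub> p"
    have \<phi>x: "\<phi> x \<in> carrier A" using ring_hom_closed[OF hom x] .
    have d: "?d \<in> carrier A" using x \<phi>x by simp
    have sum: "\<phi> x = x [^]\<^bsub>A\<^esub> p \<oplus>\<^bsub>A\<^esub> ?d"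
      using x \<phi>x by (simp add: A_cring.minus_eq A_cring.a_ac A_cring.r_neg)
    then have "\<phi> x 0 = x 0 [^]\<^bsub>k\<^esub> p \<oplus>\<^bsub>k\<^esub> ?d 0"
      using ring_hom_add[OF component_0_ring_hom A_cring.nat_pow_closed[OF x] d, of p]
        ring_hom_nat_pow[OF A_cring.cring_axioms k.cring_axioms component_0_ring_hom x, of p]
      by metis
    then have d0: "?d 0 = \<zero>\<^bsub>k\<^esub>"
      using x d by (simp add: phi_component)
    \<comment> \<open>Dividing by \<open>p = VF\<close> undoes the shift and takes
      \<open>p\<close>-th roots of the components.\<close>
    obtain y where y: "\<And>j. y j \<in> carrier k" "\<And>j. y j [^]\<^bsub>k\<^esub> p = ?d (Suc j)"
    proof -
      have "\<forall>j. \<exists>z. z \<in> carrier k \<and> z [^]\<^bsub>k\<^esub> p = ?d (Suc j)"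
        using pow_p_surj[OF A_component[OF d]] by blast
      then show thesis using that by (auto dest!: choice)
    qed
    have yA: "y \<in> carrier A" using y by (simp add: witt_ring_carrier)
    have "?d = [p] \<cdot>\<^bsub>A\<^esub> y"
    proof
      fix i
      show "?d i = ([p] \<cdot>\<^bsub>A\<^esub> y) i"
        unfolding p_mult_component[OF yA] using d0 y(2) by (cases i) simp_all
    qed
    with yA show ?thesis using sum unfolding cong_mod_def by metis
  qed
  show "x = \<zero>\<^bsub>A\<^esub>" if x: "x \<in> carrier A" and "[p] \<cdot>\<^bsub>A\<^esub> x = \<zero>\<^bsub>A\<^esub>" for x
  proof
    fix j
    have "x j [^]\<^bsub>k\<^esub> p = \<zero>\<^bsub>k\<^esub>"
      using p_mult_component[OF x, of "Suc j"] unfolding that(2) by (simp add: A_zero)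
    then have "x j [^]\<^bsub>k\<^esub> p = \<zero>\<^bsub>k\<^esub> [^]\<^bsub>k\<^esub> p"
      using prime_gt_0_nat[OF prime_p] by (simp add: k.nat_pow_zero)
    then show "x j = \<zero>\<^bsub>A\<^esub> j"
      using pow_p_inject[of "x j" "\<zero>\<^bsub>k\<^esub>"] x by (simp add: A_zero)
  qed
qed (rule prime_p)

lemma phi_inject: "x \<in> carrier A \<Longrightarrow> y \<in> carrier A \<Longrightarrow> \<phi> x = \<phi> y \<Longrightarrow> x = y"
  by (rule ext, rule pow_p_inject) (simp_all flip: phi_component)

lemma phi_surj:
  assumes "y \<in> carrier A" shows "\<exists>x\<in>carrier A. \<phi> x = y"
proof -
  obtain x where x: "\<And>i. x i \<in> carrier k" "\<And>i. x i [^]\<^bsub>k\<^esub> p = y i"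
    using pow_p_surj[OF A_component[OF assms]] by metis
  then have "x \<in> carrier A" by (simp add: witt_ring_carrier)
  then show ?thesis using x(2) by (intro bexI[of _ x]) (auto simp: phi_component)
qed

lemma phi_pow_closed: "x \<in> carrier A \<Longrightarrow> (\<phi> ^^ n) x \<in> carrier A"
  by (induction n) (simp_all add: A.lift_closed)

lemma phi_pow_inject: "x \<in> carrier A \<Longrightarrow> y \<in> carrier A \<Longrightarrow> (\<phi> ^^ n) x = (\<phi> ^^ n) y \<Longrightarrow> x = y"
  by (induction n) (use phi_inject phi_pow_closed in auto)

lemma phi_pow_surj: "y \<in> carrier A \<Longrightarrow> \<exists>x\<in>carrier A. (\<phi> ^^ n) x = y"
proof (induction n arbitrary: y)
  case (Suc n)
  obtain z where "z \<in> carrier A" "\<phi> z = y" using phi_surj[OF Suc.prems] by blast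
  moreover obtain x where "x \<in> carrier A" "(\<phi> ^^ n) x = z" using Suc.IH calculation(1) by blast
  ultimately show ?case by auto
qed auto

subsection \<open>The coefficients of a truncated Witt vector\<close>

lemma s_phi:
  shows s_phi_ring_hom: "s_phi p k \<in> ring_hom A (W p A)"
    and s_phi_frob: "a \<in> carrier A \<Longrightarrow> witt_frob p UNIV A (s_phi p k a) = s_phi p k (\<phi> a)"
    and s_phi_ghost: "a \<in> carrier A \<Longrightarrow> witt_ghost p A n (s_phi p k a) = (\<phi> ^^ n) a"
  using someI_ex[OF A.lift_section_exists] unfolding s_phi_def by blast+

lemma s_phi_closed: "a \<in> carrier A \<Longrightarrow> s_phi p k a \<in> carrier (W p A)"
  by (rule ring_hom_closed[OF s_phi_ring_hom])

definition s_res :: "nat \<Rightarrow> (nat \<Rightarrow> 'k) \<Rightarrow> nat \<Rightarrow> (nat \<Rightarrow> 'k)" where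
  "s_res n a = witt_res n A (s_phi p k a)"

definition V_one :: "nat \<Rightarrow> nat \<Rightarrow> nat \<Rightarrow> (nat \<Rightarrow> 'k)" where
  "V_one n i = (witt_ver {..<n} A ^^ i) \<one>\<^bsub>Wn p n A\<^esub>"

lemma cring_Wn: "cring (Wn p n A)"
  by (rule A.cring_witt_ring) simp

lemma s_res_closed: "a \<in> carrier A \<Longrightarrow> s_res n a \<in> carrier (Wn p n A)"
  unfolding s_res_def using s_phi_closed by (intro A.wtrunc_closed) (auto simp: witt_ring_carrier)

lemma s_res_ghost: "a \<in> carrier A \<Longrightarrow> m < n \<Longrightarrow> witt_ghost p A m (s_res n a) = (\<phi> ^^ m) a"
  unfolding s_res_def using s_phi_closed[of a]
  by (subst A.witt_ghost_wtrunc) (auto simp: witt_ring_carrier s_phi_ghost)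

lemma V_one_eq: "V_one n i = (\<lambda>j. if j = i \<and> i < n then \<one>\<^bsub>A\<^esub> else \<zero>\<^bsub>A\<^esub>)"
  unfolding V_one_def by (subst A.witt_ver_pow_one) auto

lemma V_one_closed: "V_one n i \<in> carrier (Wn p n A)"
  by (simp add: V_one_eq witt_ring_carrier[where R = A])

lemma V_one_ghost:
  "m < n \<Longrightarrow> witt_ghost p A m (V_one n i) = (if i \<le> m then [(p ^ i)] \<cdot>\<^bsub>A\<^esub> \<one>\<^bsub>A\<^esub> else \<zero>\<^bsub>A\<^esub>)"
  unfolding V_one_def by (rule A.witt_ghost_ver_pow_one) auto

lemma s_res_ring_hom: "s_res n \<in> ring_hom A (Wn p n A)"
proof -
  note pw = A.lift_pow_ring_hom
  show ?thesis
    by (intro ring_hom_memI A.witt_eqI[OF down_closed_lessThan[of n]])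
      (simp_all add: s_res_closed s_res_ghost A.witt_ring_add_closed A.witt_ring_mult_closed
        A.witt_ring_one_closed A.witt_ghost_add A.witt_ghost_mult A.witt_ghost_one
        ring_hom_add[OF pw] ring_hom_mult[OF pw] ring_hom_one[OF pw])
qed

definition s_sum :: "nat \<Rightarrow> (nat \<Rightarrow> nat \<Rightarrow> 'k) \<Rightarrow> nat \<Rightarrow> (nat \<Rightarrow> 'k)" where
  "s_sum n a = (\<Oplus>\<^bsub>Wn p n A\<^esub>i\<in>{..<n}. s_res n (a i) \<otimes>\<^bsub>Wn p n A\<^esub> V_one n i)"

lemma s_sum_closed:
  assumes "\<And>i. i < n \<Longrightarrow> a i \<in> carrier A" shows "s_sum n a \<in> carrier (Wn p n A)"
proof -
  interpret Wn: cring "Wn p n A" by (rule cring_Wn)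
  show ?thesis unfolding s_sum_def using assms
    by (intro Wn.finsum_closed) (auto intro!: Wn.m_closed s_res_closed V_one_closed)
qed

text \<open>The system is triangular in the coefficients: \<open>a i\<close> first appears in
  component \<open>i\<close>, multiplied by \<open>p^i\<close> and twisted by the automorphism
  \<open>\<phi>^i\<close>. Uniqueness and existence of the coefficients both rest on this.\<close>

lemma s_sum_ghost:
  assumes a: "\<And>i. i < n \<Longrightarrow> a i \<in> carrier A" and m: "m < n"
  shows "witt_ghost p A m (s_sum n a) = (\<Oplus>\<^bsub>A\<^esub>i\<in>{..m}. [(p ^ i)] \<cdot>\<^bsub>A\<^esub> (\<phi> ^^ m) (a i))"
proof -
  interpret Wn: cring "Wn p n A" by (rule cring_Wn)
  interpret g: ring_hom_cring "Wn p n A" A "witt_ghost p A m"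
    using A.witt_ghost_ring_hom[OF down_closed_lessThan, of m n] m
    by (simp add: ring_hom_cring_def ring_hom_cring_axioms_def Wn.cring_axioms A_cring.cring_axioms)
  have "witt_ghost p A m (s_sum n a) =
      (\<Oplus>\<^bsub>A\<^esub>i\<in>{..<n}. witt_ghost p A m (s_res n (a i) \<otimes>\<^bsub>Wn p n A\<^esub> V_one n i))"
    unfolding s_sum_def using a
    by (subst g.hom_finsum) (auto intro!: Wn.m_closed s_res_closed V_one_closed simp: o_def)
  also have "\<dots> = (\<Oplus>\<^bsub>A\<^esub>i\<in>{..<n}. if i \<le> m then [(p ^ i)] \<cdot>\<^bsub>A\<^esub> (\<phi> ^^ m) (a i) else \<zero>\<^bsub>A\<^esub>)"
    using a m by (intro A_cring.finsum_cong')
      (auto simp: s_res_closed V_one_closed s_res_ghost V_one_ghost phi_pow_closed A_cring.add_pow_rdistr)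
  also have "\<dots> = (\<Oplus>\<^bsub>A\<^esub>i\<in>{..m}. [(p ^ i)] \<cdot>\<^bsub>A\<^esub> (\<phi> ^^ m) (a i))"
    using a m by (intro A_cring.add.finprod_mono_neutral_cong_right) (auto simp: phi_pow_closed)
  finally show ?thesis .
qed

lemma s_sum_inject:
  assumes a: "\<And>i. i < n \<Longrightarrow> a i \<in> carrier A" and b: "\<And>i. i < n \<Longrightarrow> b i \<in> carrier A"
    and eq: "s_sum n a = s_sum n b" and "i < n"
  shows "a i = b i"
  using \<open>i < n\<close>
proof (induction i rule: less_induct)
  case (less i)
  let ?f = "\<lambda>a j. [(p ^ j)] \<cdot>\<^bsub>A\<^esub> (\<phi> ^^ i) (a j)"
  have split: "witt_ghost p A i (s_sum n c) = ?f c i \<oplus>\<^bsub>A\<^esub> (\<Oplus>\<^bsub>A\<^esub>j\<in>{..<i}. ?f c j)"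
    if "\<And>i. i < n \<Longrightarrow> c i \<in> carrier A" for c
  proof -
    have "{..i} = insert i {..<i}" by auto
    then show ?thesis
      using that less.prems by (subst s_sum_ghost) (simp_all add: phi_pow_closed Pi_def)
  qed
  have same: "(\<Oplus>\<^bsub>A\<^esub>j\<in>{..<i}. ?f a j) = (\<Oplus>\<^bsub>A\<^esub>j\<in>{..<i}. ?f b j)"
    using less b by (intro A_cring.finsum_cong') (auto simp: phi_pow_closed)
  have "(\<Oplus>\<^bsub>A\<^esub>j\<in>{..<i}. ?f b j) \<in> carrier A"
    using b less.prems by (intro A_cring.finsum_closed) (auto simp: phi_pow_closed)
  then have "?f a i = ?f b i"
    using split[of a] split[of b] a b eq less.prems same by (simp add: phi_pow_closed)
  then have "(\<phi> ^^ i) (a i) = (\<phi> ^^ i) (b i)"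
    by (rule A.p_power_cancel[rotated 2]) (use a b less.prems in \<open>simp_all add: phi_pow_closed\<close>)
  then show ?case using phi_pow_inject a b less.prems by blast
qed

text \<open>Applying \<phi> to component \<open>m\<close> yields the terms of component
  \<open>m+1\<close> with index at most \<open>m\<close>. By the ghost congruence the remainder is
  \<open>p^(m+1) c m\<close>, and \<open>c m\<close> is \<open>\<phi>^(m+1)\<close> of the
  coefficient sought.\<close>

lemma s_sum_surj:
  assumes x: "x \<in> carrier (Wn p n A)"
  obtains a where "\<And>i. a i \<in> carrier A" "x = s_sum n a"
proof -
  let ?w = "\<lambda>m. witt_ghost p A m x"
  have xi: "x i \<in> carrier A" for i using x by (simp add: witt_ring_carrier)
  have "\<exists>c\<in>carrier A. ?w (Suc m) = \<phi> (?w m) \<oplus>\<^bsub>A\<^esub> [(p ^ Suc m)] \<cdot>\<^bsub>A\<^esub> c" for m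
    using A.witt_ghost_lift_Suc[of x m, OF xi] unfolding cong_mod_def .
  then obtain c where c: "\<And>m. c m \<in> carrier A"
    "\<And>m. ?w (Suc m) = \<phi> (?w m) \<oplus>\<^bsub>A\<^esub> [(p ^ Suc m)] \<cdot>\<^bsub>A\<^esub> c m" by metis
  have "\<exists>b\<in>carrier A. (\<phi> ^^ m) b = (case m of 0 \<Rightarrow> ?w 0 | Suc l \<Rightarrow> c l)" for m
    using c(1) A_cring.witt_ghost_closed[of x, OF xi] by (intro phi_pow_surj) (simp split: nat.split)
  then obtain a where a: "\<And>m. a m \<in> carrier A"
    "\<And>m. (\<phi> ^^ m) (a m) = (case m of 0 \<Rightarrow> ?w 0 | Suc l \<Rightarrow> c l)" by metis
  interpret \<phi>: ring_hom_cring A A \<phi>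
    using A.lift_hom by (simp add: ring_hom_cring_def ring_hom_cring_axioms_def A_cring.cring_axioms)
  have w: "?w m = (\<Oplus>\<^bsub>A\<^esub>i\<in>{..m}. [(p ^ i)] \<cdot>\<^bsub>A\<^esub> (\<phi> ^^ m) (a i))" for m
  proof (induction m)
    case 0
    then show ?case using a(2)[of 0] A_cring.witt_ghost_closed[of x, OF xi] by simp
  next
    case (Suc m)
    have "\<phi> (?w m) = (\<Oplus>\<^bsub>A\<^esub>i\<in>{..m}. [(p ^ i)] \<cdot>\<^bsub>A\<^esub> (\<phi> ^^ Suc m) (a i))"
      unfolding Suc using a(1)
      by (subst \<phi>.hom_finsum)
        (auto simp: phi_pow_closed o_def ring_hom_nat_mult[OF A_cring.cring_axioms A_cring.cring_axioms A.lift_hom])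
    then show ?case
      using a(1) a(2)[of "Suc m"] c phi_pow_closed[OF a(1), of "Suc m"]
      by (simp add: A_cring.a_comm phi_pow_closed A.lift_closed Pi_def del: power_Suc)
  qed
  have "x = s_sum n a"
    by (rule A.witt_eqI[of "{..<n}"]) (use x a(1) in \<open>simp_all add: s_sum_closed s_sum_ghost w\<close>)
  then show thesis using that a by blast
qed

text \<open>\<open>s_coeffs\<close> describes an extensional function, hence the restriction; that
  it is the only one is \<open>s_sum_inject\<close>.\<close>

lemma s_coeffs_s_sum:
  assumes a: "\<And>i. i < n \<Longrightarrow> a i \<in> carrier A"
  shows "s_coeffs p k n (s_sum n a) = restrict a {..<n}"
proof -
  interpret Wn: cring "Wn p n A" by (rule cring_Wn)
  have eq: "(\<Oplus>\<^bsub>Wn p n A\<^esub>i\<in>{..<n}. witt_res n A (s_phi p k (b i)) \<otimes>\<^bsub>Wn p n A\<^esub>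
      (witt_ver {..<n} A ^^ i) \<one>\<^bsub>Wn p n A\<^esub>) = s_sum n b" for b
    by (simp add: s_sum_def s_res_def V_one_def)
  have restr: "s_sum n (restrict a {..<n}) = s_sum n a"
    unfolding s_sum_def using a by (intro Wn.finsum_cong') (auto intro!: s_res_closed V_one_closed)
  show ?thesis
    unfolding s_coeffs_def eq
  proof (rule the_equality)
    fix b assume b: "b \<in> {..<n} \<rightarrow>\<^sub>E carrier A \<and> s_sum n a = s_sum n b"
    then show "b = restrict a {..<n}"
      using s_sum_inject[of n a b] a by (intro ext) (auto simp: PiE_def extensional_def Pi_def restrict_def)
  qed (use a in \<open>simp_all add: restr restrict_PiE_iff del: restrict_apply\<close>)
qed

lemma s_sum_single:
  assumes b: "b \<in> carrier A" and i: "i < n"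
  shows "s_sum n (\<lambda>j. if j = i then b else \<zero>\<^bsub>A\<^esub>) = s_res n b \<otimes>\<^bsub>Wn p n A\<^esub> V_one n i"
proof -
  interpret Wn: cring "Wn p n A" by (rule cring_Wn)
  interpret s: ring_hom_cring A "Wn p n A" "s_res n"
    using s_res_ring_hom by (simp add: ring_hom_cring_def ring_hom_cring_axioms_def A_cring.cring_axioms
        Wn.cring_axioms)
  have "s_sum n (\<lambda>j. if j = i then b else \<zero>\<^bsub>A\<^esub>) =
      (\<Oplus>\<^bsub>Wn p n A\<^esub>j\<in>{..<n}. if i = j then s_res n b \<otimes>\<^bsub>Wn p n A\<^esub> V_one n i else \<zero>\<^bsub>Wn p n A\<^esub>)"
    unfolding s_sum_def using b
    by (intro Wn.finsum_cong') (auto simp: s_res_closed V_one_closed)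
  also have "\<dots> = s_res n b \<otimes>\<^bsub>Wn p n A\<^esub> V_one n i"
    using Wn.finsum_singleton[of i "{..<n}" "\<lambda>_. s_res n b \<otimes>\<^bsub>Wn p n A\<^esub> V_one n i"] b i
    by (simp add: s_res_closed V_one_closed)
  finally show ?thesis .
qed

end

section \<open>Witt complexes\<close>

lemma abelian_group_hom_additive:
  assumes "abelian_group G" "abelian_group H" "\<And>x. x \<in> carrier G \<Longrightarrow> f x \<in> carrier H"
    "\<And>x y. x \<in> carrier G \<Longrightarrow> y \<in> carrier G \<Longrightarrow> f (x \<oplus>\<^bsub>G\<^esub> y) = f x \<oplus>\<^bsub>H\<^esub> f y"
  shows "abelian_group_hom G H f"
  using assms
  by (intro abelian_group_homI group_hom.intro group_hom_axioms.intro)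
    (auto simp: hom_def abelian_group.a_group)

lemma (in abelian_group_hom) hom_nat_mult:
  "x \<in> carrier G \<Longrightarrow> h ([(m::nat)] \<cdot>\<^bsub>G\<^esub> x) = [m] \<cdot>\<^bsub>H\<^esub> h x"
  by (induction m) simp_all

context witt_complex
begin

lemma diff_hom: "1 \<le> n \<Longrightarrow> abelian_group_hom (cmp E n i) (cmp E n (Suc i)) (diff E n i)"
  by (intro abelian_group_hom_additive grp) (simp_all add: diff_closed diff_add)

lemma res_hom: "1 \<le> n \<Longrightarrow> abelian_group_hom (cmp E (Suc n) i) (cmp E n i) (res E n i)"
  by (intro abelian_group_hom_additive grp) (simp_all add: res_closed res_add)

lemma frob_hom: "1 \<le> n \<Longrightarrow> abelian_group_hom (cmp E (Suc n) i) (cmp E n i) (frob E n i)"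
  by (intro abelian_group_hom_additive grp) (simp_all add: frob_closed frob_add)

lemma ver_hom: "1 \<le> n \<Longrightarrow> abelian_group_hom (cmp E n i) (cmp E (Suc n) i) (ver E n i)"
  by (intro abelian_group_hom_additive grp) (simp_all add: ver_closed ver_add)

lemma mul_left_hom:
  "1 \<le> n \<Longrightarrow> x \<in> carrier (cmp E n i) \<Longrightarrow>
    abelian_group_hom (cmp E n j) (cmp E n (i + j)) (mul E n i j x)"
  by (intro abelian_group_hom_additive grp) (simp_all add: mul_closed mul_add_right)

lemma mul_right_hom:
  "1 \<le> n \<Longrightarrow> y \<in> carrier (cmp E n j) \<Longrightarrow>
    abelian_group_hom (cmp E n i) (cmp E n (i + j)) (\<lambda>x. mul E n i j x y)"
  by (intro abelian_group_hom_additive grp) (simp_all add: mul_closed mul_add_left)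

lemma diff_unt:
  assumes n: "1 \<le> n" shows "diff E n 0 (unt E n) = \<zero>\<^bsub>cmp E n 1\<^esub>"
proof -
  interpret G: abelian_group "cmp E n 1" by (rule grp[OF n])
  have d: "diff E n 0 (unt E n) \<in> carrier (cmp E n 1)"
    using diff_closed[OF n unt_closed[OF n]] by simp
  have "diff E n 0 (unt E n) = diff E n 0 (unt E n) \<oplus>\<^bsub>cmp E n 1\<^esub> diff E n 0 (unt E n)"
    using diff_mul[OF n unt_closed[OF n] unt_closed[OF n]] d n
    by (simp add: mul_unt_left unt_closed mul_unt_right signed_def)
  then show ?thesis using d by (metis G.add.r_cancel_one')
qed

text \<open>\<open>dF(x) = FdVF(x) = Fd(x V(1))\<close>; in the Leibniz expansion
  \<open>FV(1) = p\<close> and \<open>FdV(1) = d(1) = 0\<close>.\<close>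

lemma frob_diff:
  assumes n: "1 \<le> n" and x: "x \<in> carrier (cmp E (Suc n) 0)"
  shows "diff E n 0 (frob E n 0 x) = [p] \<cdot>\<^bsub>cmp E n 1\<^esub> frob E n 1 (diff E (Suc n) 0 x)"
proof -
  interpret G: abelian_group "cmp E n 1" by (rule grp[OF n])
  let ?v = "ver E n 0 (unt E n)"
  have n': "1 \<le> Suc n" by simp
  note u = unt_closed[OF n]
  have v: "?v \<in> carrier (cmp E (Suc n) 0)" by (rule ver_closed[OF n u])
  have dx: "diff E (Suc n) 0 x \<in> carrier (cmp E (Suc n) 1)"
    and dv: "diff E (Suc n) 0 ?v \<in> carrier (cmp E (Suc n) 1)"
    using diff_closed[OF n' x] diff_closed[OF n' v] by simp_all
  have Fdx: "frob E n 1 (diff E (Suc n) 0 x) \<in> carrier (cmp E n 1)"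
    by (rule frob_closed[OF n dx])
  have Fx: "frob E n 0 x \<in> carrier (cmp E n 0)" by (rule frob_closed[OF n x])
  have "ver E n 0 (frob E n 0 x) = mul E (Suc n) 0 0 x ?v"
    using ver_mul_left[OF n x u] by (simp add: mul_unt_right[OF n Fx])
  then have "diff E n 0 (frob E n 0 x) = frob E n 1 (diff E (Suc n) 0 (mul E (Suc n) 0 0 x ?v))"
    using frob_diff_ver[OF n Fx] by simp
  also have "diff E (Suc n) 0 (mul E (Suc n) 0 0 x ?v) =
      mul E (Suc n) 1 0 (diff E (Suc n) 0 x) ?v \<oplus>\<^bsub>cmp E (Suc n) 1\<^esub> mul E (Suc n) 0 1 x (diff E (Suc n) 0 ?v)"
    using diff_mul[OF n' x v] by (simp add: signed_def)
  also have "frob E n 1 \<dots> =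
      mul E n 1 0 (frob E n 1 (diff E (Suc n) 0 x)) (frob E n 0 ?v) \<oplus>\<^bsub>cmp E n 1\<^esub>
      mul E n 0 1 (frob E n 0 x) (frob E n 1 (diff E (Suc n) 0 ?v))"
    using frob_add[OF n mul_closed'[OF n' dx v] mul_closed'[OF n' x dv], of 1]
      frob_mul[OF n dx v] frob_mul[OF n x dv] by simp
  also have "frob E n 1 (diff E (Suc n) 0 ?v) = \<zero>\<^bsub>cmp E n 1\<^esub>"
    using frob_diff_ver[OF n u] diff_unt[OF n] by simp
  also have "mul E n 0 1 (frob E n 0 x) \<zero>\<^bsub>cmp E n 1\<^esub> = \<zero>\<^bsub>cmp E n 1\<^esub>"
    using abelian_group_hom.hom_zero[OF mul_left_hom[OF n Fx, of 1]] by simp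
  also have "mul E n 1 0 (frob E n 1 (diff E (Suc n) 0 x)) (frob E n 0 ?v) =
      [p] \<cdot>\<^bsub>cmp E n 1\<^esub> frob E n 1 (diff E (Suc n) 0 x)"
    using abelian_group_hom.hom_nat_mult[OF mul_left_hom[OF n Fdx, of 0] u]
    by (simp add: frob_ver[OF n u] mul_unt_right[OF n Fdx] flip: One_nat_def)
  finally show ?thesis using Fdx by (simp flip: One_nat_def)
qed

text \<open>Since \<open>V(1) V(x) = V(FV(x)) = p V(x)\<close>, the form \<open>p dV(x)\<close>
  equals \<open>dV(1) V(x) + V(1) dV(x)\<close>. The first term is \<open>V(FdV(1) x) = 0\<close>,
  the second \<open>V(FdV(x)) = V(dx)\<close>.\<close>

lemma ver_diff:
  assumes n: "1 \<le> n" and x: "x \<in> carrier (cmp E n 0)"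
  shows "ver E n 1 (diff E n 0 x) = [p] \<cdot>\<^bsub>cmp E (Suc n) 1\<^esub> diff E (Suc n) 0 (ver E n 0 x)"
proof -
  interpret G: abelian_group "cmp E (Suc n) 1" by (rule grp) simp
  let ?v = "ver E n 0 (unt E n)" and ?y = "ver E n 0 x"
  have n': "1 \<le> Suc n" by simp
  note u = unt_closed[OF n]
  have v: "?v \<in> carrier (cmp E (Suc n) 0)" by (rule ver_closed[OF n u])
  have y: "?y \<in> carrier (cmp E (Suc n) 0)" by (rule ver_closed[OF n x])
  have dx: "diff E n 0 x \<in> carrier (cmp E n 1)"
    and dv: "diff E (Suc n) 0 ?v \<in> carrier (cmp E (Suc n) 1)"
    and dy: "diff E (Suc n) 0 ?y \<in> carrier (cmp E (Suc n) 1)"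
    using diff_closed[OF n x] diff_closed[OF n' v] diff_closed[OF n' y] by simp_all
  have Vdx: "ver E n 1 (diff E n 0 x) \<in> carrier (cmp E (Suc n) 1)" by (rule ver_closed[OF n dx])
  have px: "[p] \<cdot>\<^bsub>cmp E n 0\<^esub> x \<in> carrier (cmp E n 0)" by (rule add_pow_p_closed[OF n x])
  have "mul E (Suc n) 0 0 ?v ?y = [p] \<cdot>\<^bsub>cmp E (Suc n) 0\<^esub> ?y"
    using ver_mul_right[OF n u y] abelian_group_hom.hom_nat_mult[OF ver_hom[OF n] x]
    by (simp add: frob_ver[OF n x] mul_unt_left[OF n px])
  then have "[p] \<cdot>\<^bsub>cmp E (Suc n) 1\<^esub> diff E (Suc n) 0 ?y = diff E (Suc n) 0 (mul E (Suc n) 0 0 ?v ?y)"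
    using abelian_group_hom.hom_nat_mult[OF diff_hom[OF n'] y] by simp
  also have "\<dots> = mul E (Suc n) 1 0 (diff E (Suc n) 0 ?v) ?y \<oplus>\<^bsub>cmp E (Suc n) 1\<^esub>
      mul E (Suc n) 0 1 ?v (diff E (Suc n) 0 ?y)"
    using diff_mul[OF n' v y] by (simp add: signed_def)
  also have "mul E (Suc n) 1 0 (diff E (Suc n) 0 ?v) ?y =
      ver E n 1 (mul E n 1 0 (frob E n 1 (diff E (Suc n) 0 ?v)) x)"
    using ver_mul_left[OF n dv x] by simp
  also have "frob E n 1 (diff E (Suc n) 0 ?v) = \<zero>\<^bsub>cmp E n 1\<^esub>"
    using frob_diff_ver[OF n u] diff_unt[OF n] by simp
  also have "mul E n 1 0 \<zero>\<^bsub>cmp E n 1\<^esub> x = \<zero>\<^bsub>cmp E n 1\<^esub>"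
    using abelian_group_hom.hom_zero[OF mul_right_hom[OF n x, of 1]] by simp
  also have "ver E n 1 \<zero>\<^bsub>cmp E n 1\<^esub> = \<zero>\<^bsub>cmp E (Suc n) 1\<^esub>"
    by (rule abelian_group_hom.hom_zero[OF ver_hom[OF n]])
  also have "mul E (Suc n) 0 1 ?v (diff E (Suc n) 0 ?y) = ver E n 1 (diff E n 0 x)"
    using ver_mul_right[OF n u dy] frob_diff_ver[OF n x] by (simp add: mul_unt_left[OF n dx] flip: One_nat_def)
  finally show ?thesis using Vdx by (simp flip: One_nat_def)
qed

subsection \<open>Subcomplexes\<close>

text \<open>The operations stay those of \<open>E\<close> and only the carriers shrink, so the
  equations among the axioms are inherited and the work lies in closedness.\<close>

definition subcx :: "(nat \<Rightarrow> nat \<Rightarrow> 'e set) \<Rightarrow> ('r, 'e) witt_cx" where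
  "subcx C = E\<lparr>cmp := \<lambda>n d. (cmp E n d)\<lparr>carrier := C n d\<rparr>\<rparr>"

definition closed_family :: "(nat \<Rightarrow> nat \<Rightarrow> 'e set) \<Rightarrow> bool" where
  "closed_family C \<longleftrightarrow> (\<forall>n\<ge>1.
     (\<forall>d. C n d \<subseteq> carrier (cmp E n d) \<and> \<zero>\<^bsub>cmp E n d\<^esub> \<in> C n d \<and>
       (\<forall>x\<in>C n d. \<ominus>\<^bsub>cmp E n d\<^esub> x \<in> C n d \<and> (\<forall>y\<in>C n d. x \<oplus>\<^bsub>cmp E n d\<^esub> y \<in> C n d))) \<and>
     (\<forall>a\<in>carrier (Wn p n R). lam E n a \<in> C n 0) \<and>
     (\<forall>i j. \<forall>x\<in>C n i. \<forall>y\<in>C n j. mul E n i j x y \<in> C n (i + j)) \<and>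
     (\<forall>d. \<forall>x\<in>C n d. diff E n d x \<in> C n (Suc d) \<and> ver E n d x \<in> C (Suc n) d) \<and>
     (\<forall>d. \<forall>x\<in>C (Suc n) d. res E n d x \<in> C n d \<and> frob E n d x \<in> C n d))"

context
  fixes C :: "nat \<Rightarrow> nat \<Rightarrow> 'e set"
  assumes C: "closed_family C"
begin

private lemma C_closed:
  assumes "1 \<le> n"
  shows "x \<in> C n d \<Longrightarrow> x \<in> carrier (cmp E n d)" "\<zero>\<^bsub>cmp E n d\<^esub> \<in> C n d"
    "x \<in> C n d \<Longrightarrow> \<ominus>\<^bsub>cmp E n d\<^esub> x \<in> C n d"
    "x \<in> C n d \<Longrightarrow> y \<in> C n d \<Longrightarrow> x \<oplus>\<^bsub>cmp E n d\<^esub> y \<in> C n d"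
    "a \<in> carrier (Wn p n R) \<Longrightarrow> lam E n a \<in> C n 0"
    "x \<in> C n i \<Longrightarrow> z \<in> C n j \<Longrightarrow> mul E n i j x z \<in> C n (i + j)"
    "x \<in> C n d \<Longrightarrow> diff E n d x \<in> C n (Suc d)"
    "x \<in> C n d \<Longrightarrow> ver E n d x \<in> C (Suc n) d"
    "x \<in> C (Suc n) d \<Longrightarrow> res E n d x \<in> C n d"
    "x \<in> C (Suc n) d \<Longrightarrow> frob E n d x \<in> C n d"
  using C assms unfolding closed_family_def by blast+

private lemma subcx_simps:
  "cmp (subcx C) n d = (cmp E n d)\<lparr>carrier := C n d\<rparr>" "unt (subcx C) = unt E" "mul (subcx C) = mul E"
  "diff (subcx C) = diff E" "res (subcx C) = res E" "frob (subcx C) = frob E"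
  "ver (subcx C) = ver E" "lam (subcx C) = lam E"
  by (simp_all add: subcx_def)

private lemma unt_C: "1 \<le> n \<Longrightarrow> unt E n \<in> C n 0"
proof -
  assume n: "1 \<le> n"
  have "\<one>\<^bsub>Wn p n R\<^esub> \<in> carrier (Wn p n R)"
    using cring_R by (auto simp: witt_ring_def wtrunc_def teich_def cring.cring_simprules)
  then show ?thesis using C_closed(5)[OF n] lam_one[OF n] by metis
qed

private lemma subcx_group:
  assumes n: "1 \<le> n" shows "abelian_group (cmp (subcx C) n d)"
proof -
  interpret G: abelian_group "cmp E n d" by (rule grp[OF n])
  note c = C_closed[OF n]
  show ?thesis
    unfolding subcx_simps
  proof (rule abelian_groupI, goal_cases)
    case (6 x)
    then show ?case using c(1,3) G.l_neg by (intro bexI[of _ "\<ominus>\<^bsub>cmp E n d\<^esub> x"]) auto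
  qed (use c(1-4) in \<open>auto simp: G.a_ac\<close>)
qed

text \<open>The inverse is described relative to the carrier, so shrinking the carrier could change
  it; uniqueness of inverses shows that it does not.\<close>

private lemma subcx_neg:
  assumes n: "1 \<le> n" and x: "x \<in> C n d"
  shows "\<ominus>\<^bsub>(cmp E n d)\<lparr>carrier := C n d\<rparr>\<^esub> x = \<ominus>\<^bsub>cmp E n d\<^esub> x"
proof -
  interpret G: abelian_group "cmp E n d" by (rule grp[OF n])
  interpret H: abelian_group "(cmp E n d)\<lparr>carrier := C n d\<rparr>"
    using subcx_group[OF n, of d] by (simp add: subcx_simps)
  show ?thesis
    by (rule H.minus_equality) (use x C_closed(1,3)[OF n] in \<open>auto simp: G.l_neg\<close>)
qed

lemma witt_complex_subcx: "witt_complex p R (subcx C)"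
proof -
  have signed: "signed ((cmp E n d)\<lparr>carrier := C n d\<rparr>) m x = signed (cmp E n d) m x"
    if "1 \<le> n" "x \<in> C n d" for n d m x
    using subcx_neg[OF that] by (simp add: signed_def)
  have pow: "[m] \<cdot>\<^bsub>(cmp E n d)\<lparr>carrier := C n d\<rparr>\<^esub> x = [m] \<cdot>\<^bsub>cmp E n d\<^esub> x" for m :: nat and n d x
    by (simp add: add_pow_def nat_pow_def)
  have mulC: "mul E n i j x y \<in> C n l" if "1 \<le> n" "x \<in> C n i" "y \<in> C n j" "l = i + j" for n i j l x y
    using C_closed(6)[OF that(1-3)] that(4) by simp
  note c = C_closed
  show ?thesis
  proof (rule witt_complex.intro, goal_cases)
    case (4 n d)
    then show ?case by (rule subcx_group)
  next
    case (7 n x i y j z l)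
    then show ?case using mul_assoc[of n x i y j z l] by (simp add: subcx_simps c)
  next
    case (12 n x i y j)
    then show ?case
      using mul_comm[of n x i y j] by (simp add: subcx_simps c signed mulC add.commute)
  next
    case (15 n x i y j)
    then show ?case
      using diff_mul[of n x i y j] by (simp add: subcx_simps c signed mulC)
  next
    case (33 n r)
    then show ?case using frob_diff_teich[of n r] by (simp add: subcx_simps)
  qed (auto simp: subcx_simps c unt_C prime_p odd_p Zp_alg pow eqs)
qed

lemma subcx_inclusion: "witt_complex_hom p R (subcx C) E (\<lambda>n i x. x)"
  unfolding witt_complex_hom_def by (auto simp: subcx_simps C_closed hom_def)

end

text \<open>Composing the inclusion of a subcomplex with the morphism given by initiality
  yields the identity.\<close>

lemma closed_family_full:
  assumes E: "is_de_rham_witt p R E" and C: "closed_family C" and n: "1 \<le> n"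
  shows "carrier (cmp E n d) \<subseteq> C n d"
proof
  fix x assume x: "x \<in> carrier (cmp E n d)"
  obtain h where h: "witt_complex_hom p R E (subcx C) h"
    using E witt_complex_subcx[OF C] unfolding is_de_rham_witt_def unique_witt_complex_hom_def by blast
  obtain e where e: "\<And>g. witt_complex_hom p R E E g \<Longrightarrow> g n d x = e n d x"
    using E n x unfolding is_de_rham_witt_def unique_witt_complex_hom_def by metis
  have "h n d x = x"
    using e[OF witt_complex_hom_comp[OF h subcx_inclusion[OF C]]] e[OF witt_complex_hom_id] by simp
  then show "x \<in> C n d"
    using witt_complex_hom_closed[OF h n x] by (simp add: subcx_def)
qed

end

subsection \<open>Forms over the Witt vectors of a perfect ring\<close>

lemma (in monoid) nat_pow_1: "x \<in> carrier G \<Longrightarrow> x [^] (1::nat) = x"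
  by simp

lemma (in abelian_group) nat_mult_1: "x \<in> carrier G \<Longrightarrow> [(1::nat)] \<cdot> x = x"
  by simp

locale witt_complex_over_W = witt_perfect p k + E: witt_complex p "W p k" E
  for p :: nat and k :: "('k, 'm) ring_scheme" and E :: "(nat \<Rightarrow> 'k, 'e) witt_cx"
begin

declare One_nat_def [simp del] One_nat_def [symmetric, simp]

section \<open>The forms \<open>dV^i(1)\<close> and their relations\<close>

definition dV :: "nat \<Rightarrow> nat \<Rightarrow> 'e" where
  "dV n i = diff E n 0 (lam E n (V_one n i))"

lemma V_one_0: "V_one n 0 = \<one>\<^bsub>Wn p n A\<^esub>"
  by (simp add: V_one_def)

lemma V_one_eq_zero: "n \<le> i \<Longrightarrow> V_one n i = \<zero>\<^bsub>Wn p n A\<^esub>"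
  unfolding V_one_eq witt_ring_def[where R = A] by auto

lemma V_one_Suc: "witt_ver {..<Suc n} A (V_one n i) = V_one (Suc n) (Suc i)"
  by (auto simp: V_one_eq witt_ver_def wtrunc_def split: nat.split)

lemma s_res_frob:
  assumes a: "a \<in> carrier A"
  shows "witt_frob p {..<n} A (s_res (Suc n) a) = s_res n (\<phi> a)"
proof (rule A.witt_eqI[OF down_closed_lessThan])
  have s: "s_res (Suc n) a i \<in> carrier A" for i
    using s_res_closed[OF a] by (simp add: witt_ring_carrier[where R = A])
  show "witt_frob p {..<n} A (s_res (Suc n) a) \<in> carrier (Wn p n A)"
    by (rule A.witt_frob_closed[OF s])
  show "witt_ghost p A m (witt_frob p {..<n} A (s_res (Suc n) a)) = witt_ghost p A m (s_res n (\<phi> a))"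
    if "m \<in> {..<n}" for m
    using A.witt_ghost_frob[of "{..<n}" m "s_res (Suc n) a", OF _ _ s] that a
    by (simp add: s_res_ghost A.lift_closed funpow_swap1)
qed (use a in \<open>simp add: s_res_closed A.lift_closed\<close>)

lemma lam_hom: "1 \<le> n \<Longrightarrow> abelian_group_hom (Wn p n A) (cmp E n 0) (lam E n)"
  using cring.axioms(1)[OF cring_Wn] ring.is_abelian_group
  by (intro abelian_group_hom_additive E.grp) (auto simp: E.lam_closed E.lam_add)

lemma lam_V_one_closed: "1 \<le> n \<Longrightarrow> lam E n (V_one n i) \<in> carrier (cmp E n 0)"
  by (rule E.lam_closed[OF _ V_one_closed])

lemma dV_closed: "1 \<le> n \<Longrightarrow> dV n i \<in> carrier (cmp E n 1)"
  using E.diff_closed[OF _ lam_V_one_closed] by (simp add: dV_def)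

lemma lam_s_res_closed: "1 \<le> n \<Longrightarrow> a \<in> carrier A \<Longrightarrow> lam E n (s_res n a) \<in> carrier (cmp E n 0)"
  by (rule E.lam_closed[OF _ s_res_closed])

lemma ver_lam_V_one: "1 \<le> n \<Longrightarrow> ver E n 0 (lam E n (V_one n i)) = lam E (Suc n) (V_one (Suc n) (Suc i))"
  by (simp add: E.ver_lam V_one_closed V_one_Suc)

lemma dV_0: "1 \<le> n \<Longrightarrow> dV n 0 = \<zero>\<^bsub>cmp E n 1\<^esub>"
  by (simp add: dV_def V_one_0 E.lam_one E.diff_unt)

lemma dV_ge: "1 \<le> n \<Longrightarrow> n \<le> i \<Longrightarrow> dV n i = \<zero>\<^bsub>cmp E n 1\<^esub>"
  using abelian_group_hom.hom_zero[OF lam_hom, of n] abelian_group_hom.hom_zero[OF E.diff_hom, of n 0]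
  by (simp add: dV_def V_one_eq_zero)

lemma ver_dV: "1 \<le> n \<Longrightarrow> ver E n 1 (dV n i) = [p] \<cdot>\<^bsub>cmp E (Suc n) 1\<^esub> dV (Suc n) (Suc i)"
  unfolding dV_def by (subst E.ver_diff) (simp_all add: lam_V_one_closed ver_lam_V_one)

lemma p_power_dV: "1 \<le> n \<Longrightarrow> [(p ^ i)] \<cdot>\<^bsub>cmp E n 1\<^esub> dV n i = \<zero>\<^bsub>cmp E n 1\<^esub>"
proof (induction i arbitrary: n)
  case 0
  interpret G: abelian_group "cmp E n 1" by (rule E.grp[OF 0])
  show ?case using 0 by (simp add: dV_0)
next
  case (Suc i)
  interpret G: abelian_group "cmp E n 1" by (rule E.grp[OF Suc.prems])
  show ?case
  \<comment> \<open>The induction passes from level \<open>n\<close> to level \<open>n - 1\<close>,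
    which for \<open>n = 1\<close> would leave the meaningful range; there
    \<open>dV n (Suc i)\<close> is zero because \<open>Suc i \<ge> n\<close>.\<close>
  proof (cases "n = 1")
    case True
    have "dV n (Suc i) = \<zero>\<^bsub>cmp E n 1\<^esub>"
      by (rule dV_ge) (use True in simp_all)
    then show ?thesis by simp
  next
    case False
    then obtain m where m: "n = Suc m" "1 \<le> m" using Suc.prems by (cases n) auto
    have "[(p ^ Suc i)] \<cdot>\<^bsub>cmp E n 1\<^esub> dV n (Suc i) = [(p ^ i)] \<cdot>\<^bsub>cmp E n 1\<^esub> ([p] \<cdot>\<^bsub>cmp E n 1\<^esub> dV n (Suc i))"
      using G.add.nat_pow_pow[OF dV_closed[OF Suc.prems]] by simp
    also have "\<dots> = ver E m 1 ([(p ^ i)] \<cdot>\<^bsub>cmp E m 1\<^esub> dV m i)"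
      using abelian_group_hom.hom_nat_mult[OF E.ver_hom[OF m(2)] dV_closed[OF m(2)]] ver_dV[OF m(2)] m(1)
      by simp
    also have "\<dots> = \<zero>\<^bsub>cmp E n 1\<^esub>"
      using Suc.IH[OF m(2)] abelian_group_hom.hom_zero[OF E.ver_hom[OF m(2)]] m(1) by simp
    finally show ?thesis .
  qed
qed

text \<open>\<open>V^(j+1)(1) dV^(l+1)(1) = V(V^j(1) FdV^(l+1)(1)) = V(V^j(1) dV^l(1))\<close>, and
  \<open>V(dV^l(1)) = p dV^(l+1)(1)\<close> provides the factor \<open>p\<close> gained in each
  step.\<close>

lemma V_one_mul_dV:
  "1 \<le> n \<Longrightarrow> mul E n 0 1 (lam E n (V_one n j)) (dV n i) = [(p ^ j)] \<cdot>\<^bsub>cmp E n 1\<^esub> dV n i"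
proof (induction j arbitrary: n i)
  case 0
  interpret G: abelian_group "cmp E n 1" by (rule E.grp[OF 0])
  show ?case using 0 dV_closed[OF 0, of i] by (simp add: V_one_0 E.lam_one E.mul_unt_left G.nat_mult_1)
next
  case (Suc j)
  interpret G: abelian_group "cmp E n 1" by (rule E.grp[OF Suc.prems])
  show ?case
  proof (cases "n = 1 \<or> i = 0")
    case True
    then have "dV n i = \<zero>\<^bsub>cmp E n 1\<^esub>"
      using dV_0[OF Suc.prems] dV_ge[OF Suc.prems, of i] by (cases i) auto
    then show ?thesis
      using abelian_group_hom.hom_zero[OF E.mul_left_hom[OF Suc.prems lam_V_one_closed[OF Suc.prems]], of 1]
      by simp
  next
    case False
    then obtain m l where m: "n = Suc m" "1 \<le> m" "i = Suc l" using Suc.prems by (cases n; cases i) auto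
    note c = dV_closed[OF m(2)] lam_V_one_closed[OF m(2)] dV_closed[OF Suc.prems, of i]
    have "frob E m 1 (dV n i) = dV m l"
      using E.frob_diff_ver[OF m(2) c(2)[of l]] m by (simp add: dV_def ver_lam_V_one)
    then have "mul E n 0 1 (lam E n (V_one n (Suc j))) (dV n i) =
        ver E m 1 (mul E m 0 1 (lam E m (V_one m j)) (dV m l))"
      using E.ver_mul_right[OF m(2) c(2)[of j], of "dV n i" 1] c(3) m by (simp add: ver_lam_V_one)
    also have "\<dots> = [(p ^ j)] \<cdot>\<^bsub>cmp E n 1\<^esub> ([p] \<cdot>\<^bsub>cmp E n 1\<^esub> dV n i)"
      using abelian_group_hom.hom_nat_mult[OF E.ver_hom[OF m(2)] c(1)] ver_dV[OF m(2)] m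
      by (simp add: Suc.IH[OF m(2)])
    also have "\<dots> = [(p ^ Suc j)] \<cdot>\<^bsub>cmp E n 1\<^esub> dV n i"
      using G.add.nat_pow_pow[OF c(3)] by simp
    finally show ?thesis .
  qed
qed

text \<open>Since \<open>\<phi>\<close> is surjective and \<open>F s\<^sub>\<phi> = s\<^sub>\<phi> \<phi>\<close>, the relation \<open>dF = pFd\<close> can be iterated.\<close>

lemma diff_s_res_divisible:
  assumes "1 \<le> n" "a \<in> carrier A"
  shows "\<exists>\<nu>\<in>carrier (cmp E n 1). diff E n 0 (lam E n (s_res n a)) = [(p ^ m)] \<cdot>\<^bsub>cmp E n 1\<^esub> \<nu>"
  using assms
proof (induction m arbitrary: n a)
  case 0
  interpret G: abelian_group "cmp E n 1" by (rule E.grp[OF 0(1)])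
  show ?case
    using 0 E.diff_closed[OF _ lam_s_res_closed, of n a] by (intro bexI) (auto simp: G.nat_mult_1)
next
  case (Suc m)
  interpret G: abelian_group "cmp E n 1" by (rule E.grp[OF Suc.prems(1)])
  note n = Suc.prems(1)
  obtain b where b: "b \<in> carrier A" "\<phi> b = a" using phi_surj[OF Suc.prems(2)] by blast
  obtain \<nu> where \<nu>: "\<nu> \<in> carrier (cmp E (Suc n) 1)"
    "diff E (Suc n) 0 (lam E (Suc n) (s_res (Suc n) b)) = [(p ^ m)] \<cdot>\<^bsub>cmp E (Suc n) 1\<^esub> \<nu>"
    using Suc.IH[of "Suc n" b] b by auto
  have l: "lam E (Suc n) (s_res (Suc n) b) \<in> carrier (cmp E (Suc n) 0)"
    using lam_s_res_closed b by simp
  have "diff E n 0 (lam E n (s_res n a)) = diff E n 0 (frob E n 0 (lam E (Suc n) (s_res (Suc n) b)))"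
    using E.frob_lam[OF n s_res_closed[OF b(1)]] s_res_frob[OF b(1), of n] b(2) by simp
  also have "\<dots> = [p] \<cdot>\<^bsub>cmp E n 1\<^esub> frob E n 1 ([(p ^ m)] \<cdot>\<^bsub>cmp E (Suc n) 1\<^esub> \<nu>)"
    using E.frob_diff[OF n l] \<nu>(2) by simp
  also have "\<dots> = [p] \<cdot>\<^bsub>cmp E n 1\<^esub> ([(p ^ m)] \<cdot>\<^bsub>cmp E n 1\<^esub> frob E n 1 \<nu>)"
    using abelian_group_hom.hom_nat_mult[OF E.frob_hom[OF n] \<nu>(1)] by simp
  also have "\<dots> = [(p ^ Suc m)] \<cdot>\<^bsub>cmp E n 1\<^esub> frob E n 1 \<nu>"
    using G.add.nat_pow_pow[OF E.frob_closed[OF n \<nu>(1)]] by (simp add: mult.commute)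
  finally show ?case using E.frob_closed[OF n \<nu>(1)] by blast
qed

subsection \<open>Generation in degree one\<close>

text \<open>The additive span of the forms \<open>x dy\<close>, given inductively so that additive
  maps need only be examined on generators, as in \<open>forms_image\<close>.\<close>

inductive_set forms :: "nat \<Rightarrow> 'e set" for n where
  zero: "\<zero>\<^bsub>cmp E n 1\<^esub> \<in> forms n"
| gen: "x \<in> carrier (Wn p n A) \<Longrightarrow> y \<in> carrier (Wn p n A) \<Longrightarrow>
    mul E n 0 1 (lam E n x) (diff E n 0 (lam E n y)) \<in> forms n"
| neg: "\<omega> \<in> forms n \<Longrightarrow> \<ominus>\<^bsub>cmp E n 1\<^esub> \<omega> \<in> forms n"
| add: "\<omega> \<in> forms n \<Longrightarrow> \<nu> \<in> forms n \<Longrightarrow> \<omega> \<oplus>\<^bsub>cmp E n 1\<^esub> \<nu> \<in> forms n"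

lemma diff_lam_closed:
  "1 \<le> n \<Longrightarrow> x \<in> carrier (Wn p n A) \<Longrightarrow> diff E n 0 (lam E n x) \<in> carrier (cmp E n 1)"
  using E.diff_closed[OF _ E.lam_closed, of n x] by simp

lemma forms_closed:
  assumes n: "1 \<le> n" and \<omega>: "\<omega> \<in> forms n" shows "\<omega> \<in> carrier (cmp E n 1)"
  using \<omega>
proof (induction rule: forms.induct)
  case (gen x y)
  then show ?case
    using E.mul_closed[OF n E.lam_closed[OF n gen(1)] diff_lam_closed[OF n gen(2)]] by simp
qed (simp_all add: E.zero_closed[OF n] E.neg_closed[OF n] E.add_closed[OF n])

lemma forms_image:
  assumes f: "abelian_group_hom (cmp E n 1) (cmp E m 1) f" and n: "1 \<le> n"
    and gen: "\<And>x y. x \<in> carrier (Wn p n A) \<Longrightarrow> y \<in> carrier (Wn p n A) \<Longrightarrow>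
      f (mul E n 0 1 (lam E n x) (diff E n 0 (lam E n y))) \<in> forms m"
    and \<omega>: "\<omega> \<in> forms n"
  shows "f \<omega> \<in> forms m"
proof -
  interpret f: abelian_group_hom "cmp E n 1" "cmp E m 1" f by (rule f)
  show ?thesis using \<omega>
    by (induction rule: forms.induct) (simp_all add: forms.intros gen forms_closed[OF n])
qed

lemma lam_mul_forms:
  assumes n: "1 \<le> n" and z: "z \<in> carrier (Wn p n A)" and \<omega>: "\<omega> \<in> forms n"
  shows "mul E n 0 1 (lam E n z) \<omega> \<in> forms n"
proof -
  interpret Wn: cring "Wn p n A" by (rule cring_Wn)
  note l = E.lam_closed[OF n]
  show ?thesis
  proof (rule forms_image[OF _ n _ \<omega>])
    show "abelian_group_hom (cmp E n 1) (cmp E n 1) (mul E n 0 1 (lam E n z))"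
      using E.mul_left_hom[OF n l[OF z], of 1] by simp
    fix x y assume xy: "x \<in> carrier (Wn p n A)" "y \<in> carrier (Wn p n A)"
    have "mul E n 0 1 (lam E n z) (mul E n 0 1 (lam E n x) (diff E n 0 (lam E n y))) =
        mul E n 0 1 (lam E n (z \<otimes>\<^bsub>Wn p n A\<^esub> x)) (diff E n 0 (lam E n y))"
      using E.mul_assoc[OF n l[OF z] l[OF xy(1)] diff_lam_closed[OF n xy(2)]] E.lam_mul[OF n z xy(1)]
      by simp
    then show "mul E n 0 1 (lam E n z) (mul E n 0 1 (lam E n x) (diff E n 0 (lam E n y))) \<in> forms n"
      using forms.gen z xy by simp
  qed
qed

lemma diff_lam_forms:
  assumes n: "1 \<le> n" and x: "x \<in> carrier (Wn p n A)"
  shows "diff E n 0 (lam E n x) \<in> forms n"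
  using forms.gen[OF cring.cring_simprules(6)[OF cring_Wn] x] E.lam_one[OF n]
    E.mul_unt_left[OF n diff_lam_closed[OF n x]] by simp

text \<open>Prepares the computation of \<open>Fdy\<close>: the axioms give it on Teichmueller lifts
  and on images of \<open>V\<close>.\<close>

lemma teich_ver_decompose:
  assumes n: "1 \<le> n" and y: "y \<in> carrier (Wn p (Suc n) A)"
  defines "z \<equiv> \<lambda>i. y (Suc i)"
  shows "z \<in> carrier (Wn p n A)"
    and "y = teich A (y 0) \<oplus>\<^bsub>Wn p (Suc n) A\<^esub> witt_ver {..<Suc n} A z"
proof -
  have yc: "y i \<in> carrier A" for i using y by (simp add: witt_ring_carrier[where R = A])
  show z: "z \<in> carrier (Wn p n A)"
    using y by (simp add: witt_ring_carrier[where R = A] z_def)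
  have zc: "z i \<in> carrier A" for i using yc by (simp add: z_def)
  have t: "teich A (y 0) \<in> carrier (Wn p (Suc n) A)"
    by (rule teich_closed[OF A_cring.cring_axioms yc]) simp
  have v: "witt_ver {..<Suc n} A z \<in> carrier (Wn p (Suc n) A)"
    by (rule A.witt_ver_closed[OF zc])
  show "y = teich A (y 0) \<oplus>\<^bsub>Wn p (Suc n) A\<^esub> witt_ver {..<Suc n} A z"
  proof (rule A.witt_eqI[OF down_closed_lessThan y A.witt_ring_add_closed[OF t v]])
    fix m assume m: "m \<in> {..<Suc n}"
    have "witt_ghost p A m (teich A (y 0) \<oplus>\<^bsub>Wn p (Suc n) A\<^esub> witt_ver {..<Suc n} A z) =
        y 0 [^]\<^bsub>A\<^esub> (p ^ m) \<oplus>\<^bsub>A\<^esub> (case m of 0 \<Rightarrow> \<zero>\<^bsub>A\<^esub> | Suc l \<Rightarrow> [p] \<cdot>\<^bsub>A\<^esub> witt_ghost p A l z)"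
      using A.witt_ghost_add[OF down_closed_lessThan m t v] A.witt_ghost_teich[OF down_closed_lessThan m yc]
        A.witt_ghost_ver[of z, OF zc down_closed_lessThan m] by simp
    also have "\<dots> = witt_ghost p A m y"
      using A.witt_ghost_decompose[of y, OF yc] A_cring.witt_ghost_0[of y p, OF yc] yc
      by (cases m) (simp_all add: z_def A_cring.nat_pow_1)
    finally show "witt_ghost p A m y =
        witt_ghost p A m (teich A (y 0) \<oplus>\<^bsub>Wn p (Suc n) A\<^esub> witt_ver {..<Suc n} A z)" ..
  qed
qed

text \<open>With \<open>y = [y_0] + V(z)\<close> the form \<open>Fdy\<close> is
  \<open>[y_0]^(p-1) d[y_0] + dz\<close>.\<close>

lemma frob_diff_lam_forms:
  assumes n: "1 \<le> n" and y: "y \<in> carrier (Wn p (Suc n) A)"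
  shows "frob E n 1 (diff E (Suc n) 0 (lam E (Suc n) y)) \<in> forms n"
proof -
  define z where "z = (\<lambda>i. y (Suc i))"
  note dec = teich_ver_decompose[OF n y, folded z_def]
  have n': "1 \<le> Suc n" by simp
  have yc: "y 0 \<in> carrier A" using y by (simp add: witt_ring_carrier[where R = A])
  have t: "teich A (y 0) \<in> carrier (Wn p (Suc n) A)" "teich A (y 0) \<in> carrier (Wn p n A)"
    by (rule teich_closed[OF A_cring.cring_axioms yc]; use n in simp)+
  have v: "witt_ver {..<Suc n} A z \<in> carrier (Wn p (Suc n) A)"
    using dec(1) by (intro A.witt_ver_closed) (simp add: witt_ring_carrier[where R = A])
  note lt = E.lam_closed[OF n' t(1)] and lv = E.lam_closed[OF n' v]
  have "frob E n 1 (diff E (Suc n) 0 (lam E (Suc n) y)) =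
      frob E n 1 (diff E (Suc n) 0 (lam E (Suc n) (teich A (y 0)))) \<oplus>\<^bsub>cmp E n 1\<^esub>
      frob E n 1 (diff E (Suc n) 0 (lam E (Suc n) (witt_ver {..<Suc n} A z)))"
    by (subst dec(2), subst E.lam_add[OF n' t(1) v], subst E.diff_add[OF n' lt lv])
      (use E.frob_add[OF n diff_lam_closed[OF n' t(1)] diff_lam_closed[OF n' v]] in simp)
  also have "frob E n 1 (diff E (Suc n) 0 (lam E (Suc n) (witt_ver {..<Suc n} A z))) =
      diff E n 0 (lam E n z)"
    using E.frob_diff_ver[OF n E.lam_closed[OF n dec(1)]] E.ver_lam[OF n dec(1)] by simp
  also have "frob E n 1 (diff E (Suc n) 0 (lam E (Suc n) (teich A (y 0)))) =
      mul E n 0 1 (lam E n (teich A (y 0) [^]\<^bsub>Wn p n A\<^esub> (p - 1))) (diff E n 0 (lam E n (teich A (y 0))))"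
    by (rule E.frob_diff_teich[OF n yc])
  finally show ?thesis
    using forms.add[OF forms.gen[OF teich_pow_closed[OF A_cring.cring_axioms yc n] t(2)]
        diff_lam_forms[OF n dec(1)]] by simp
qed

text \<open>From degree 2 on nothing is discarded, so closure is immediate there and only degrees 0
  and 1 call for an argument.\<close>

definition generated :: "nat \<Rightarrow> nat \<Rightarrow> 'e set" where
  "generated n d = (if d = 0 then lam E n ` carrier (Wn p n A) else if d = 1 then forms n
     else carrier (cmp E n d))"

lemma generated_closed: "1 \<le> n \<Longrightarrow> x \<in> generated n d \<Longrightarrow> x \<in> carrier (cmp E n d)"
  by (auto simp: generated_def E.lam_closed forms_closed split: if_splits)

lemma lam_generated: "x \<in> carrier (Wn p n A) \<Longrightarrow> lam E n x \<in> generated n 0"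
  by (simp add: generated_def)

lemma generated_group:
  assumes n: "1 \<le> n"
  shows "\<zero>\<^bsub>cmp E n d\<^esub> \<in> generated n d"
    and "x \<in> generated n d \<Longrightarrow> \<ominus>\<^bsub>cmp E n d\<^esub> x \<in> generated n d"
    and "x \<in> generated n d \<Longrightarrow> y \<in> generated n d \<Longrightarrow> x \<oplus>\<^bsub>cmp E n d\<^esub> y \<in> generated n d"
proof -
  interpret Wn: cring "Wn p n A" by (rule cring_Wn)
  interpret l: abelian_group_hom "Wn p n A" "cmp E n 0" "lam E n" by (rule lam_hom[OF n])
  show "\<zero>\<^bsub>cmp E n d\<^esub> \<in> generated n d"
    using n forms.zero imageI[OF Wn.zero_closed, of "lam E n"]
    by (simp add: generated_def E.zero_closed)
  show "\<ominus>\<^bsub>cmp E n d\<^esub> x \<in> generated n d" if "x \<in> generated n d"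
    using that n by (auto simp: generated_def E.neg_closed forms.neg simp flip: l.hom_a_inv)
  show "x \<oplus>\<^bsub>cmp E n d\<^esub> y \<in> generated n d" if "x \<in> generated n d" "y \<in> generated n d"
    using that n by (auto simp: generated_def E.add_closed forms.add simp flip: l.hom_add)
qed

lemma generated_mul:
  assumes n: "1 \<le> n" and x: "x \<in> generated n i" and y: "y \<in> generated n j"
  shows "mul E n i j x y \<in> generated n (i + j)"
proof -
  interpret Wn: cring "Wn p n A" by (rule cring_Wn)
  consider "i = 0" "j = 0" | "i = 0" "j = 1" | "i = 1" "j = 0" | "2 \<le> i + j"
    by linarith
  then show ?thesis
  proof cases
    case 1
    then show ?thesis using x y n by (auto simp: generated_def simp flip: E.lam_mul)
  next
    case 2
    then show ?thesis using x y lam_mul_forms[OF n] by (auto simp: generated_def)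
  next
    case 3
    have "mul E n 1 0 x y = mul E n 0 1 y x"
      using E.mul_comm[OF n generated_closed[OF n x] generated_closed[OF n y]] 3
      by (simp add: signed_def)
    then show ?thesis using 3 x y lam_mul_forms[OF n] by (auto simp: generated_def)
  next
    case 4
    then show ?thesis
      using E.mul_closed[OF n generated_closed[OF n x] generated_closed[OF n y]]
      by (auto simp: generated_def)
  qed
qed

lemma res_forms:
  assumes n: "1 \<le> n" and \<omega>: "\<omega> \<in> forms (Suc n)" shows "res E n 1 \<omega> \<in> forms n"
proof (rule forms_image[OF E.res_hom[OF n] _ _ \<omega>])
  fix x y assume xy: "x \<in> carrier (Wn p (Suc n) A)" "y \<in> carrier (Wn p (Suc n) A)"
  have n': "1 \<le> Suc n" by simp
  note l = E.lam_closed[OF n']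
  have r: "witt_res n A x \<in> carrier (Wn p n A)" if "x \<in> carrier (Wn p (Suc n) A)" for x
    using that by (intro A.wtrunc_closed) (simp add: witt_ring_carrier[where R = A])
  have "res E n 1 (mul E (Suc n) 0 1 (lam E (Suc n) x) (diff E (Suc n) 0 (lam E (Suc n) y))) =
      mul E n 0 1 (lam E n (witt_res n A x)) (diff E n 0 (lam E n (witt_res n A y)))"
    using E.res_mul[OF n l[OF xy(1)] diff_lam_closed[OF n' xy(2)]] E.res_diff[OF n l[OF xy(2)]]
      E.lam_res[OF n xy(1)] E.lam_res[OF n xy(2)] by simp
  then show "res E n 1 (mul E (Suc n) 0 1 (lam E (Suc n) x) (diff E (Suc n) 0 (lam E (Suc n) y)))
      \<in> forms n"
    using forms.gen[OF r[OF xy(1)] r[OF xy(2)]] by simp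
qed simp

lemma frob_forms:
  assumes n: "1 \<le> n" and \<omega>: "\<omega> \<in> forms (Suc n)" shows "frob E n 1 \<omega> \<in> forms n"
proof (rule forms_image[OF E.frob_hom[OF n] _ _ \<omega>])
  fix x y assume xy: "x \<in> carrier (Wn p (Suc n) A)" "y \<in> carrier (Wn p (Suc n) A)"
  have n': "1 \<le> Suc n" by simp
  have F: "witt_frob p {..<n} A x \<in> carrier (Wn p n A)"
    using xy by (intro A.witt_frob_closed) (simp add: witt_ring_carrier[where R = A])
  have "frob E n 1 (mul E (Suc n) 0 1 (lam E (Suc n) x) (diff E (Suc n) 0 (lam E (Suc n) y))) =
      mul E n 0 1 (lam E n (witt_frob p {..<n} A x)) (frob E n 1 (diff E (Suc n) 0 (lam E (Suc n) y)))"
    using E.frob_mul[OF n E.lam_closed[OF n' xy(1)] diff_lam_closed[OF n' xy(2)]] E.frob_lam[OF n xy(1)]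
    by simp
  then show "frob E n 1 (mul E (Suc n) 0 1 (lam E (Suc n) x) (diff E (Suc n) 0 (lam E (Suc n) y)))
      \<in> forms n"
    using lam_mul_forms[OF n F frob_diff_lam_forms[OF n xy(2)]] by simp
qed simp

text \<open>Rewriting \<open>dy\<close> as \<open>FdV(y)\<close> gives
  \<open>V(x dy) = V(x F(dV(y))) = V(x) dV(y)\<close>.\<close>

lemma ver_forms:
  assumes n: "1 \<le> n" and \<omega>: "\<omega> \<in> forms n" shows "ver E n 1 \<omega> \<in> forms (Suc n)"
proof (rule forms_image[OF E.ver_hom[OF n] n _ \<omega>])
  fix x y assume xy: "x \<in> carrier (Wn p n A)" "y \<in> carrier (Wn p n A)"
  have n': "1 \<le> Suc n" by simp
  have V: "witt_ver {..<Suc n} A x \<in> carrier (Wn p (Suc n) A)" if "x \<in> carrier (Wn p n A)" for x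
    using that by (intro A.witt_ver_closed) (simp add: witt_ring_carrier[where R = A])
  have "diff E n 0 (lam E n y) = frob E n 1 (diff E (Suc n) 0 (lam E (Suc n) (witt_ver {..<Suc n} A y)))"
    using E.frob_diff_ver[OF n E.lam_closed[OF n xy(2)]] E.ver_lam[OF n xy(2)] by simp
  then have "ver E n 1 (mul E n 0 1 (lam E n x) (diff E n 0 (lam E n y))) =
      mul E (Suc n) 0 1 (lam E (Suc n) (witt_ver {..<Suc n} A x))
        (diff E (Suc n) 0 (lam E (Suc n) (witt_ver {..<Suc n} A y)))"
    using E.ver_mul_right[OF n E.lam_closed[OF n xy(1)] diff_lam_closed[OF n' V[OF xy(2)]]]
      E.ver_lam[OF n xy(1)] by simp
  then show "ver E n 1 (mul E n 0 1 (lam E n x) (diff E n 0 (lam E n y))) \<in> forms (Suc n)"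
    using forms.gen[OF V[OF xy(1)] V[OF xy(2)]] by simp
qed

lemma closed_family_generated: "E.closed_family generated"
  unfolding E.closed_family_def
proof (intro allI impI conjI subsetI ballI)
  fix n d x assume n: "(1::nat) \<le> n" and x: "x \<in> generated n d"
  show "diff E n d x \<in> generated n (Suc d)"
    using x n E.diff_closed[OF n generated_closed[OF n x]]
    by (auto simp: generated_def diff_lam_forms split: if_splits)
  have "witt_ver {..<Suc n} A a \<in> carrier (Wn p (Suc n) A)" if "a \<in> carrier (Wn p n A)" for a
    using that by (intro A.witt_ver_closed) (simp add: witt_ring_carrier[where R = A])
  then show "ver E n d x \<in> generated (Suc n) d"
    using x n E.ver_closed[OF n generated_closed[OF n x]]
    by (auto simp: generated_def E.ver_lam ver_forms split: if_splits)
next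
  fix n d x assume n: "(1::nat) \<le> n" and x: "x \<in> generated (Suc n) d"
  have "witt_res n A a \<in> carrier (Wn p n A)" "witt_frob p {..<n} A a \<in> carrier (Wn p n A)"
    if "a \<in> carrier (Wn p (Suc n) A)" for a
    by (intro A.wtrunc_closed A.witt_frob_closed, use that in \<open>simp add: witt_ring_carrier[where R = A]\<close>)+
  then show "res E n d x \<in> generated n d" "frob E n d x \<in> generated n d"
    using x n E.res_closed[OF n generated_closed[OF _ x]] E.frob_closed[OF n generated_closed[OF _ x]]
    by (auto simp: generated_def E.lam_res E.frob_lam res_forms frob_forms
        split: if_splits)
qed (auto intro: generated_closed generated_group generated_mul lam_generated)

lemma forms_eq_carrier:
  "is_de_rham_witt p A E \<Longrightarrow> 1 \<le> n \<Longrightarrow> forms n = carrier (cmp E n 1)"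
  using E.closed_family_full[OF _ closed_family_generated, of n 1] forms_closed
  by (auto simp: generated_def)

end

subsection \<open>The \<open>p\<close>-divisible part and normal forms\<close>

lemma (in abelian_group_hom) hom_finsum:
  "f \<in> I \<rightarrow> carrier G \<Longrightarrow> h (finsum G f I) = (\<Oplus>\<^bsub>H\<^esub>i\<in>I. h (f i))"
  by (induction I rule: infinite_finite_induct) (auto simp: Pi_def)

context witt_complex_over_W
begin

definition p_div :: "nat \<Rightarrow> 'e set" where
  "p_div n = {\<omega> \<in> carrier (cmp E n 1). \<forall>j. \<exists>\<nu>\<in>carrier (cmp E n 1). \<omega> = [(p ^ j)] \<cdot>\<^bsub>cmp E n 1\<^esub> \<nu>}"

lemma p_div_closed: "\<omega> \<in> p_div n \<Longrightarrow> \<omega> \<in> carrier (cmp E n 1)"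
  by (simp add: p_div_def)

lemma p_divisible_part_cmp_module:
  assumes n: "1 \<le> n" shows "p_divisible_part p (cmp_module E n 1) = p_div n"
proof -
  interpret G: abelian_group "cmp E n 1" by (rule E.grp[OF n])
  have pow: "[(m::nat)] \<cdot>\<^bsub>cmp_module E n 1\<^esub> x = [m] \<cdot>\<^bsub>cmp E n 1\<^esub> x" for m x
    by (simp add: cmp_module_def add_pow_def nat_pow_def)
  have car: "carrier (cmp_module E n 1) = carrier (cmp E n 1)" by (simp add: cmp_module_def)
  show ?thesis
  proof (intro equalityI subsetI)
    fix \<omega> assume \<omega>: "\<omega> \<in> p_divisible_part p (cmp_module E n 1)"
    then have div: "\<exists>\<nu>\<in>carrier (cmp E n 1). \<omega> = [(p ^ j)] \<cdot>\<^bsub>cmp E n 1\<^esub> \<nu>" if "1 \<le> j" for j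
      using that unfolding p_divisible_part_def by (auto simp: pow car)
    then have "\<omega> \<in> carrier (cmp E n 1)" using div[of 1] by auto
    then have "\<exists>\<nu>\<in>carrier (cmp E n 1). \<omega> = [(p ^ j)] \<cdot>\<^bsub>cmp E n 1\<^esub> \<nu>" for j
      using div[of j] by (cases "j = 0") (auto simp: G.nat_mult_1)
    then show "\<omega> \<in> p_div n" using \<open>\<omega> \<in> carrier (cmp E n 1)\<close> by (simp add: p_div_def)
  qed (auto simp: p_div_def p_divisible_part_def pow car)
qed

lemma p_div_image:
  assumes f: "abelian_group_hom (cmp E n 1) (cmp E n 1) f" and \<omega>: "\<omega> \<in> p_div n"
  shows "f \<omega> \<in> p_div n"
proof -
  interpret f: abelian_group_hom "cmp E n 1" "cmp E n 1" f by (rule f)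
  have "\<exists>\<nu>\<in>carrier (cmp E n 1). f \<omega> = [(p ^ j)] \<cdot>\<^bsub>cmp E n 1\<^esub> \<nu>" for j
  proof -
    obtain \<nu> where "\<nu> \<in> carrier (cmp E n 1)" "\<omega> = [(p ^ j)] \<cdot>\<^bsub>cmp E n 1\<^esub> \<nu>"
      using \<omega> by (auto simp: p_div_def)
    then show ?thesis by (intro bexI[of _ "f \<nu>"]) (simp_all add: f.hom_nat_mult)
  qed
  then show ?thesis using \<omega> by (simp add: p_div_def)
qed

lemma lam_mul_hom:
  "1 \<le> n \<Longrightarrow> x \<in> carrier (Wn p n A) \<Longrightarrow>
    abelian_group_hom (cmp E n 1) (cmp E n 1) (mul E n 0 1 (lam E n x))"
  using E.mul_left_hom[OF _ E.lam_closed, of n x 1] by simp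

context
  fixes n :: nat
  assumes n: "1 \<le> n"
begin

interpretation G: abelian_group "cmp E n 1" by (rule E.grp[OF n])
interpretation Wn: cring "Wn p n A" by (rule cring_Wn)

lemma p_div_zero: "\<zero>\<^bsub>cmp E n 1\<^esub> \<in> p_div n"
  by (auto simp: p_div_def intro!: bexI[of _ "\<zero>\<^bsub>cmp E n 1\<^esub>"])

lemma p_div_neg:
  assumes "\<omega> \<in> p_div n" shows "\<ominus>\<^bsub>cmp E n 1\<^esub> \<omega> \<in> p_div n"
  by (rule p_div_image[OF abelian_group_hom_additive[OF E.grp E.grp] assms])
    (use n in \<open>simp_all add: G.minus_add\<close>)

lemma p_div_add:
  assumes "\<omega> \<in> p_div n" "\<nu> \<in> p_div n" shows "\<omega> \<oplus>\<^bsub>cmp E n 1\<^esub> \<nu> \<in> p_div n"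
proof -
  have "\<exists>\<mu>\<in>carrier (cmp E n 1). \<omega> \<oplus>\<^bsub>cmp E n 1\<^esub> \<nu> = [(p ^ j)] \<cdot>\<^bsub>cmp E n 1\<^esub> \<mu>" for j
  proof -
    obtain a b where "a \<in> carrier (cmp E n 1)" "\<omega> = [(p ^ j)] \<cdot>\<^bsub>cmp E n 1\<^esub> a"
      "b \<in> carrier (cmp E n 1)" "\<nu> = [(p ^ j)] \<cdot>\<^bsub>cmp E n 1\<^esub> b"
      using assms unfolding p_div_def by blast
    then show ?thesis
      by (intro bexI[of _ "a \<oplus>\<^bsub>cmp E n 1\<^esub> b"]) (simp_all add: G.add.nat_pow_distrib)
  qed
  then show ?thesis using assms by (simp add: p_div_def)
qed

lemma diff_s_res_p_div: "a \<in> carrier A \<Longrightarrow> diff E n 0 (lam E n (s_res n a)) \<in> p_div n"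
  using diff_s_res_divisible[OF n] diff_lam_closed[OF n s_res_closed] by (simp add: p_div_def)

definition dV_form :: "(nat \<Rightarrow> 'k) \<Rightarrow> nat \<Rightarrow> 'e" where
  "dV_form a i = mul E n 0 1 (lam E n (s_res n a)) (dV n i)"

lemma dV_form_hom: "abelian_group_hom A (cmp E n 1) (\<lambda>a. dV_form a i)"
proof (rule abelian_group_hom_additive[OF A_cring.abelian_group_axioms G.abelian_group_axioms])
  fix a b assume ab: "a \<in> carrier A" "b \<in> carrier A"
  note l = E.lam_closed[OF n s_res_closed[OF ab(1)]] E.lam_closed[OF n s_res_closed[OF ab(2)]]
  show "dV_form a i \<in> carrier (cmp E n 1)"
    using E.mul_closed[OF n l(1) dV_closed[OF n]] by (simp add: dV_form_def)
  show "dV_form (a \<oplus>\<^bsub>A\<^esub> b) i = dV_form a i \<oplus>\<^bsub>cmp E n 1\<^esub> dV_form b i"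
    using E.mul_add_left[OF n l dV_closed[OF n]] E.lam_add[OF n s_res_closed[OF ab(1)] s_res_closed[OF ab(2)]]
      ring_hom_add[OF s_res_ring_hom ab] by (simp add: dV_form_def)
qed

lemma dV_form_closed: "a \<in> carrier A \<Longrightarrow> dV_form a i \<in> carrier (cmp E n 1)"
  by (rule abelian_group_hom.hom_closed[OF dV_form_hom])

lemma dV_form_p_power:
  assumes a: "a \<in> carrier A" shows "dV_form ([(p ^ i)] \<cdot>\<^bsub>A\<^esub> a) i = \<zero>\<^bsub>cmp E n 1\<^esub>"
proof -
  interpret f: abelian_group_hom "cmp E n 1" "cmp E n 1" "mul E n 0 1 (lam E n (s_res n a))"
    by (rule lam_mul_hom[OF n s_res_closed[OF a]])
  have "dV_form ([(p ^ i)] \<cdot>\<^bsub>A\<^esub> a) i = [(p ^ i)] \<cdot>\<^bsub>cmp E n 1\<^esub> dV_form a i"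
    by (rule abelian_group_hom.hom_nat_mult[OF dV_form_hom a])
  also have "\<dots> = \<zero>\<^bsub>cmp E n 1\<^esub>"
    using f.hom_nat_mult[OF dV_closed[OF n], of "p ^ i" i] p_power_dV[OF n] by (simp add: dV_form_def)
  finally show ?thesis .
qed

text \<open>On \<open>dV^i(1)\<close> the vector \<open>x = \<Sum>j. s_\<phi>(a_j) V^j(1)\<close>
  acts like \<open>s_\<phi>(b)\<close> with \<open>b = \<Sum>j. p^j a_j\<close>, which is the value
  at \<open>x\<close> of the ring homomorphism defining the module structure of
  \<open>E_n^1\<close>.\<close>

lemma lam_mul_dV:
  assumes x: "x \<in> carrier (Wn p n A)"
  shows "\<exists>b\<in>carrier A. mul E n 0 1 (lam E n x) (dV n i) = dV_form b i"
proof -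
  obtain a where a: "\<And>j. a j \<in> carrier A" "x = s_sum n a" using s_sum_surj[OF x] by blast
  interpret f: abelian_group_hom "Wn p n A" "cmp E n 1" "\<lambda>x. mul E n 0 1 (lam E n x) (dV n i)"
    by (rule abelian_group_hom_additive[OF Wn.abelian_group_axioms G.abelian_group_axioms])
      (use E.mul_closed[OF n E.lam_closed[OF n] dV_closed[OF n, of i]]
        E.mul_add_left[OF n E.lam_closed[OF n] E.lam_closed[OF n] dV_closed[OF n, of i]]
        in \<open>simp_all add: E.lam_add[OF n]\<close>)
  interpret t: abelian_group_hom A "cmp E n 1" "\<lambda>a. dV_form a i" by (rule dV_form_hom)
  have summand: "mul E n 0 1 (lam E n (s_res n (a j) \<otimes>\<^bsub>Wn p n A\<^esub> V_one n j)) (dV n i) =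
      dV_form ([(p ^ j)] \<cdot>\<^bsub>A\<^esub> a j) i" for j
  proof -
    note s = s_res_closed[OF a(1)[of j], of n]
    have "mul E n 0 1 (lam E n (s_res n (a j) \<otimes>\<^bsub>Wn p n A\<^esub> V_one n j)) (dV n i) =
        mul E n 0 1 (lam E n (s_res n (a j))) (mul E n 0 1 (lam E n (V_one n j)) (dV n i))"
      using E.mul_assoc[OF n E.lam_closed[OF n s] lam_V_one_closed[OF n] dV_closed[OF n]]
      by (simp add: E.lam_mul[OF n s V_one_closed])
    also have "\<dots> = [(p ^ j)] \<cdot>\<^bsub>cmp E n 1\<^esub> dV_form (a j) i"
      using abelian_group_hom.hom_nat_mult[OF lam_mul_hom[OF n s] dV_closed[OF n]]
      by (simp add: V_one_mul_dV[OF n] dV_form_def)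
    also have "\<dots> = dV_form ([(p ^ j)] \<cdot>\<^bsub>A\<^esub> a j) i"
      using t.hom_nat_mult[OF a(1)] by simp
    finally show ?thesis .
  qed
  have "mul E n 0 1 (lam E n x) (dV n i) = (\<Oplus>\<^bsub>cmp E n 1\<^esub>j\<in>{..<n}. dV_form ([(p ^ j)] \<cdot>\<^bsub>A\<^esub> a j) i)"
    unfolding a(2) s_sum_def using a(1)
    by (subst f.hom_finsum) (auto simp: s_res_closed V_one_closed summand)
  also have "\<dots> = dV_form (\<Oplus>\<^bsub>A\<^esub>j\<in>{..<n}. [(p ^ j)] \<cdot>\<^bsub>A\<^esub> a j) i"
    using a(1) by (subst t.hom_finsum) auto
  finally show ?thesis
    using a(1) by (intro bexI[of _ "\<Oplus>\<^bsub>A\<^esub>j\<in>{..<n}. [(p ^ j)] \<cdot>\<^bsub>A\<^esub> a j"]) (auto intro!: A_cring.finsum_closed)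
qed

section \<open>Normal forms up to \<open>p\<close>-divisible elements\<close>

definition dV_sum :: "(nat \<Rightarrow> nat \<Rightarrow> 'k) \<Rightarrow> 'e" where
  "dV_sum b = (\<Oplus>\<^bsub>cmp E n 1\<^esub>i\<in>{..<n}. dV_form (b i) i)"

definition normal_forms :: "'e set" where
  "normal_forms = {\<omega>. \<exists>\<sigma>\<in>p_div n. \<exists>b. (\<forall>i. b i \<in> carrier A) \<and> \<omega> = \<sigma> \<oplus>\<^bsub>cmp E n 1\<^esub> dV_sum b}"

lemma normal_formsI:
  "\<sigma> \<in> p_div n \<Longrightarrow> (\<And>i. b i \<in> carrier A) \<Longrightarrow> \<sigma> \<oplus>\<^bsub>cmp E n 1\<^esub> dV_sum b \<in> normal_forms"
  unfolding normal_forms_def by blast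

lemma dV_sum_closed: "(\<And>i. b i \<in> carrier A) \<Longrightarrow> dV_sum b \<in> carrier (cmp E n 1)"
  unfolding dV_sum_def by (intro G.finsum_closed) (simp add: dV_form_closed)

lemma dV_sum_add:
  assumes "\<And>i. b i \<in> carrier A" "\<And>i. c i \<in> carrier A"
  shows "dV_sum (\<lambda>i. b i \<oplus>\<^bsub>A\<^esub> c i) = dV_sum b \<oplus>\<^bsub>cmp E n 1\<^esub> dV_sum c"
proof -
  have "dV_form (b i \<oplus>\<^bsub>A\<^esub> c i) i = dV_form (b i) i \<oplus>\<^bsub>cmp E n 1\<^esub> dV_form (c i) i" for i
    by (rule abelian_group_hom.hom_add[OF dV_form_hom assms])
  then show ?thesis
    unfolding dV_sum_def using assms by (simp add: G.finsum_addf dV_form_closed)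
qed

lemma dV_sum_zero: "dV_sum (\<lambda>_. \<zero>\<^bsub>A\<^esub>) = \<zero>\<^bsub>cmp E n 1\<^esub>"
  unfolding dV_sum_def by (simp add: abelian_group_hom.hom_zero[OF dV_form_hom])

lemma dV_sum_single:
  assumes b: "b \<in> carrier A" and i: "i < n"
  shows "dV_sum (\<lambda>j. if j = i then b else \<zero>\<^bsub>A\<^esub>) = dV_form b i"
proof -
  have "dV_sum (\<lambda>j. if j = i then b else \<zero>\<^bsub>A\<^esub>) =
      (\<Oplus>\<^bsub>cmp E n 1\<^esub>j\<in>{..<n}. if i = j then dV_form b i else \<zero>\<^bsub>cmp E n 1\<^esub>)"
    unfolding dV_sum_def using b
    by (intro G.finsum_cong') (auto simp: dV_form_closed abelian_group_hom.hom_zero[OF dV_form_hom])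
  also have "\<dots> = dV_form b i"
    using G.finsum_singleton[of i "{..<n}" "\<lambda>_. dV_form b i"] b i by (simp add: dV_form_closed)
  finally show ?thesis .
qed

lemma normal_forms_add:
  assumes "\<omega> \<in> normal_forms" "\<nu> \<in> normal_forms" shows "\<omega> \<oplus>\<^bsub>cmp E n 1\<^esub> \<nu> \<in> normal_forms"
proof -
  obtain \<sigma> b \<tau> c where *: "\<sigma> \<in> p_div n" "\<And>i. b i \<in> carrier A" "\<omega> = \<sigma> \<oplus>\<^bsub>cmp E n 1\<^esub> dV_sum b"
    "\<tau> \<in> p_div n" "\<And>i. c i \<in> carrier A" "\<nu> = \<tau> \<oplus>\<^bsub>cmp E n 1\<^esub> dV_sum c"
    using assms unfolding normal_forms_def by blast
  have "\<omega> \<oplus>\<^bsub>cmp E n 1\<^esub> \<nu> = (\<sigma> \<oplus>\<^bsub>cmp E n 1\<^esub> \<tau>) \<oplus>\<^bsub>cmp E n 1\<^esub> dV_sum (\<lambda>i. b i \<oplus>\<^bsub>A\<^esub> c i)"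
    using * by (simp add: dV_sum_add dV_sum_closed p_div_closed G.a_ac)
  moreover have "b i \<oplus>\<^bsub>A\<^esub> c i \<in> carrier A" for i using * by simp
  ultimately show ?thesis using normal_formsI[OF p_div_add[OF *(1,4)]] by simp
qed

lemma p_div_normal: "\<sigma> \<in> p_div n \<Longrightarrow> \<sigma> \<in> normal_forms"
  unfolding normal_forms_def
  by (auto simp: dV_sum_zero p_div_closed intro!: bexI[of _ \<sigma>] exI[of _ "\<lambda>_. \<zero>\<^bsub>A\<^esub>"])

lemma dV_form_normal: "b \<in> carrier A \<Longrightarrow> i < n \<Longrightarrow> dV_form b i \<in> normal_forms"
  unfolding normal_forms_def
  by (auto simp: dV_sum_single dV_form_closed p_div_zero
      intro!: bexI[of _ "\<zero>\<^bsub>cmp E n 1\<^esub>"] exI[of _ "\<lambda>j. if j = i then b else \<zero>\<^bsub>A\<^esub>"])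

lemma normal_forms_neg:
  assumes "\<omega> \<in> normal_forms" shows "\<ominus>\<^bsub>cmp E n 1\<^esub> \<omega> \<in> normal_forms"
proof -
  obtain \<sigma> b where *: "\<sigma> \<in> p_div n" "\<And>i. b i \<in> carrier A" "\<omega> = \<sigma> \<oplus>\<^bsub>cmp E n 1\<^esub> dV_sum b"
    using assms unfolding normal_forms_def by blast
  have "dV_sum (\<lambda>i. \<ominus>\<^bsub>A\<^esub> b i) \<oplus>\<^bsub>cmp E n 1\<^esub> dV_sum b = \<zero>\<^bsub>cmp E n 1\<^esub>"
    using *(2) dV_sum_add[of "\<lambda>i. \<ominus>\<^bsub>A\<^esub> b i" b] by (simp add: A_cring.l_neg dV_sum_zero)
  then have "\<ominus>\<^bsub>cmp E n 1\<^esub> dV_sum b = dV_sum (\<lambda>i. \<ominus>\<^bsub>A\<^esub> b i)"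
    by (rule G.minus_equality) (use *(2) dV_sum_closed in auto)
  then have "\<ominus>\<^bsub>cmp E n 1\<^esub> \<omega> = \<ominus>\<^bsub>cmp E n 1\<^esub> \<sigma> \<oplus>\<^bsub>cmp E n 1\<^esub> dV_sum (\<lambda>i. \<ominus>\<^bsub>A\<^esub> b i)"
    using * by (simp add: G.minus_add p_div_closed dV_sum_closed)
  moreover have "\<ominus>\<^bsub>A\<^esub> b i \<in> carrier A" for i using * by simp
  ultimately show ?thesis using normal_formsI[OF p_div_neg[OF *(1)]] by simp
qed

lemma normal_forms_finsum:
  assumes "finite I" "\<And>i. i \<in> I \<Longrightarrow> f i \<in> normal_forms" "\<And>i. i \<in> I \<Longrightarrow> f i \<in> carrier (cmp E n 1)"
  shows "(\<Oplus>\<^bsub>cmp E n 1\<^esub>i\<in>I. f i) \<in> normal_forms"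
  using assms
  by (induction I rule: finite_induct) (auto simp: p_div_normal p_div_zero Pi_def normal_forms_add)

text \<open>The Leibniz rule splits \<open>d(s_\<phi>(a_i) V^i(1))\<close> into
  \<open>V^i(1) ds_\<phi>(a_i)\<close>, which is \<open>p\<close>-divisible, and
  \<open>s_\<phi>(a_i) dV^i(1)\<close>. Multiplication by \<open>x\<close> keeps the former
  \<open>p\<close>-divisible and turns the latter into some
  \<open>s_\<phi>(b) dV^i(1)\<close>.\<close>

lemma forms_normal:
  assumes "\<omega> \<in> forms n" shows "\<omega> \<in> normal_forms"
  using assms
proof (induction rule: forms.induct)
  case (gen x y)
  obtain a where a: "\<And>j. a j \<in> carrier A" "y = s_sum n a" using s_sum_surj[OF gen(2)] by blast
  interpret x: abelian_group_hom "cmp E n 1" "cmp E n 1" "mul E n 0 1 (lam E n x)"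
    by (rule lam_mul_hom[OF n gen(1)])
  interpret l: abelian_group_hom "Wn p n A" "cmp E n 0" "lam E n" by (rule lam_hom[OF n])
  interpret d: abelian_group_hom "cmp E n 0" "cmp E n 1" "diff E n 0"
    using E.diff_hom[OF n, of 0] by simp
  have c: "s_res n (a i) \<otimes>\<^bsub>Wn p n A\<^esub> V_one n i \<in> carrier (Wn p n A)" for i
    using a by (simp add: s_res_closed V_one_closed)
  have "mul E n 0 1 (lam E n x) (diff E n 0 (lam E n (s_res n (a i) \<otimes>\<^bsub>Wn p n A\<^esub> V_one n i))) \<in> normal_forms"
    if "i < n" for i
  proof -
    let ?s = "lam E n (s_res n (a i))" and ?v = "lam E n (V_one n i)"
    note sW = s_res_closed[OF a(1)[of i], of n]
    note s = E.lam_closed[OF n sW] and v = lam_V_one_closed[OF n, of i]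
    have ds: "diff E n 0 ?s \<in> p_div n" by (rule diff_s_res_p_div[OF a(1)])
    \<comment> \<open>No sign arises, since one of the factors has degree 0.\<close>
    have "mul E n 1 0 (diff E n 0 ?s) ?v = mul E n 0 1 ?v (diff E n 0 ?s)"
      using E.mul_comm[OF n p_div_closed[OF ds] v] by (simp add: signed_def)
    moreover have vds: "mul E n 0 1 ?v (diff E n 0 ?s) \<in> p_div n"
      by (rule p_div_image[OF lam_mul_hom[OF n V_one_closed] ds])
    moreover have "diff E n 0 (lam E n (s_res n (a i) \<otimes>\<^bsub>Wn p n A\<^esub> V_one n i)) =
        mul E n 1 0 (diff E n 0 ?s) ?v \<oplus>\<^bsub>cmp E n 1\<^esub> dV_form (a i) i"
      using E.diff_mul[OF n s v]
      by (simp add: E.lam_mul[OF n sW V_one_closed] signed_def dV_form_def dV_def)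
    ultimately have "mul E n 0 1 (lam E n x) (diff E n 0 (lam E n (s_res n (a i) \<otimes>\<^bsub>Wn p n A\<^esub> V_one n i))) =
        mul E n 0 1 (lam E n x) (mul E n 0 1 ?v (diff E n 0 ?s)) \<oplus>\<^bsub>cmp E n 1\<^esub>
        mul E n 0 1 (lam E n x) (dV_form (a i) i)"
      using a by (simp add: p_div_closed dV_form_closed)
    moreover have "mul E n 0 1 (lam E n x) (dV_form (a i) i) =
        mul E n 0 1 (lam E n (x \<otimes>\<^bsub>Wn p n A\<^esub> s_res n (a i))) (dV n i)"
      using E.mul_assoc[OF n E.lam_closed[OF n gen(1)] s dV_closed[OF n]]
      by (simp add: dV_form_def E.lam_mul[OF n gen(1) sW])
    moreover have "mul E n 0 1 (lam E n (x \<otimes>\<^bsub>Wn p n A\<^esub> s_res n (a i))) (dV n i) \<in> normal_forms"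
      using lam_mul_dV[OF Wn.m_closed[OF gen(1) sW], of i] dV_form_normal that by auto
    ultimately show ?thesis
      using normal_forms_add p_div_normal[OF p_div_image[OF x.abelian_group_hom_axioms vds]] by simp
  qed
  moreover have "mul E n 0 1 (lam E n x) (diff E n 0 (lam E n y)) =
      (\<Oplus>\<^bsub>cmp E n 1\<^esub>i\<in>{..<n}.
        mul E n 0 1 (lam E n x) (diff E n 0 (lam E n (s_res n (a i) \<otimes>\<^bsub>Wn p n A\<^esub> V_one n i))))"
    unfolding a(2) s_sum_def using c
    by (simp add: l.hom_finsum d.hom_finsum x.hom_finsum Pi_def)
  ultimately show ?case using c by (auto intro!: normal_forms_finsum)
qed (auto intro: normal_forms_add normal_forms_neg p_div_normal p_div_zero)

end

end

section \<open>Comparison with the complex \<open>E\<close>\<close>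

context witt_perfect
begin

declare One_nat_def [simp del] One_nat_def [symmetric, simp]

lemma p_ideal_ideal: "ideal (p_ideal p k j) A"
  by (rule A_cring.cgenideal_ideal) simp

lemma mem_p_ideal: "x \<in> p_ideal p k j \<longleftrightarrow> (\<exists>c\<in>carrier A. x = [(p ^ j)] \<cdot>\<^bsub>A\<^esub> c)"
proof -
  have "c \<otimes>\<^bsub>A\<^esub> ([(p ^ j)] \<cdot>\<^bsub>A\<^esub> \<one>\<^bsub>A\<^esub>) = [(p ^ j)] \<cdot>\<^bsub>A\<^esub> c" if "c \<in> carrier A" for c
    using that by (simp add: A_cring.add_pow_rdistr)
  then show ?thesis by (auto simp: cgenideal_def) metis
qed

lemma A_coset_ring_hom: "A_coset p k j \<in> ring_hom A (A_mod p k j)"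
  by (rule ideal.rcos_ring_hom[OF p_ideal_ideal])

lemma A_coset_surj: "X \<in> carrier (A_mod p k j) \<Longrightarrow> \<exists>a\<in>carrier A. X = A_coset p k j a"
  by (auto simp: FactRing_def A_RCOSETS_def')

lemma A_coset_zero_iff:
  assumes "a \<in> carrier A"
  shows "A_coset p k j a = \<zero>\<^bsub>A_mod p k j\<^esub> \<longleftrightarrow> a \<in> p_ideal p k j"
proof -
  interpret I: ideal "p_ideal p k j" A by (rule p_ideal_ideal)
  show ?thesis
    using I.rcos_const_imp_mem[OF assms] I.a_rcos_const[of a] by (auto simp: FactRing_def)
qed

lemma A_coset_zero: "A_coset p k j \<zero>\<^bsub>A\<^esub> = \<zero>\<^bsub>A_mod p k j\<^esub>"
  by (subst A_coset_zero_iff) (auto simp: mem_p_ideal intro!: bexI[of _ "\<zero>\<^bsub>A\<^esub>"])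

text \<open>Elements of \<open>E_n^1\<close> are handled through lifts to \<open>A\<close>, so that
  computing with cosets becomes computing in \<open>A\<close>.\<close>

definition E1_elem :: "nat \<Rightarrow> (nat \<Rightarrow> nat \<Rightarrow> 'k) \<Rightarrow> (nat \<Rightarrow> 'k) E_elem" where
  "E1_elem n b = Deg1 (\<lambda>j\<in>{..<n}. A_coset p k j (b j))"

lemma E1_elem_cong: "(\<And>j. j < n \<Longrightarrow> b j = c j) \<Longrightarrow> E1_elem n b = E1_elem n c"
  unfolding E1_elem_def by (rule arg_cong[of _ _ Deg1], rule restrict_ext) simp

lemma E1_elem_closed: "(\<And>j. b j \<in> carrier A) \<Longrightarrow> E1_elem n b \<in> carrier (E_cmp p k n 1)"
  using ring_hom_closed[OF A_coset_ring_hom] by (auto simp: E1_elem_def E_cmp_def)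

lemma E1_elem_surj:
  assumes "x \<in> carrier (E_cmp p k n 1)"
  obtains b where "\<And>j. b j \<in> carrier A" "x = E1_elem n b"
proof -
  obtain c where c: "x = Deg1 c" "c \<in> (\<Pi>\<^sub>E j\<in>{..<n}. carrier (A_mod p k j))"
    using assms by (auto simp: E_cmp_def)
  \<comment> \<open>A lift is asked for at every index; for \<open>j \<ge> n\<close> zero is
    taken.\<close>
  have "\<forall>j. \<exists>a. a \<in> carrier A \<and> (j < n \<longrightarrow> c j = A_coset p k j a)"
  proof
    fix j show "\<exists>a. a \<in> carrier A \<and> (j < n \<longrightarrow> c j = A_coset p k j a)"
      using c(2) A_coset_surj[of "c j" j] A_cring.zero_closed by (cases "j < n") auto
  qed
  then obtain b where b: "\<And>j. b j \<in> carrier A" "\<And>j. j < n \<Longrightarrow> c j = A_coset p k j (b j)"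
    by (auto dest!: choice)
  have "c = (\<lambda>j\<in>{..<n}. A_coset p k j (b j))"
    using c(2) b(2) by (auto simp: PiE_def extensional_def fun_eq_iff)
  then have "x = E1_elem n b" using c(1) by (simp only: E1_elem_def)
  then show thesis by (rule that[OF b(1)])
qed

lemma E1_elem_add:
  assumes "\<And>j. b j \<in> carrier A" "\<And>j. c j \<in> carrier A"
  shows "E1_elem n b \<oplus>\<^bsub>E_cmp p k n 1\<^esub> E1_elem n c = E1_elem n (\<lambda>j. b j \<oplus>\<^bsub>A\<^esub> c j)"
  using ring_hom_add[OF A_coset_ring_hom assms] by (simp add: E1_elem_def E_cmp_def fun_eq_iff)

lemma E1_elem_zero: "\<zero>\<^bsub>E_cmp p k n 1\<^esub> = E1_elem n (\<lambda>_. \<zero>\<^bsub>A\<^esub>)"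
  by (auto simp: E1_elem_def E_cmp_def A_coset_zero)

lemma E1_elem_eq_zero_iff:
  assumes "\<And>j. b j \<in> carrier A"
  shows "E1_elem n b = \<zero>\<^bsub>E_cmp p k n 1\<^esub> \<longleftrightarrow> (\<forall>j<n. b j \<in> p_ideal p k j)"
proof -
  have "E1_elem n b = \<zero>\<^bsub>E_cmp p k n 1\<^esub> \<longleftrightarrow> (\<forall>j<n. A_coset p k j (b j) = \<zero>\<^bsub>A_mod p k j\<^esub>)"
    by (auto simp: E1_elem_def E_cmp_def restrict_def fun_eq_iff)
  then show ?thesis by (simp add: A_coset_zero_iff assms)
qed

lemma E_cmp_1_group: "abelian_group (E_cmp p k n 1)"
proof (rule abelian_groupI, goal_cases)
  case (1 x y)
  then show ?case by (elim E1_elem_surj) (simp add: E1_elem_add E1_elem_closed)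
next
  case 2
  show ?case by (simp add: E1_elem_zero E1_elem_closed)
next
  case (3 x y z)
  then show ?case by (elim E1_elem_surj) (simp add: E1_elem_add A_cring.a_assoc)
next
  case (4 x y)
  then show ?case by (elim E1_elem_surj) (simp add: E1_elem_add A_cring.a_comm)
next
  case (5 x)
  then show ?case by (elim E1_elem_surj) (simp add: E1_elem_add E1_elem_zero)
next
  case (6 x)
  obtain b where b: "\<And>j. b j \<in> carrier A" "x = E1_elem n b" by (rule E1_elem_surj[OF 6]) (rule that)
  have "E1_elem n (\<lambda>j. \<ominus>\<^bsub>A\<^esub> b j) \<oplus>\<^bsub>E_cmp p k n 1\<^esub> x = \<zero>\<^bsub>E_cmp p k n 1\<^esub>"
    using b by (simp add: E1_elem_add E1_elem_zero A_cring.l_neg)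
  then show ?case using E1_elem_closed[of "\<lambda>j. \<ominus>\<^bsub>A\<^esub> b j" n] b(1) by auto
qed

lemma E1_elem_nat_mult:
  assumes "\<And>j. b j \<in> carrier A"
  shows "[(m::nat)] \<cdot>\<^bsub>E_cmp p k n 1\<^esub> E1_elem n b = E1_elem n (\<lambda>j. [m] \<cdot>\<^bsub>A\<^esub> b j)"
proof -
  interpret E1: abelian_group "E_cmp p k n 1" by (rule E_cmp_1_group)
  show ?thesis
    by (induction m) (simp_all add: E1_elem_zero E1_elem_add assms del: One_nat_def)
qed

text \<open>Only factors \<open>A/p^j A\<close> with \<open>j < n\<close> occur. Consequently an
  additive map into this group kills every element divisible by all powers of
  \<open>p\<close>.\<close>

lemma E_cmp_1_p_power:
  assumes "x \<in> carrier (E_cmp p k n 1)"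
  shows "[(p ^ n)] \<cdot>\<^bsub>E_cmp p k n 1\<^esub> x = \<zero>\<^bsub>E_cmp p k n 1\<^esub>"
proof -
  obtain b where b: "\<And>j. b j \<in> carrier A" "x = E1_elem n b" by (rule E1_elem_surj[OF assms]) (rule that)
  have "[(p ^ n)] \<cdot>\<^bsub>A\<^esub> b j = [(p ^ j)] \<cdot>\<^bsub>A\<^esub> ([(p ^ (n - j))] \<cdot>\<^bsub>A\<^esub> b j)" if "j < n" for j
    using that b by (simp add: A_cring.add.nat_pow_pow flip: power_add)
  then have "\<forall>j<n. [(p ^ n)] \<cdot>\<^bsub>A\<^esub> b j \<in> p_ideal p k j"
    using b(1) unfolding mem_p_ideal by blast
  then show ?thesis
    using E1_elem_eq_zero_iff[of "\<lambda>j. [(p ^ n)] \<cdot>\<^bsub>A\<^esub> b j" n] b by (simp add: E1_elem_nat_mult)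
qed

lemma E_diff_V_one:
  assumes i: "i < n"
  shows "diff (E_cx p k) n 0 (Deg0 (V_one n i)) = E1_elem n (\<lambda>j. if j = i then \<one>\<^bsub>A\<^esub> else \<zero>\<^bsub>A\<^esub>)"
proof -
  interpret Wn: cring "Wn p n A" by (rule cring_Wn)
  have "V_one n i = s_sum n (\<lambda>j. if j = i then \<one>\<^bsub>A\<^esub> else \<zero>\<^bsub>A\<^esub>)"
    using i by (simp add: s_sum_single V_one_closed ring_hom_one[OF s_res_ring_hom])
  then have "s_coeffs p k n (V_one n i) = (\<lambda>j\<in>{..<n}. if j = i then \<one>\<^bsub>A\<^esub> else \<zero>\<^bsub>A\<^esub>)"
    using s_coeffs_s_sum[of n "\<lambda>j. if j = i then \<one>\<^bsub>A\<^esub> else \<zero>\<^bsub>A\<^esub>"] by simp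
  then have "E1_elem n (s_coeffs p k n (V_one n i)) = E1_elem n (\<lambda>j. if j = i then \<one>\<^bsub>A\<^esub> else \<zero>\<^bsub>A\<^esub>)"
    by (intro E1_elem_cong) simp
  then show ?thesis by (simp add: E_cx_def E1_elem_def)
qed

text \<open>The expansion of \<open>s_\<phi>(b)\<close> has the single term
  \<open>s_\<phi>(b) V^0(1)\<close>. Hence \<open>s_\<phi>(b)\<close> acts on \<open>E_n^1\<close>
  as multiplication by \<open>b\<close>.\<close>

lemma wn_to_A_s_res:
  assumes n: "1 \<le> n" and b: "b \<in> carrier A" shows "wn_to_A p k n (s_res n b) = b"
proof -
  interpret Wn: cring "Wn p n A" by (rule cring_Wn)
  let ?c = "\<lambda>j. if j = 0 then b else \<zero>\<^bsub>A\<^esub>"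
  have "s_res n b = s_sum n ?c"
    using s_sum_single[OF b, of 0 n] n b by (simp add: V_one_def s_res_closed)
  then have "wn_to_A p k n (s_res n b) = (\<Oplus>\<^bsub>A\<^esub>j\<in>{..<n}. [(p ^ j)] \<cdot>\<^bsub>A\<^esub> restrict ?c {..<n} j)"
    using s_coeffs_s_sum[of n ?c] b by (simp add: wn_to_A_def)
  also have "\<dots> = (\<Oplus>\<^bsub>A\<^esub>j\<in>{..<n}. if 0 = j then b else \<zero>\<^bsub>A\<^esub>)"
    using b by (intro A_cring.finsum_cong') (auto simp: A_cring.nat_mult_1)
  also have "\<dots> = b"
    using A_cring.finsum_singleton[of 0 "{..<n}" "\<lambda>_. b"] n b by simp
  finally show ?thesis .
qed

lemma E_mul_s_res:
  assumes n: "1 \<le> n" and b: "b \<in> carrier A" and c: "\<And>j. c j \<in> carrier A"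
  shows "mul (E_cx p k) n 0 1 (Deg0 (s_res n b)) (E1_elem n c) = E1_elem n (\<lambda>j. b \<otimes>\<^bsub>A\<^esub> c j)"
  using ring_hom_mult[OF A_coset_ring_hom b c]
  by (simp add: E_cx_def E1_elem_def E_act_def wn_to_A_s_res[OF n b] fun_eq_iff)

end

section \<open>The comparison map on normal forms\<close>

locale comparison = witt_complex_over_W p k Om
  for p :: nat and k :: "('k, 'm) ring_scheme" and Om :: "(nat \<Rightarrow> 'k, 'e) witt_cx" +
  fixes n :: nat and \<eta> :: "nat \<Rightarrow> nat \<Rightarrow> 'e \<Rightarrow> (nat \<Rightarrow> 'k) E_elem"
  assumes n: "1 \<le> n" and init: "is_de_rham_witt p A Om"
    and hom: "witt_complex_hom p A Om (E_cx p k) \<eta>"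
begin

lemma cmp_E_cx: "cmp (E_cx p k) = E_cmp p k" and lam_E_cx: "lam (E_cx p k) m a = Deg0 a"
  by (simp_all add: E_cx_def)

lemma eta_hom: "abelian_group_hom (cmp Om n 1) (E_cmp p k n 1) (\<eta> n 1)"
  using witt_complex_hom_closed[OF hom n, of _ 1] witt_complex_hom_add[OF hom n, of _ 1]
  by (intro abelian_group_hom_additive E.grp n E_cmp_1_group) (simp_all add: cmp_E_cx)

lemma eta_dV_form:
  assumes b: "b \<in> carrier A" and i: "i < n"
  shows "\<eta> n 1 (dV_form n b i) = E1_elem n (\<lambda>j. if j = i then b else \<zero>\<^bsub>A\<^esub>)"
proof -
  note ops = witt_complex_hom_ops[OF hom n]
  have "\<eta> n 1 (dV n i) = E1_elem n (\<lambda>j. if j = i then \<one>\<^bsub>A\<^esub> else \<zero>\<^bsub>A\<^esub>)"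
    using ops(3)[OF lam_V_one_closed[OF n, of i]] ops(7)[OF V_one_closed, of i] i
    by (simp add: dV_def lam_E_cx E_diff_V_one)
  then have "\<eta> n 1 (dV_form n b i) =
      mul (E_cx p k) n 0 1 (Deg0 (s_res n b)) (E1_elem n (\<lambda>j. if j = i then \<one>\<^bsub>A\<^esub> else \<zero>\<^bsub>A\<^esub>))"
    using ops(2)[OF lam_s_res_closed[OF n b] dV_closed[OF n, of i]] ops(7)[OF s_res_closed[OF b]]
    by (simp add: dV_form_def[OF n] lam_E_cx)
  also have "\<dots> = E1_elem n (\<lambda>j. b \<otimes>\<^bsub>A\<^esub> (if j = i then \<one>\<^bsub>A\<^esub> else \<zero>\<^bsub>A\<^esub>))"
    by (rule E_mul_s_res[OF n b]) simp
  also have "\<dots> = E1_elem n (\<lambda>j. if j = i then b else \<zero>\<^bsub>A\<^esub>)"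
    using b by (intro E1_elem_cong) simp
  finally show ?thesis .
qed

lemma eta_dV_sum:
  assumes b: "\<And>i. b i \<in> carrier A" shows "\<eta> n 1 (dV_sum n b) = E1_elem n b"
proof -
  interpret \<eta>: abelian_group_hom "cmp Om n 1" "E_cmp p k n 1" "\<eta> n 1" by (rule eta_hom)
  have "(\<Oplus>\<^bsub>E_cmp p k n 1\<^esub>i\<in>{..<m}. \<eta> n 1 (dV_form n (b i) i)) =
      E1_elem n (\<lambda>j. if j < m then b j else \<zero>\<^bsub>A\<^esub>)" if "m \<le> n" for m
    using that
  proof (induction m)
    case 0
    then show ?case by (simp add: E1_elem_zero)
  next
    case (Suc m)
    have "(\<Oplus>\<^bsub>E_cmp p k n 1\<^esub>i\<in>{..<Suc m}. \<eta> n 1 (dV_form n (b i) i)) =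
        \<eta> n 1 (dV_form n (b m) m) \<oplus>\<^bsub>E_cmp p k n 1\<^esub>
        (\<Oplus>\<^bsub>E_cmp p k n 1\<^esub>i\<in>{..<m}. \<eta> n 1 (dV_form n (b i) i))"
      using b dV_form_closed[OF n] by (simp add: lessThan_Suc Pi_def)
    also have "\<dots> = E1_elem n (\<lambda>j. (if j = m then b m else \<zero>\<^bsub>A\<^esub>) \<oplus>\<^bsub>A\<^esub> (if j < m then b j else \<zero>\<^bsub>A\<^esub>))"
      using Suc b by (simp add: eta_dV_form E1_elem_add)
    also have "\<dots> = E1_elem n (\<lambda>j. if j < Suc m then b j else \<zero>\<^bsub>A\<^esub>)"
      using b by (intro E1_elem_cong) (auto simp: less_Suc_eq)
    finally show ?case .
  qed
  then have "\<eta> n 1 (dV_sum n b) = E1_elem n (\<lambda>j. if j < n then b j else \<zero>\<^bsub>A\<^esub>)"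
    unfolding dV_sum_def[OF n] using b dV_form_closed[OF n] by (subst \<eta>.hom_finsum) simp_all
  also have "\<dots> = E1_elem n b" by (rule E1_elem_cong) simp
  finally show ?thesis .
qed

lemma eta_p_div: "\<sigma> \<in> p_div n \<Longrightarrow> \<eta> n 1 \<sigma> = \<zero>\<^bsub>E_cmp p k n 1\<^esub>"
proof -
  interpret \<eta>: abelian_group_hom "cmp Om n 1" "E_cmp p k n 1" "\<eta> n 1" by (rule eta_hom)
  assume "\<sigma> \<in> p_div n"
  then obtain \<nu> where "\<nu> \<in> carrier (cmp Om n 1)" "\<sigma> = [(p ^ n)] \<cdot>\<^bsub>cmp Om n 1\<^esub> \<nu>"
    unfolding p_div_def by blast
  then show ?thesis by (simp add: \<eta>.hom_nat_mult E_cmp_1_p_power)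
qed

text \<open>On a normal form \<eta> kills the \<open>p\<close>-divisible summand and returns the
  classes of the \<open>b i\<close>. If these vanish, \<open>b i\<close> lies in
  \<open>p^i A\<close>, and \<open>dV_form_p_power\<close> makes the corresponding terms zero, which
  leaves the \<open>p\<close>-divisible summand.\<close>

lemma eta_zero_iff:
  assumes \<omega>: "\<omega> \<in> carrier (cmp Om n 1)"
  shows "\<eta> n 1 \<omega> = \<zero>\<^bsub>E_cmp p k n 1\<^esub> \<longleftrightarrow> \<omega> \<in> p_div n"
proof
  interpret G: abelian_group "cmp Om n 1" by (rule E.grp[OF n])
  interpret \<eta>: abelian_group_hom "cmp Om n 1" "E_cmp p k n 1" "\<eta> n 1" by (rule eta_hom)
  assume zero: "\<eta> n 1 \<omega> = \<zero>\<^bsub>E_cmp p k n 1\<^esub>"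
  obtain \<sigma> b where *: "\<sigma> \<in> p_div n" "\<And>i. b i \<in> carrier A" "\<omega> = \<sigma> \<oplus>\<^bsub>cmp Om n 1\<^esub> dV_sum n b"
    using forms_normal[OF n, of \<omega>] \<omega> forms_eq_carrier[OF init n] unfolding normal_forms_def[OF n] by blast
  have "E1_elem n b = \<zero>\<^bsub>E_cmp p k n 1\<^esub>"
    using zero eta_p_div[OF *(1)] eta_dV_sum[OF *(2)] E1_elem_closed[of b n] *
    by (simp add: p_div_closed dV_sum_closed[OF n])
  then have "dV_form n (b i) i = \<zero>\<^bsub>cmp Om n 1\<^esub>" if "i < n" for i
    using that E1_elem_eq_zero_iff[of b n] *(2) dV_form_p_power[OF n] by (auto simp: mem_p_ideal)
  then have "dV_sum n b = \<zero>\<^bsub>cmp Om n 1\<^esub>"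
    unfolding dV_sum_def[OF n] by (intro G.add.finprod_one_eqI) simp
  then show "\<omega> \<in> p_div n" using * by (simp add: p_div_closed)
qed (rule eta_p_div)

lemma eta_surj: "\<eta> n 1 ` carrier (cmp Om n 1) = carrier (E_cmp p k n 1)"
proof (intro equalityI subsetI)
  fix x assume x: "x \<in> carrier (E_cmp p k n 1)"
  obtain b where "\<And>j. b j \<in> carrier A" "x = E1_elem n b" by (rule E1_elem_surj[OF x]) (rule that)
  then show "x \<in> \<eta> n 1 ` carrier (cmp Om n 1)"
    using eta_dV_sum[of b] dV_sum_closed[OF n, of b] by (metis imageI)
qed (use abelian_group_hom.hom_closed[OF eta_hom] in auto)

section \<open>The induced isomorphism of \<open>W_n(A)\<close>-modules\<close>

abbreviation "M \<equiv> cmp_module Om n 1"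
abbreviation "N \<equiv> cmp_module (E_cx p k) n 1"
abbreviation "S \<equiv> p_divisible_part p M"

lemma module_simps:
  "carrier M = carrier (cmp Om n 1)" "x \<oplus>\<^bsub>M\<^esub> y = x \<oplus>\<^bsub>cmp Om n 1\<^esub> y" "\<zero>\<^bsub>M\<^esub> = \<zero>\<^bsub>cmp Om n 1\<^esub>"
  "a \<odot>\<^bsub>M\<^esub> x = mul Om n 0 1 (lam Om n a) x"
  "carrier N = carrier (E_cmp p k n 1)" "z \<oplus>\<^bsub>N\<^esub> w = z \<oplus>\<^bsub>E_cmp p k n 1\<^esub> w" "\<zero>\<^bsub>N\<^esub> = \<zero>\<^bsub>E_cmp p k n 1\<^esub>"
  "a \<odot>\<^bsub>N\<^esub> z = mul (E_cx p k) n 0 1 (Deg0 a) z"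
  by (simp_all add: cmp_module_def cmp_E_cx lam_E_cx)

lemma S_eq: "S = p_div n"
  by (rule p_divisible_part_cmp_module[OF n])

lemma eta_module_hom: "abelian_group_hom M N (\<eta> n 1)"
proof -
  interpret \<eta>: abelian_group_hom "cmp Om n 1" "E_cmp p k n 1" "\<eta> n 1" by (rule eta_hom)
  show ?thesis
  proof (rule abelian_group_hom_additive)
    show "abelian_group M"
      by (rule abelian_groupI)
        (auto simp: module_simps \<eta>.G.a_ac intro!: bexI[of _ "\<ominus>\<^bsub>cmp Om n 1\<^esub> _"] \<eta>.G.l_neg)
    show "abelian_group N"
      by (rule abelian_groupI)
        (auto simp: module_simps \<eta>.H.a_ac intro!: bexI[of _ "\<ominus>\<^bsub>E_cmp p k n 1\<^esub> _"] \<eta>.H.l_neg)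
  qed (simp_all add: module_simps)
qed

lemma eta_smult:
  "a \<in> carrier (Wn p n A) \<Longrightarrow> \<omega> \<in> carrier M \<Longrightarrow> \<eta> n 1 (a \<odot>\<^bsub>M\<^esub> \<omega>) = a \<odot>\<^bsub>N\<^esub> \<eta> n 1 \<omega>"
  using witt_complex_hom_ops(2)[OF hom n E.lam_closed[OF n], of a \<omega> 1] witt_complex_hom_ops(7)[OF hom n, of a]
  by (simp add: module_simps lam_E_cx)

text \<open>With \<open>S\<close> presented as a kernel, its subgroup property and the isomorphism
  theorem for groups become available.\<close>

lemma kernel_eta: "kernel (add_monoid M) (add_monoid N) (\<eta> n 1) = S"
  unfolding S_eq using eta_zero_iff p_div_closed by (auto simp: kernel_def module_simps)

lemma submodule_S: "submodule S (Wn p n A) M"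
proof (intro submodule.intro submodule_axioms.intro)
  interpret \<eta>: abelian_group_hom M N "\<eta> n 1" by (rule eta_module_hom)
  show "subgroup S (add_monoid M)"
    using group_hom.subgroup_kernel[OF \<eta>.a_group_hom] by (simp add: kernel_eta)
  show "a \<odot>\<^bsub>M\<^esub> x \<in> S" if "a \<in> carrier (Wn p n A)" "x \<in> S" for a x
    using p_div_image[OF lam_mul_hom[OF n that(1)]] that(2) by (simp add: S_eq module_simps)
qed

lemma eta_coset: "\<omega> \<in> carrier M \<Longrightarrow> x \<in> S +>\<^bsub>M\<^esub> \<omega> \<Longrightarrow> x \<in> carrier M \<and> \<eta> n 1 x = \<eta> n 1 \<omega>"
proof -
  interpret \<eta>: abelian_group_hom M N "\<eta> n 1" by (rule eta_module_hom)
  assume \<omega>: "\<omega> \<in> carrier M" and "x \<in> S +>\<^bsub>M\<^esub> \<omega>"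
  then obtain s where s: "s \<in> S" "x = s \<oplus>\<^bsub>M\<^esub> \<omega>" by (auto simp: a_r_coset_def')
  then have "s \<in> carrier M" "\<eta> n 1 s = \<zero>\<^bsub>N\<^esub>"
    using eta_p_div p_div_closed by (auto simp: S_eq module_simps)
  then show ?thesis using s \<omega> by simp
qed

lemma coset_self: "\<omega> \<in> carrier M \<Longrightarrow> \<omega> \<in> S +>\<^bsub>M\<^esub> \<omega>"
proof -
  interpret G: abelian_group "cmp Om n 1" by (rule E.grp[OF n])
  show "\<omega> \<in> carrier M \<Longrightarrow> \<omega> \<in> S +>\<^bsub>M\<^esub> \<omega>"
    using p_div_zero[OF n] by (auto simp: a_r_coset_def' S_eq module_simps intro!: bexI[of _ "\<zero>\<^bsub>M\<^esub>"])
qed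

lemma quotient_iso:
  "\<exists>\<psi>\<in>module_iso (Wn p n A) (quot_module M S) N. \<forall>\<omega>\<in>carrier M. \<psi> (S +>\<^bsub>M\<^esub> \<omega>) = \<eta> n 1 \<omega>"
proof
  interpret \<eta>: abelian_group_hom M N "\<eta> n 1" by (rule eta_module_hom)
  interpret h: group_hom "add_monoid M" "add_monoid N" "\<eta> n 1" by (rule \<eta>.a_group_hom)
  let ?\<psi> = "\<lambda>X. the_elem (\<eta> n 1 ` X)"
  have the_elem: "?\<psi> X = v" if "X \<noteq> {}" "\<And>x. x \<in> X \<Longrightarrow> \<eta> n 1 x = v" for X v
  proof -
    have "\<eta> n 1 ` X = {v}" using that by auto
    then show ?thesis by simp
  qed
  have coset: "?\<psi> (S +>\<^bsub>M\<^esub> \<omega>) = \<eta> n 1 \<omega>" if "\<omega> \<in> carrier M" for \<omega>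
  proof (rule the_elem)
    show "S +>\<^bsub>M\<^esub> \<omega> \<noteq> {}" using coset_self[OF that] by blast
    show "\<eta> n 1 x = \<eta> n 1 \<omega>" if "x \<in> S +>\<^bsub>M\<^esub> \<omega>" for x
      using eta_coset[OF \<open>\<omega> \<in> carrier M\<close> that] by blast
  qed
  then show "\<forall>\<omega>\<in>carrier M. ?\<psi> (S +>\<^bsub>M\<^esub> \<omega>) = \<eta> n 1 \<omega>" by blast
  have "\<eta> n 1 ` carrier (add_monoid M) = carrier (add_monoid N)"
    using eta_surj by (simp add: module_simps)
  from h.FactGroup_iso_set[OF this] have "?\<psi> \<in> iso (add_monoid M Mod S) (add_monoid N)"
    by (simp only: kernel_eta)
  then have iso: "?\<psi> \<in> iso (add_monoid (quot_module M S)) (add_monoid N)"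
    by (simp add: iso_def hom_def FactGroup_def quot_module_def A_RCOSETS_def set_add_def)
  have "?\<psi> (a \<odot>\<^bsub>quot_module M S\<^esub> X) = a \<odot>\<^bsub>N\<^esub> ?\<psi> X"
    if a: "a \<in> carrier (Wn p n A)" and X: "X \<in> carrier (quot_module M S)" for a X
  proof -
    obtain \<omega> where \<omega>: "\<omega> \<in> carrier M" "X = S +>\<^bsub>M\<^esub> \<omega>"
      using X by (auto simp: quot_module_def A_RCOSETS_def')
    have am: "a \<odot>\<^bsub>M\<^esub> x \<in> carrier M" if "x \<in> carrier M" for x
      using abelian_group_hom.hom_closed[OF lam_mul_hom[OF n a]] that by (simp add: module_simps)
    \<comment> \<open>Scalar multiplication on the quotient is a union of cosets. The union is
      nonempty and \<eta> is constant on it, so \<open>the_elem\<close> can be evaluated without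
      identifying the union with a single coset.\<close>
    have "?\<psi> (\<Union>x\<in>X. S +>\<^bsub>M\<^esub> (a \<odot>\<^bsub>M\<^esub> x)) = a \<odot>\<^bsub>N\<^esub> \<eta> n 1 \<omega>"
    proof (rule the_elem)
      show "(\<Union>x\<in>X. S +>\<^bsub>M\<^esub> (a \<odot>\<^bsub>M\<^esub> x)) \<noteq> {}"
        using \<omega> coset_self am by blast
      fix y assume "y \<in> (\<Union>x\<in>X. S +>\<^bsub>M\<^esub> (a \<odot>\<^bsub>M\<^esub> x))"
      then obtain x where x: "x \<in> X" "y \<in> S +>\<^bsub>M\<^esub> (a \<odot>\<^bsub>M\<^esub> x)" by blast
      then have "x \<in> carrier M" "\<eta> n 1 x = \<eta> n 1 \<omega>" using eta_coset \<omega> by auto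
      then show "\<eta> n 1 y = a \<odot>\<^bsub>N\<^esub> \<eta> n 1 \<omega>"
        using eta_coset[OF am x(2)] eta_smult[OF a] by simp
    qed
    then show ?thesis using coset[OF \<omega>(1)] \<omega>(2) by (simp add: quot_module_def)
  qed
  then show "?\<psi> \<in> module_iso (Wn p n A) (quot_module M S) N"
    using iso by (simp add: module_iso_def)
qed

end

theorem proposition4p2:
  fixes p n :: nat
    and k :: "('k, 'm) ring_scheme"
    and Om :: "(nat \<Rightarrow> 'k, 'e) witt_cx"
    and \<eta> :: "nat \<Rightarrow> nat \<Rightarrow> 'e \<Rightarrow> (nat \<Rightarrow> 'k) E_elem"
  assumes "prime p" and "odd p" and "perfect_ring p k" and "n \<ge> 1"
    and "is_de_rham_witt p (W p k) Om"
    and "witt_complex_hom p (W p k) Om (E_cx p k) \<eta>"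
  shows "let M = cmp_module Om n 1; N = cmp_module (E_cx p k) n 1; S = p_divisible_part p M in
           submodule S (Wn p n (W p k)) M \<and>
           (\<exists>\<psi> \<in> module_iso (Wn p n (W p k)) (quot_module M S) N.
              \<forall>\<omega> \<in> carrier M. \<psi> (S +>\<^bsub>M\<^esub> \<omega>) = \<eta> n 1 \<omega>)"
proof -
  have "witt_complex p (W p k) Om" using assms(5) by (simp add: is_de_rham_witt_def)
  then interpret comparison p k Om n \<eta>
    using assms by (intro comparison.intro witt_complex_over_W.intro witt_perfect.intro
        comparison_axioms.intro) auto
  show ?thesis unfolding Let_def using submodule_S quotient_iso by blast
qed

end
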